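(* Let $n\ge 2$ and let $\int:A_o(n)\to\mathbb{C}$ be the Haar functional of $A_o(n)$. For every integer $k\ge 1$ and all indices $i_1,\dots,i_{2k},j_1,\dots,j_{2k}\in\{1,\dots,n\}$, $$\int u_{i_1j_1}\cdots u_{i_{2k}j_{2k}}=\sum_{p,q\in D(k)}\delta_{pi}\,\delta_{qj}\,W_{kn}(p,q),$$ and for every integer $k\ge 0$ and all indices $i_1,\dots,i_{2k+1},j_1,\dots,j_{2k+1}\in\{1,\dots,n\}$, $$\int u_{i_1j_1}\cdots u_{i_{2k+1}j_{2k+1}}=0.$$
   Context: $A_o(n)$ is the universal (unital) $C^*$-algebra generated by $n^2$ elements $u_{ij}$, $1\le i,j\le n$, subject to the relations making $u=(u_{ij})$ an orthogonal matrix, i.e. $u_{ij}=u_{ij}^*$ for all $i,j$ and $uu^t=u^tu=1$. It is a Hopf $C^*$-algebra with comultiplication $\Delta(u_{ij})=\sum_{k} u_{ik}\otimes u_{kj}$. The Haar functional $\int:A_o(n)\to\mathbb{C}$ is the unique positive unital linear form satisfying $(\mathrm{id}\otimes\int)\Delta(a)=(\int\otimes \mathrm{id})\Delta(a)=(\int a)\,1$ for all $a$ (its existence and uniqueness is due to Woronowicz). $D(k)$ is the set of Temperley-Lieb diagrams with $k$ upper and $k$ lower points; it is identified (by reading the lower row from left to right as $1,\dots,k$ and the upper row from right to left as $k+1,\dots,2k$) with the set of non-crossing pair partitions of $\{1,\dots,2k\}$. For $p\in D(k)$ and a multi-index $i=(i_1,\dots,i_{2k})$, $\delta_{pi}=1$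 if $i_a=i_b$ whenever $\{a,b\}$ is a pair (string) of $p$, and $\delta_{pi}=0$ otherwise. For $p,q\in D(k)$, $l(p,q)$ is the number of loops obtained by closing the composed diagram $p^*q$; equivalently, the number of connected components of the graph on $\{1,\dots,2k\}$ whose edges are the pairs of $p$ and the pairs of $q$. The Gram matrix is $G_{kn}(p,q)=n^{l(p,q)}$ for $p,q\in D(k)$ (it is invertible for $n\geq 2$), and the Weingarten matrix is $W_{kn}=G_{kn}^{-1}$. *)

theory Defs
  imports
    "HOL-Analysis.Analysis"
    "HOL-Library.Poly_Mapping"
    "HOL-Library.Disjoint_Sets"
begin

section \<open>Unital C*-algebras\<close>

text \<open>
  Non-zero unital C*-algebras. Completeness, submultiplicativity of the norm and
  \<open>norm 1 = 1\<close> come from the two parent classes.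
\<close>

class unital_cstar_algebra = real_normed_algebra_1 + banach +
  fixes scaleC :: "complex \<Rightarrow> 'a \<Rightarrow> 'a"
    and star :: "'a \<Rightarrow> 'a"
  assumes scaleR_eq_scaleC: "scaleR r x = scaleC (complex_of_real r) x"
    and scaleC_add_right: "scaleC c (x + y) = scaleC c x + scaleC c y"
    and scaleC_add_left: "scaleC (c + d) x = scaleC c x + scaleC d x"
    and scaleC_scaleC: "scaleC c (scaleC d x) = scaleC (c * d) x"
    and mult_scaleC_left: "scaleC c x * y = scaleC c (x * y)"
    and mult_scaleC_right: "x * scaleC c y = scaleC c (x * y)"
    and norm_scaleC: "norm (scaleC c x) = cmod c * norm x"
    and star_add: "star (x + y) = star x + star y"
    and star_scaleC: "star (scaleC c x) = scaleC (cnj c) (star x)"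
    and star_mult: "star (x * y) = star y * star x"
    and star_star: "star (star x) = x"
    and norm_star_mult_self: "norm (star x * x) = (norm x)\<^sup>2"

definition clinear_map :: "('a::unital_cstar_algebra \<Rightarrow> 'b::unital_cstar_algebra) \<Rightarrow> bool" where
  "clinear_map f \<longleftrightarrow>
     (\<forall>x y. f (x + y) = f x + f y) \<and> (\<forall>c x. f (scaleC c x) = scaleC c (f x))"

definition clinear_form :: "('a::unital_cstar_algebra \<Rightarrow> complex) \<Rightarrow> bool" where
  "clinear_form f \<longleftrightarrow>
     (\<forall>x y. f (x + y) = f x + f y) \<and> (\<forall>c x. f (scaleC c x) = c * f x)"

definition star_hom :: "('a::unital_cstar_algebra \<Rightarrow> 'b::unital_cstar_algebra) \<Rightarrow> bool" where
  "star_hom f \<longleftrightarrow> clinear_map f \<and> f 1 = 1 \<and>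
     (\<forall>x y. f (x * y) = f x * f y) \<and> (\<forall>x. f (star x) = star (f x))"

definition positive_form :: "('a::unital_cstar_algebra \<Rightarrow> complex) \<Rightarrow> bool" where
  "positive_form f \<longleftrightarrow> (\<forall>x. f (star x * x) \<in> \<real> \<and> 0 \<le> Re (f (star x * x)))"


section \<open>Universal C*-algebras given by generators and relations\<close>

text \<open>
  Words in letters \<open>g\<close> and \<open>g\<^sup>*\<close>, with concatenation written additively: this makes
  \<open>'g word \<Rightarrow>\<^sub>0 complex\<close>, with the convolution product of \<^theory>\<open>HOL-Library.Poly_Mapping\<close>,
  the free unital *-algebra on the generators.
\<close>

datatype 'g letter = Gen 'g | Adj 'g

datatype 'g word = Word "'g letter list"

instantiation word :: (type) monoid_add
begin

fun plus_word :: "'a word \<Rightarrow> 'a word \<Rightarrow> 'a word" where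
  "Word xs + Word ys = Word (xs @ ys)"

definition zero_word :: "'a word" where
  "0 = Word []"

instance
proof
  fix a b c :: "'a word"
  show "a + b + c = a + (b + c)" by (cases a; cases b; cases c) simp
  show "0 + a = a" by (cases a) (simp add: zero_word_def)
  show "a + 0 = a" by (cases a) (simp add: zero_word_def)
qed

end

type_synonym 'g free_star_algebra = "'g word \<Rightarrow>\<^sub>0 complex"

abbreviation gen :: "'g \<Rightarrow> 'g free_star_algebra" where
  "gen g \<equiv> Poly_Mapping.single (Word [Gen g]) 1"

abbreviation free_scale :: "complex \<Rightarrow> 'g free_star_algebra \<Rightarrow> 'g free_star_algebra" where
  "free_scale c \<equiv> Poly_Mapping.map ((*) c)"

fun adj_letter :: "'g letter \<Rightarrow> 'g letter" where
  "adj_letter (Gen g) = Adj g"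
| "adj_letter (Adj g) = Gen g"

fun adj_word :: "'g word \<Rightarrow> 'g word" where
  "adj_word (Word ls) = Word (rev (map adj_letter ls))"

definition free_star :: "'g free_star_algebra \<Rightarrow> 'g free_star_algebra" where
  "free_star P =
     (\<Sum>w\<in>Poly_Mapping.keys P. Poly_Mapping.single (adj_word w) (cnj (Poly_Mapping.lookup P w)))"

fun eval_letter :: "('g \<Rightarrow> 'a::unital_cstar_algebra) \<Rightarrow> 'g letter \<Rightarrow> 'a" where
  "eval_letter v (Gen g) = v g"
| "eval_letter v (Adj g) = star (v g)"

fun eval_word :: "('g \<Rightarrow> 'a::unital_cstar_algebra) \<Rightarrow> 'g word \<Rightarrow> 'a" where
  "eval_word v (Word ls) = prod_list (map (eval_letter v) ls)"

definition eval_free :: "('g \<Rightarrow> 'a::unital_cstar_algebra) \<Rightarrow> 'g free_star_algebra \<Rightarrow> 'a" where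
  "eval_free v P =
     (\<Sum>w\<in>Poly_Mapping.keys P. scaleC (Poly_Mapping.lookup P w) (eval_word v w))"

definition cstar_seminorm :: "('g free_star_algebra \<Rightarrow> real) \<Rightarrow> bool" where
  "cstar_seminorm p \<longleftrightarrow>
     (\<forall>P Q. p (P + Q) \<le> p P + p Q) \<and>
     (\<forall>c P. p (free_scale c P) = cmod c * p P) \<and>
     (\<forall>P Q. p (P * Q) \<le> p P * p Q) \<and>
     (\<forall>P. p (free_star P * P) = (p P)\<^sup>2)"

text \<open>
  The universal C*-algebra on generators subject to relations \<open>r = 0\<close>, \<open>r \<in> R\<close>, is the
  separated completion of the free *-algebra for the largest C*-seminorm killing \<open>R\<close>. The
  predicate below says that the target of the tuple \<open>u\<close>, together with \<open>u\<close>, is such a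
  completion. C*-seminorms are used because HOL cannot quantify over the carrier types of all
  C*-algebras: the C*-seminorms killing \<open>R\<close> are exactly the functions \<open>P \<mapsto> \<parallel>P(v)\<parallel>\<close> for \<open>v\<close> a
  solution of the relations in some unital C*-algebra (possibly zero). That the predicate yields the universal
  property in its usual form, for an arbitrary target C*-algebra, is proved below in
  \<open>universal_cstar_algebra_property\<close>.
\<close>

definition universal_cstar_algebra ::
  "'g free_star_algebra set \<Rightarrow> ('g \<Rightarrow> 'a::unital_cstar_algebra) \<Rightarrow> bool" where
  "universal_cstar_algebra R u \<longleftrightarrow>
     (\<forall>r\<in>R. eval_free u r = 0) \<and>
     closure (range (eval_free u)) = UNIV \<and>
     (\<forall>p. cstar_seminorm p \<and> (\<forall>r\<in>R. p r = 0) \<longrightarrow> (\<forall>P. p P \<le> norm (eval_free u P)))"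


subsection \<open>The universal property\<close>

lemma scaleC_zero_left: "scaleC 0 (x::'a::unital_cstar_algebra) = 0"
  using scaleC_add_left[of 0 0 x] by simp

lemma scaleC_zero_right: "scaleC c (0::'a::unital_cstar_algebra) = 0"
  using scaleC_add_right[of c 0 "0::'a"] by simp

lemma scaleC_one: "scaleC 1 (x::'a::unital_cstar_algebra) = x"
  using scaleR_eq_scaleC[of 1 x] by simp

lemma star_zero: "star (0::'a::unital_cstar_algebra) = 0"
  using star_add[of 0 "0::'a"] by simp

lemma star_one: "star (1::'a::unital_cstar_algebra) = 1"
  using star_mult[of "star 1" "1::'a"] by (simp add: star_star)

lemma star_uminus: "star (- x) = - star (x::'a::unital_cstar_algebra)"
  using star_add[of x "- x"] by (simp add: star_zero eq_neg_iff_add_eq_0 add.commute)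

lemma star_diff: "star (x - y) = star x - star (y::'a::unital_cstar_algebra)"
  using star_add[of x "- y"] by (simp add: star_uminus)

lemma star_sum: "star (sum f A) = (\<Sum>x\<in>A. star (f x :: 'a::unital_cstar_algebra))"
  by (induction A rule: infinite_finite_induct) (simp_all add: star_zero star_add)

lemma norm_star: "norm (star x) = norm (x::'a::unital_cstar_algebra)"
proof -
  have le: "norm y \<le> norm (star y)" for y :: 'a
  proof (cases "y = 0")
    case False
    have "norm y * norm y \<le> norm (star y) * norm y"
      using norm_mult_ineq[of "star y" y] by (simp add: norm_star_mult_self power2_eq_square)
    with False show ?thesis by simp
  qed simp
  show ?thesis using le[of x] le[of "star x"] by (simp add: star_star)
qed

lemma eval_free_superset:
  assumes "finite S" "Poly_Mapping.keys P \<subseteq> S"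
  shows "eval_free v P = (\<Sum>w\<in>S. scaleC (Poly_Mapping.lookup P w) (eval_word v w))"
  unfolding eval_free_def using assms
  by (intro sum.mono_neutral_left) (auto simp: in_keys_iff scaleC_zero_left)

lemma eval_free_zero: "eval_free v 0 = 0"
  by (simp add: eval_free_def)

lemma eval_free_add: "eval_free v (P + Q) = eval_free v P + eval_free v Q"
proof -
  let ?S = "Poly_Mapping.keys P \<union> Poly_Mapping.keys Q"
  have "Poly_Mapping.keys (P + Q) \<subseteq> ?S" by (rule keys_add)
  then show ?thesis
    by (simp add: eval_free_superset[of ?S] lookup_add scaleC_add_left sum.distrib)
qed

lemma eval_free_sum: "eval_free v (sum f A) = (\<Sum>x\<in>A. eval_free v (f x))"
  by (induction A rule: infinite_finite_induct) (simp_all add: eval_free_zero eval_free_add)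

lemma eval_free_single: "eval_free v (Poly_Mapping.single w c) = scaleC c (eval_word v w)"
  by (simp add: eval_free_def scaleC_zero_left)

lemma eval_free_gen: "eval_free v (gen g) = v g"
  by (simp add: eval_free_single scaleC_one)

lemma free_decomp:
  fixes P :: "'g free_star_algebra"
  shows "P = (\<Sum>w\<in>Poly_Mapping.keys P. Poly_Mapping.single w (Poly_Mapping.lookup P w))"
  by (rule poly_mapping_eqI) (auto simp: lookup_sum lookup_single when_def in_keys_iff)

lemma eval_word_add: "eval_word v (w + w') = eval_word v w * eval_word v w'"
  by (cases w; cases w') simp

lemma eval_free_one: "eval_free v 1 = 1"
  by (simp add: single_one[symmetric] eval_free_single zero_word_def scaleC_one del: single_one)

lemma eval_free_mult: "eval_free v (P * Q) = eval_free v P * eval_free v Q"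
proof -
  have "P * Q = (\<Sum>w\<in>Poly_Mapping.keys P. \<Sum>w'\<in>Poly_Mapping.keys Q.
      Poly_Mapping.single (w + w') (Poly_Mapping.lookup P w * Poly_Mapping.lookup Q w'))"
    by (subst free_decomp[of P], subst free_decomp[of Q]) (simp add: sum_product mult_single)
  then show ?thesis
    by (simp add: eval_free_sum eval_free_single eval_word_add)
      (simp add: eval_free_def sum_product mult_scaleC_left mult_scaleC_right scaleC_scaleC
        mult.commute)
qed

lemma eval_free_scale: "eval_free v (free_scale c P) = scaleC c (eval_free v P)"
  by (simp add: mult_map_scale_conv_mult eval_free_mult eval_free_single zero_word_def
      mult_scaleC_left)

lemma eval_letter_adj: "eval_letter v (adj_letter l) = star (eval_letter v l)"
  by (cases l) (simp_all add: star_star)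

lemma eval_word_adj: "eval_word v (adj_word w) = star (eval_word v w)"
proof (cases w)
  case (Word ls)
  have "prod_list (map (eval_letter v) (rev (map adj_letter ls))) =
      star (prod_list (map (eval_letter v) ls))"
    by (induction ls) (simp_all add: star_one star_mult eval_letter_adj)
  with Word show ?thesis by simp
qed

lemma eval_free_star: "eval_free v (free_star P) = star (eval_free v P)"
  by (simp add: free_star_def eval_free_sum eval_free_single eval_word_adj)
    (simp add: eval_free_def star_sum star_scaleC)

lemma cstar_seminorm_eval: "cstar_seminorm (\<lambda>P. norm (eval_free v P))"
  by (auto simp: cstar_seminorm_def eval_free_add eval_free_scale eval_free_mult eval_free_star
      norm_scaleC norm_star_mult_self norm_triangle_ineq norm_mult_ineq)

lemma eval_free_diff: "eval_free v (P - Q) = eval_free v P - eval_free v Q"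
  using eval_free_add[of v "P - Q" Q] by simp

lemma star_hom_eval_free:
  assumes "star_hom f"
  shows "f (eval_free u P) = eval_free (f \<circ> u) P"
proof -
  have add: "f (x + y) = f x + f y" and sc: "f (scaleC c x) = scaleC c (f x)"
    and one: "f 1 = 1" and mult: "f (x * y) = f x * f y" and st: "f (star x) = star (f x)"
    for x y c using assms by (auto simp: star_hom_def clinear_map_def)
  have zero: "f 0 = 0" using add[of 0 0] by simp
  have let': "f (eval_letter u l) = eval_letter (f \<circ> u) l" for l
    by (cases l) (simp_all add: st)
  have word: "f (eval_word u w) = eval_word (f \<circ> u) w" for w
  proof (cases w)
    case (Word ls)
    have "f (prod_list (map (eval_letter u) ls)) = prod_list (map (eval_letter (f \<circ> u)) ls)"
      by (induction ls) (simp_all add: one mult let' del: o_apply)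
    with Word show ?thesis by simp
  qed
  have sum: "f (sum g A) = (\<Sum>x\<in>A. f (g x))" for g and A :: "'c word set"
    by (induction A rule: infinite_finite_induct) (simp_all add: zero add)
  show ?thesis by (simp add: eval_free_def sum sc word)
qed

text \<open>
  Continuity of *-homomorphisms between C*-algebras is automatic; it is listed here only to
  keep the proof elementary.
\<close>

theorem universal_cstar_algebra_property:
  fixes u :: "'g \<Rightarrow> 'a::unital_cstar_algebra" and v :: "'g \<Rightarrow> 'b::unital_cstar_algebra"
  assumes univ: "universal_cstar_algebra R u" and rel: "\<forall>r\<in>R. eval_free v r = 0"
  shows "\<exists>!f. star_hom f \<and> continuous_on UNIV f \<and> (\<forall>g. f (u g) = v g)"
proof -
  let ?D = "range (eval_free u)"
  have dense: "closure ?D = UNIV" using univ by (simp add: universal_cstar_algebra_def)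
  have le: "norm (eval_free v P) \<le> norm (eval_free u P)" for P
    using univ rel cstar_seminorm_eval[of v]
    unfolding universal_cstar_algebra_def by (metis norm_zero)
  define f0 where "f0 x = eval_free v (SOME P. eval_free u P = x)" for x
  have f0: "f0 (eval_free u P) = eval_free v P" for P
  proof -
    define Q where "Q = (SOME Q. eval_free u Q = eval_free u P)"
    have "eval_free u Q = eval_free u P" unfolding Q_def by (rule someI) simp
    then have "norm (eval_free v (Q - P)) \<le> 0"
      using le[of "Q - P"] by (simp add: eval_free_diff)
    then show ?thesis by (simp add: f0_def Q_def[symmetric] eval_free_diff)
  qed
  have "uniformly_continuous_on ?D f0"
    unfolding uniformly_continuous_on_def
  proof (intro allI impI)
    fix e :: real assume "e > 0"
    then show "\<exists>d>0. \<forall>x\<in>?D. \<forall>x'\<in>?D. dist x' x < d \<longrightarrow> dist (f0 x') (f0 x) < e"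
      using le by (intro exI[of _ e])
        (auto simp: f0 dist_norm eval_free_diff[symmetric] intro: le_less_trans)
  qed
  then obtain f where uc: "uniformly_continuous_on (closure ?D) f"
    and ext: "\<And>x. x \<in> ?D \<Longrightarrow> f0 x = f x"
    by (rule uniformly_continuous_on_extension_on_closure) blast
  have cont: "continuous_on UNIV f"
    using uniformly_continuous_imp_continuous[OF uc] dense by simp
  have f: "f (eval_free u P) = eval_free v P" for P using ext f0 by fastforce
  have lim: "(\<lambda>k. f (X k)) \<longlonglongrightarrow> f x" if "X \<longlonglongrightarrow> x" for X x
    using continuous_on_tendsto_compose[OF cont that] by simp
  have seq: "\<exists>P. (\<lambda>k. eval_free u (P k)) \<longlonglongrightarrow> x" for x
  proof -
    have "x \<in> closure ?D" using dense by simp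
    then obtain X where X: "\<And>k. X k \<in> ?D" "X \<longlonglongrightarrow> x"
      unfolding closure_sequential by blast
    then have "\<forall>k. \<exists>P. X k = eval_free u P" by blast
    then obtain P where "\<And>k. X k = eval_free u (P k)" by metis
    then have "X = (\<lambda>k. eval_free u (P k))" by auto
    with X(2) show ?thesis by auto
  qed
  have star_lim: "(\<lambda>k. star (X k)) \<longlonglongrightarrow> star x" if "X \<longlonglongrightarrow> x"
    for X and x :: "'c::unital_cstar_algebra"
    using that unfolding tendsto_iff by (simp add: dist_norm star_diff[symmetric] norm_star)
  have scale_lim: "(\<lambda>k. scaleC c (X k)) \<longlonglongrightarrow> scaleC c x" if "X \<longlonglongrightarrow> x"
    for X c and x :: "'c::unital_cstar_algebra"
  proof -
    have "(\<lambda>k. scaleC c 1 * X k) \<longlonglongrightarrow> scaleC c 1 * x" by (intro tendsto_intros that)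
    then show ?thesis by (simp add: mult_scaleC_left)
  qed
  have add: "f (x + y) = f x + f y" and mult: "f (x * y) = f x * f y" for x y
  proof -
    obtain P Q where P: "(\<lambda>k. eval_free u (P k)) \<longlonglongrightarrow> x"
      and Q: "(\<lambda>k. eval_free u (Q k)) \<longlonglongrightarrow> y" using seq by metis
    show "f (x + y) = f x + f y"
      using lim[OF tendsto_add[OF P Q]] tendsto_add[OF lim[OF P] lim[OF Q]]
      by (intro LIMSEQ_unique) (simp_all add: f eval_free_add[symmetric])
    show "f (x * y) = f x * f y"
      using lim[OF tendsto_mult[OF P Q]] tendsto_mult[OF lim[OF P] lim[OF Q]]
      by (intro LIMSEQ_unique) (simp_all add: f eval_free_mult[symmetric])
  qed
  have scale: "f (scaleC c x) = scaleC c (f x)" and st: "f (star x) = star (f x)" for c x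
  proof -
    obtain P where P: "(\<lambda>k. eval_free u (P k)) \<longlonglongrightarrow> x" using seq by metis
    show "f (scaleC c x) = scaleC c (f x)"
      using lim[OF scale_lim[OF P]] scale_lim[OF lim[OF P]]
      by (intro LIMSEQ_unique) (simp_all add: f eval_free_scale[symmetric])
    show "f (star x) = star (f x)"
      using lim[OF star_lim[OF P]] star_lim[OF lim[OF P]]
      by (intro LIMSEQ_unique) (simp_all add: f eval_free_star[symmetric])
  qed
  have one: "f 1 = 1" using f[of 1] by (simp add: eval_free_one)
  have gens: "f (u g) = v g" for g using f[of "gen g"] by (simp add: eval_free_gen)
  show ?thesis
  proof (rule ex1I[of _ f])
    show "star_hom f \<and> continuous_on UNIV f \<and> (\<forall>g. f (u g) = v g)"
      by (simp add: star_hom_def clinear_map_def add mult scale st one cont gens)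
  next
    fix f' assume f': "star_hom f' \<and> continuous_on UNIV f' \<and> (\<forall>g. f' (u g) = v g)"
    then have "f' \<circ> u = v" by auto
    then have f'_eval: "f' (eval_free u P) = eval_free v P" for P
      using star_hom_eval_free[of f' u P] f' by simp
    show "f' = f"
    proof
      fix x
      obtain P where P: "(\<lambda>k. eval_free u (P k)) \<longlonglongrightarrow> x" using seq by metis
      have "(\<lambda>k. f' (eval_free u (P k))) \<longlonglongrightarrow> f' x"
        using f' continuous_on_tendsto_compose[of UNIV f', OF _ P] by simp
      with lim[OF P] show "f' x = f x"
        by (intro LIMSEQ_unique) (simp_all add: f f'_eval)
    qed
  qed
qed


section \<open>The algebra \<open>A\<^sub>o(n)\<close> and its Haar functional\<close>

text \<open>
  The index set \<open>{1, \<dots>, n}\<close> is the finite type \<open>'n\<close>, with \<open>n = CARD('n)\<close>. The relations are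
  \<open>u\<^sub>i\<^sub>j = u\<^sub>i\<^sub>j\<^sup>*\<close>, \<open>u u\<^sup>t = 1\<close> and \<open>u\<^sup>t u = 1\<close>.
\<close>

definition orthogonal_relations :: "('n::finite \<times> 'n) free_star_algebra set" where
  "orthogonal_relations =
     {gen (i, j) - free_star (gen (i, j)) | i j. True} \<union>
     {(\<Sum>k\<in>UNIV. gen (i, k) * gen (j, k)) - (if i = j then 1 else 0) | i j. True} \<union>
     {(\<Sum>k\<in>UNIV. gen (k, i) * gen (k, j)) - (if i = j then 1 else 0) | i j. True}"

definition is_A_o :: "('n::finite \<Rightarrow> 'n \<Rightarrow> 'a::unital_cstar_algebra) \<Rightarrow> bool" where
  "is_A_o u \<longleftrightarrow> universal_cstar_algebra orthogonal_relations (\<lambda>(i, j). u i j)"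

text \<open>
  \<open>is_cstar_tensor \<tau>\<close> says that the target of \<open>\<tau>\<close> is a completion of the algebraic tensor
  product \<open>'a \<odot> 'b\<close> for some C*-norm, with \<open>a \<otimes> b = \<tau> a b\<close>. The fourth conjunct is the
  criterion for the linear map induced by \<open>\<tau>\<close> on \<open>'a \<odot> 'b\<close> to be injective. The C*-norm is
  left arbitrary, so the minimal and the maximal tensor product are both covered.
\<close>

definition is_cstar_tensor ::
  "('a::unital_cstar_algebra \<Rightarrow> 'b::unital_cstar_algebra \<Rightarrow> 't::unital_cstar_algebra) \<Rightarrow> bool" where
  "is_cstar_tensor \<tau> \<longleftrightarrow>
     (\<forall>a. clinear_map (\<tau> a)) \<and> (\<forall>b. clinear_map (\<lambda>a. \<tau> a b)) \<and>
     (\<tau> 1 1 = 1 \<and> (\<forall>a b a' b'. \<tau> a b * \<tau> a' b' = \<tau> (a * a') (b * b')) \<and>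
       (\<forall>a b. star (\<tau> a b) = \<tau> (star a) (star b))) \<and>
     (\<forall>(m::nat) a b.
        (\<forall>c. (\<Sum>s<m. scaleC (c s) (b s)) = 0 \<longrightarrow> (\<forall>s<m. c s = 0)) \<longrightarrow>
        (\<Sum>s<m. \<tau> (a s) (b s)) = 0 \<longrightarrow> (\<forall>s<m. a s = 0)) \<and>
     closure {\<Sum>s<m. \<tau> (a s) (b s) | (m::nat) a b. True} = UNIV"

definition is_comultiplication ::
  "('n::finite \<Rightarrow> 'n \<Rightarrow> 'a::unital_cstar_algebra) \<Rightarrow> ('a \<Rightarrow> 'a \<Rightarrow> 't::unital_cstar_algebra) \<Rightarrow>
   ('a \<Rightarrow> 't) \<Rightarrow> bool" where
  "is_comultiplication u \<tau> \<Delta> \<longleftrightarrow>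
     star_hom \<Delta> \<and> (\<forall>i j. \<Delta> (u i j) = (\<Sum>k\<in>UNIV. \<tau> (u i k) (u k j)))"

text \<open>
  The slice maps \<open>id \<otimes> h\<close> and \<open>h \<otimes> id\<close>: the continuous linear maps on the completed tensor
  product with the given values on elementary tensors. By density each is unique when it
  exists; for positive \<open>h\<close> it does exist.
\<close>

definition is_id_tensor ::
  "('a \<Rightarrow> 'b \<Rightarrow> 't) \<Rightarrow> ('b::unital_cstar_algebra \<Rightarrow> complex) \<Rightarrow>
   ('t::unital_cstar_algebra \<Rightarrow> 'a::unital_cstar_algebra) \<Rightarrow> bool" where
  "is_id_tensor \<tau> h S \<longleftrightarrow>
     clinear_map S \<and> continuous_on UNIV S \<and> (\<forall>a b. S (\<tau> a b) = scaleC (h b) a)"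

definition is_tensor_id ::
  "('a \<Rightarrow> 'b \<Rightarrow> 't) \<Rightarrow> ('a::unital_cstar_algebra \<Rightarrow> complex) \<Rightarrow>
   ('t::unital_cstar_algebra \<Rightarrow> 'b::unital_cstar_algebra) \<Rightarrow> bool" where
  "is_tensor_id \<tau> h T \<longleftrightarrow>
     clinear_map T \<and> continuous_on UNIV T \<and> (\<forall>a b. T (\<tau> a b) = scaleC (h a) b)"

definition is_haar_functional ::
  "('a::unital_cstar_algebra \<Rightarrow> 'a \<Rightarrow> 't::unital_cstar_algebra) \<Rightarrow> ('a \<Rightarrow> 't) \<Rightarrow>
   ('a \<Rightarrow> complex) \<Rightarrow> bool" where
  "is_haar_functional \<tau> \<Delta> h \<longleftrightarrow>
     clinear_form h \<and> positive_form h \<and> h 1 = 1 \<and>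
     (\<exists>S T. is_id_tensor \<tau> h S \<and> is_tensor_id \<tau> h T \<and>
        (\<forall>a. S (\<Delta> a) = scaleC (h a) 1 \<and> T (\<Delta> a) = scaleC (h a) 1))"


section \<open>Temperley-Lieb diagrams and the Weingarten matrix\<close>

text \<open>
  Diagrams in \<open>D(k)\<close> are encoded as non-crossing pair partitions of \<open>{1, \<dots>, 2k}\<close>: the lower
  points, from left to right, are \<open>1, \<dots>, k\<close> and the upper points, from right to left, are
  \<open>k + 1, \<dots>, 2k\<close>. A multi-index \<open>(i\<^sub>1, \<dots>, i\<^sub>2\<^sub>k)\<close> is a function on \<open>nat\<close>, read on \<open>{1..2 * k}\<close>
  only.
\<close>

definition TL_diagrams :: "nat \<Rightarrow> nat set set set" where
  "TL_diagrams k =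
     {p. partition_on {1..2 * k} p \<and> (\<forall>B\<in>p. card B = 2) \<and>
         \<not> (\<exists>a b c d. a < b \<and> b < c \<and> c < d \<and> {a, c} \<in> p \<and> {b, d} \<in> p)}"

definition diagram_delta :: "nat set set \<Rightarrow> (nat \<Rightarrow> 'n) \<Rightarrow> complex" where
  "diagram_delta p i = (if \<forall>a b. {a, b} \<in> p \<longrightarrow> i a = i b then 1 else 0)"

text \<open>
  The number of connected components of the graph on \<open>{1, \<dots>, 2k}\<close> with edge set \<open>p \<union> q\<close>.
\<close>

definition loops :: "nat \<Rightarrow> nat set set \<Rightarrow> nat set set \<Rightarrow> nat" where
  "loops k p q = card ({1..2 * k} // {(a, b). {a, b} \<in> p \<union> q}\<^sup>*)"

definition gram :: "nat \<Rightarrow> nat \<Rightarrow> nat set set \<Rightarrow> nat set set \<Rightarrow> complex" where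
  "gram k n p q = of_nat n ^ loops k p q"

text \<open>The inverse of a square matrix indexed by a finite set \<open>I\<close>, extended by \<open>0\<close> off \<open>I \<times> I\<close>.\<close>

definition matrix_inverse_on :: "'i set \<Rightarrow> ('i \<Rightarrow> 'i \<Rightarrow> complex) \<Rightarrow> 'i \<Rightarrow> 'i \<Rightarrow> complex" where
  "matrix_inverse_on I G =
     (THE W. (\<forall>p q. p \<notin> I \<or> q \<notin> I \<longrightarrow> W p q = 0) \<and>
        (\<forall>p\<in>I. \<forall>q\<in>I. (\<Sum>r\<in>I. G p r * W r q) = (if p = q then 1 else 0)) \<and>
        (\<forall>p\<in>I. \<forall>q\<in>I. (\<Sum>r\<in>I. W p r * G r q) = (if p = q then 1 else 0)))"

definition weingarten :: "nat \<Rightarrow> nat \<Rightarrow> nat set set \<Rightarrow> nat set set \<Rightarrow> complex" where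
  "weingarten k n = matrix_inverse_on (TL_diagrams k) (gram k n)"

end

theory Submission
  imports Defs
begin

text \<open>
  Let \<open>P\<close> be the matrix of moments \<open>\<integral> u\<^sub>i\<^sub>1\<^sub>j\<^sub>1 \<dots> u\<^sub>i\<^sub>m\<^sub>j\<^sub>m\<close> and \<open>Q\<close> the orthogonal projection onto the
  span of the vectors \<open>\<delta>\<^sub>p\<close>. Orthogonality of \<open>u\<close> makes each \<open>\<delta>\<^sub>p\<close> a fixed vector of the tensor power of
  \<open>u\<close>, so \<open>P Q = Q\<close>. For the converse, the projections \<open>Q\<close> in all degrees define a functional on the
  free *-algebra that vanishes on the ideal generated by the relations. It is positive because the
  Temperley-Lieb spaces form an algebra of matrices closed under transposition, so by the GNS
  construction and the universal property it descends to \<open>A\<^sub>o(n)\<close>. Applied to the invariance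
  \<open>\<Sum>\<^sub>k (\<integral> u\<^sub>i\<^sub>k) u\<^sub>k\<^sub>j = (\<integral> u\<^sub>i\<^sub>j) 1\<close> it gives \<open>P Q = P\<close>. Hence \<open>P = Q\<close>, and writing \<open>Q\<close> in terms of the
  linearly independent vectors \<open>\<delta>\<^sub>p\<close> brings in the inverse of their Gram matrix.
\<close>

section \<open>Function spaces on a finite set\<close>

text \<open>The obstacle is P Q = P. Invariance by itself only says that the rows of P are invariant
  under u, and nothing so far prevents the C*-algebra from having invariant vectors beyond the
  Temperley-Lieb ones. In place of a duality theorem, one functional with moments Q serves as a
  witness. It can be applied to an identity in A_o(n) only if it kills every element of the free
  algebra that evaluates to zero there, which is more than the ideal of the relations; hence
  positivity and boundedness. Universality is phrased by C*-seminorms, so the operator seminorm of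
  the GNS space is used directly. Positivity must hold for elements of mixed degree, so all words of
  length at most M are treated together. Bending the row index of a matrix, from (x, y) to the word
  \<open>rev x @ y\<close>, turns moments into entries of the projection onto a matrix algebra. All
  vectors are real, and complex coefficients are split into real and imaginary parts.\<close>

definition function_subspace :: "('x \<Rightarrow> real) set \<Rightarrow> bool" where
  "function_subspace S \<longleftrightarrow> (\<lambda>_. 0) \<in> S \<and> (\<forall>f\<in>S. \<forall>g\<in>S. (\<lambda>x. f x + g x) \<in> S) \<and>
     (\<forall>c. \<forall>f\<in>S. (\<lambda>x. c * f x) \<in> S)"

text \<open>Inner products run over \<open>X\<close>, while the expansion is demanded at every point
  of the type; this is consistent because the spaces in question vanish off
  \<open>X\<close>.\<close>

definition orthonormal_basis :: "'x set \<Rightarrow> ('x \<Rightarrow> real) set \<Rightarrow> ('x \<Rightarrow> real) set \<Rightarrow> bool" where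
  "orthonormal_basis X S B \<longleftrightarrow> finite B \<and> B \<subseteq> S \<and>
     (\<forall>b\<in>B. \<forall>c\<in>B. (\<Sum>x\<in>X. b x * c x) = (if b = c then 1 else 0)) \<and>
     (\<forall>f\<in>S. \<forall>x. f x = (\<Sum>b\<in>B. (\<Sum>y\<in>X. f y * b y) * b x))"

lemma orthonormal_basisD:
  assumes "orthonormal_basis X S B"
  shows "finite B" "B \<subseteq> S"
    "b \<in> B \<Longrightarrow> c \<in> B \<Longrightarrow> (\<Sum>x\<in>X. b x * c x) = (if b = c then 1 else 0)"
    "f \<in> S \<Longrightarrow> f x = (\<Sum>b\<in>B. (\<Sum>y\<in>X. f y * b y) * b x)"
proof -
  note * = assms[unfolded orthonormal_basis_def]
  show "finite B" using * by (elim conjE)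
  show "B \<subseteq> S" using * by (elim conjE)
  show "b \<in> B \<Longrightarrow> c \<in> B \<Longrightarrow> (\<Sum>x\<in>X. b x * c x) = (if b = c then 1 else 0)"
    using * by (elim conjE) (drule (1) bspec, erule (1) bspec)
  show "f \<in> S \<Longrightarrow> f x = (\<Sum>b\<in>B. (\<Sum>y\<in>X. f y * b y) * b x)"
    using * by (elim conjE) (drule (1) bspec, erule spec)
qed

lemma function_subspace_sum:
  assumes "function_subspace S" "\<And>a. a \<in> A \<Longrightarrow> f a \<in> S"
  shows "(\<lambda>x. \<Sum>a\<in>A. c a * f a x) \<in> S"
  using assms(2)
proof (induction A rule: infinite_finite_induct)
  case (insert a A)
  have "(\<lambda>x. c a * f a x) \<in> S" "(\<lambda>x. \<Sum>a\<in>A. c a * f a x) \<in> S"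
    using insert assms(1) by (auto simp: function_subspace_def)
  then have "(\<lambda>x. c a * f a x + (\<Sum>a\<in>A. c a * f a x)) \<in> S"
    using assms(1) by (auto simp: function_subspace_def)
  with insert show ?case by simp
qed (use assms(1) in \<open>auto simp: function_subspace_def\<close>)

lemma function_subspace_diff:
  assumes "function_subspace S" "f \<in> S" "g \<in> S"
  shows "(\<lambda>x. f x - g x) \<in> S"
proof -
  have "(\<lambda>x. (-1) * g x) \<in> S" using assms unfolding function_subspace_def by blast
  with assms have "(\<lambda>x. f x + (\<lambda>x. (-1) * g x) x) \<in> S"
    unfolding function_subspace_def by (elim conjE) (drule (1) bspec, erule (1) bspec)
  then show ?thesis by simp
qed

text \<open>
  Induction on the domain: the functions of \<open>S\<close> vanishing at one more point form a subspace of
  codimension at most one.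
\<close>

lemma orthonormal_basis_exists:
  assumes "finite X" "function_subspace S" "\<And>f x. f \<in> S \<Longrightarrow> x \<notin> X \<Longrightarrow> f x = 0"
  shows "\<exists>B. orthonormal_basis X S B"
  using assms
proof (induction X arbitrary: S rule: finite_induct)
  case empty
  then have "orthonormal_basis {} S {}" by (auto simp: orthonormal_basis_def)
  then show ?case by blast
next
  case (insert a X)
  define S' where "S' = {f \<in> S. f a = 0}"
  have sub': "function_subspace S'" using insert.prems(1) by (auto simp: S'_def function_subspace_def)
  have "\<exists>B. orthonormal_basis X S' B"
    by (rule insert.IH[OF sub']) (use insert.prems(2) in \<open>auto simp: S'_def; metis\<close>)
  then obtain B where B: "orthonormal_basis X S' B" ..
  note fin = orthonormal_basisD(1)[OF B] and BS = orthonormal_basisD(2)[OF B]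
    and on = orthonormal_basisD(3)[OF B] and rep = orthonormal_basisD(4)[OF B]
  have Ba: "b a = 0" if "b \<in> B" for b using BS that by (auto simp: S'_def)
  let ?Y = "insert a X"
  have Y: "(\<Sum>x\<in>?Y. f x * g x) = f a * g a + (\<Sum>x\<in>X. f x * g x)" for f g :: "'a \<Rightarrow> real"
    using insert.hyps by simp
  show ?case
  proof (cases "S = S'")
    case True
    then have "orthonormal_basis ?Y S B"
      unfolding orthonormal_basis_def Y using fin BS on rep by (simp add: Ba)
    then show ?thesis by blast
  next
    case False
    then obtain g where g: "g \<in> S" "g a \<noteq> 0" by (auto simp: S'_def)
    \<comment> \<open>\<open>q\<close> is the projection of \<open>g\<close> onto \<open>S'\<close>.
      All of \<open>B\<close> vanishes at \<open>a\<close>, so orthogonality of \<open>d\<close> to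
      \<open>B\<close> over \<open>X\<close> is orthogonality over \<open>insert a X\<close>, while
      \<open>d a\<close> stays nonzero.\<close>
    define q where "q = (\<lambda>x. \<Sum>b\<in>B. (\<Sum>y\<in>X. g y * b y) * b x)"
    have qS: "q \<in> S'" unfolding q_def by (rule function_subspace_sum[OF sub']) (use BS in auto)
    define d where "d = (\<lambda>x. g x - q x)"
    have dS: "d \<in> S" unfolding d_def
      by (rule function_subspace_diff) (use insert.prems(1) g qS in \<open>auto simp: S'_def\<close>)
    have da: "d a \<noteq> 0" using g qS by (auto simp: d_def S'_def)
    have qb: "(\<Sum>x\<in>X. q x * b x) = (\<Sum>y\<in>X. g y * b y)" if "b \<in> B" for b
    proof -
      have "(\<Sum>x\<in>X. q x * b x) = (\<Sum>x\<in>X. \<Sum>c\<in>B. (\<Sum>y\<in>X. g y * c y) * (c x * b x))"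
        by (simp add: q_def sum_distrib_right mult.assoc)
      also have "\<dots> = (\<Sum>c\<in>B. (\<Sum>y\<in>X. g y * c y) * (\<Sum>x\<in>X. c x * b x))"
        by (subst sum.swap) (simp add: sum_distrib_left)
      also have "\<dots> = (\<Sum>c\<in>B. if c = b then (\<Sum>y\<in>X. g y * c y) else 0)"
        by (rule sum.cong) (use on that in auto)
      finally show ?thesis using that fin by simp
    qed
    have db: "(\<Sum>x\<in>X. d x * b x) = 0" if "b \<in> B" for b
      using qb[OF that] by (simp add: d_def left_diff_distrib sum_subtractf)
    define s where "s = (\<Sum>x\<in>?Y. d x * d x)"
    have s0: "s > 0" unfolding s_def
      by (rule sum_pos2[of _ a]) (use insert.hyps da in \<open>auto simp: zero_less_mult_iff linorder_neq_iff\<close>)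
    define e where "e = (\<lambda>x. (1 / sqrt s) * d x)"
    have eS: "e \<in> S" using dS insert.prems(1) unfolding e_def function_subspace_def by blast
    have ea: "e a \<noteq> 0" using da s0 by (simp add: e_def)
    have ee: "(\<Sum>x\<in>?Y. e x * e x) = 1"
    proof -
      have "e x * e x = (1 / s) * (d x * d x)" for x
        using s0 by (simp add: e_def real_sqrt_mult_self)
      then have "(\<Sum>x\<in>?Y. e x * e x) = (\<Sum>x\<in>?Y. (1 / s) * (d x * d x))" by (simp only:)
      also have "\<dots> = (1 / s) * s" unfolding s_def sum_distrib_left ..
      finally show ?thesis using s0 by simp
    qed
    have eb: "(\<Sum>x\<in>X. e x * b x) = 0" if "b \<in> B" for b
      using db[OF that] by (simp add: e_def sum_divide_distrib[symmetric])
    have be: "(\<Sum>x\<in>X. b x * e x) = 0" if "b \<in> B" for b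
      using eb[OF that] by (simp add: mult.commute)
    have enB: "e \<notin> B" using Ba ea by auto
    have rep': "f x = (\<Sum>b\<in>insert e B. (\<Sum>y\<in>?Y. f y * b y) * b x)" if f: "f \<in> S" for f x
    proof -
      \<comment> \<open>Subtracting the multiple of \<open>e\<close> that agrees with
        \<open>f\<close> at \<open>a\<close> lands in \<open>S'\<close>, where \<open>B\<close>
        already represents. As \<open>r\<close> is orthogonal to \<open>e\<close>, the coefficient
        \<open>f a / e a\<close> is the inner product of \<open>f\<close> with
        \<open>e\<close>.\<close>
      define r where "r = (\<lambda>x. f x - (f a / e a) * e x)"
      have rS: "r \<in> S'"
      proof -
        have "(\<lambda>x. (f a / e a) * e x) \<in> S" using eS insert.prems(1) unfolding function_subspace_def by blast
        from function_subspace_diff[OF insert.prems(1) f this] show ?thesis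
          using ea by (simp add: S'_def r_def)
      qed
      have fr: "f y = r y + (f a / e a) * e y" for y by (simp add: r_def)
      have 1: "(\<Sum>y\<in>?Y. f y * b y) = (\<Sum>y\<in>X. r y * b y)" if "b \<in> B" for b
      proof -
        have "(\<Sum>y\<in>?Y. f y * b y) = (\<Sum>y\<in>X. f y * b y)" using Y Ba that by simp
        also have "\<dots> = (\<Sum>y\<in>X. r y * b y) + (f a / e a) * (\<Sum>y\<in>X. e y * b y)"
          by (subst fr) (simp add: distrib_right sum.distrib sum_distrib_left mult.assoc)
        finally show ?thesis using eb that by simp
      qed
      have re: "(\<Sum>y\<in>?Y. r y * e y) = 0"
      proof -
        have "(\<Sum>y\<in>?Y. r y * e y) = (\<Sum>y\<in>X. r y * e y)" using Y rS by (simp add: S'_def)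
        also have "\<dots> = (\<Sum>y\<in>X. \<Sum>b\<in>B. (\<Sum>y\<in>X. r y * b y) * (b y * e y))"
          by (subst rep[OF rS]) (simp add: sum_distrib_right mult.assoc)
        also have "\<dots> = (\<Sum>b\<in>B. (\<Sum>y\<in>X. r y * b y) * (\<Sum>y\<in>X. b y * e y))"
          by (subst sum.swap) (simp add: sum_distrib_left)
        also have "\<dots> = 0" using be by simp
        finally show ?thesis .
      qed
      have 2: "(\<Sum>y\<in>?Y. f y * e y) = f a / e a"
      proof -
        have "(\<Sum>y\<in>?Y. f y * e y) = (\<Sum>y\<in>?Y. r y * e y + (f a / e a) * (e y * e y))"
          by (rule sum.cong[OF refl], subst fr) (simp only: distrib_right mult.assoc)
        also have "\<dots> = (\<Sum>y\<in>?Y. r y * e y) + (f a / e a) * (\<Sum>y\<in>?Y. e y * e y)"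
          by (simp only: sum.distrib sum_distrib_left)
        finally show ?thesis by (simp only: re ee mult_1_right add_0)
      qed
      have "f x = (f a / e a) * e x + (\<Sum>b\<in>B. (\<Sum>y\<in>X. r y * b y) * b x)"
        unfolding rep[OF rS, of x, symmetric] using fr[of x] by simp
      also have "\<dots> = (\<Sum>b\<in>insert e B. (\<Sum>y\<in>?Y. f y * b y) * b x)"
        by (subst sum.insert[OF fin enB], subst 2) (use 1 in simp)
      finally show ?thesis .
    qed
    have "orthonormal_basis ?Y S (insert e B)"
      unfolding orthonormal_basis_def
    proof (intro conjI ballI allI)
      fix b c assume "b \<in> insert e B" "c \<in> insert e B"
      then show "(\<Sum>x\<in>?Y. b x * c x) = (if b = c then 1 else 0)"
        using ee enB by (auto simp: Y Ba on eb be simp del: sum.insert)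
    qed (use fin BS eS rep' in \<open>auto simp: S'_def simp del: sum.insert\<close>)
    then show ?thesis by blast
  qed
qed

section \<open>Kernels of orthogonal projections\<close>

definition reproducing_kernel :: "'x set \<Rightarrow> ('x \<Rightarrow> real) set \<Rightarrow> ('x \<Rightarrow> 'x \<Rightarrow> real) \<Rightarrow> bool" where
  "reproducing_kernel X S K \<longleftrightarrow> (\<forall>x y. K x y = K y x) \<and> (\<forall>x. K x \<in> S) \<and>
     (\<forall>f\<in>S. \<forall>x. (\<Sum>y\<in>X. K x y * f y) = f x)"

lemma orthonormal_basis_imp_reproducing_kernel:
  assumes "function_subspace S" "orthonormal_basis X S B"
  shows "reproducing_kernel X S (\<lambda>x y. \<Sum>b\<in>B. b x * b y)"
  unfolding reproducing_kernel_def
proof (intro conjI allI ballI)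
  show "(\<lambda>y. \<Sum>b\<in>B. b x * b y) \<in> S" for x
    by (rule function_subspace_sum[OF assms(1)]) (use assms(2) in \<open>auto simp: orthonormal_basis_def\<close>)
next
  fix f x assume "f \<in> S"
  then have "f x = (\<Sum>b\<in>B. (\<Sum>y\<in>X. f y * b y) * b x)"
    using assms(2) by (simp add: orthonormal_basis_def)
  also have "\<dots> = (\<Sum>y\<in>X. (\<Sum>b\<in>B. b x * b y) * f y)"
    by (subst sum_distrib_right, subst sum_distrib_right, subst sum.swap) (simp add: mult_ac)
  finally show "(\<Sum>y\<in>X. (\<Sum>b\<in>B. b x * b y) * f y) = f x" by simp
qed (simp add: mult.commute)

lemma reproducing_kernelD:
  assumes "reproducing_kernel X S K"
  shows "K x y = K y x" "K x \<in> S" "f \<in> S \<Longrightarrow> (\<Sum>y\<in>X. K x y * f y) = f x"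
proof -
  note * = assms[unfolded reproducing_kernel_def]
  show "K x y = K y x" using * by blast
  show "K x \<in> S" using * by blast
  show "f \<in> S \<Longrightarrow> (\<Sum>y\<in>X. K x y * f y) = f x" using * by (elim conjE) (drule (1) bspec, erule spec)
qed

text \<open>Each kernel fixes the rows of the other and both are symmetric, so their product equals
  either one. Hence a symmetry of the space \<open>S\<close> is inherited by its kernel.\<close>

lemma reproducing_kernel_unique:
  assumes "reproducing_kernel X S K" "reproducing_kernel X S K'"
  shows "K = K'"
proof (intro ext)
  fix x y
  have "K x y = (\<Sum>z\<in>X. K' y z * K x z)"
    by (rule reproducing_kernelD(3)[OF assms(2), symmetric]) (rule reproducing_kernelD(2)[OF assms(1)])
  also have "\<dots> = (\<Sum>z\<in>X. K x z * K' y z)" by (simp add: mult.commute)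
  also have "\<dots> = K' y x"
    by (rule reproducing_kernelD(3)[OF assms(1)]) (rule reproducing_kernelD(2)[OF assms(2)])
  also have "\<dots> = K' x y" by (rule reproducing_kernelD(1)[OF assms(2)])
  finally show "K x y = K' x y" .
qed

text \<open>The part \<open>w\<close> of \<open>v\<close> orthogonal to the row space of
  \<open>z\<close> is orthogonal in particular to \<open>F w\<close>, the row combination with
  coefficients \<open>w\<close>. The form thus vanishes at \<open>w\<close>, so \<open>w\<close>
  vanishes on \<open>X\<close> and \<open>v\<close> lies in the row space.\<close>

lemma positive_definite_solvable:
  fixes z :: "'x \<Rightarrow> 'x \<Rightarrow> real"
  assumes fin: "finite X"
    and inj: "\<And>w. (\<Sum>i\<in>X. \<Sum>j\<in>X. w i * z i j * w j) = 0 \<Longrightarrow> \<forall>i\<in>X. w i = 0"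
  shows "\<exists>y. \<forall>j\<in>X. v j = (\<Sum>k\<in>X. y k * z k j)"
proof -
  define F where "F = (\<lambda>y j. if j \<in> X then \<Sum>k\<in>X. y k * z k j else 0)"
  have "function_subspace (range F)"
    unfolding function_subspace_def
  proof (intro conjI allI ballI)
    show "(\<lambda>_. 0) \<in> range F" by (rule image_eqI[of _ _ "\<lambda>_. 0"]) (auto simp: F_def)
  next
    fix f g assume "f \<in> range F" "g \<in> range F"
    then obtain y y' where "f = F y" "g = F y'" by auto
    then show "(\<lambda>x. f x + g x) \<in> range F"
      by (intro image_eqI[of _ _ "\<lambda>k. y k + y' k"]) (auto simp: F_def distrib_right sum.distrib)
  next
    fix c f assume "f \<in> range F"
    then obtain y where "f = F y" by auto
    then show "(\<lambda>x. c * f x) \<in> range F"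
      by (intro image_eqI[of _ _ "\<lambda>k. c * y k"]) (auto simp: F_def sum_distrib_left mult.assoc)
  qed
  moreover have "f x = 0" if "f \<in> range F" "x \<notin> X" for f x using that by (auto simp: F_def)
  ultimately obtain B where "orthonormal_basis X (range F) B"
    using orthonormal_basis_exists[OF fin, of "range F"] by blast
  from orthonormal_basis_imp_reproducing_kernel[OF \<open>function_subspace (range F)\<close> this]
  obtain K where K: "reproducing_kernel X (range F) K" by blast
  define w where "w = (\<lambda>x. v x - (\<Sum>y\<in>X. K x y * v y))"
  have orth: "(\<Sum>x\<in>X. w x * f x) = 0" if "f \<in> range F" for f
  proof -
    have "(\<Sum>x\<in>X. (\<Sum>y\<in>X. K x y * v y) * f x) = (\<Sum>x\<in>X. \<Sum>y\<in>X. v y * (K x y * f x))"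
      by (simp add: sum_distrib_right sum_distrib_left mult_ac)
    also have "\<dots> = (\<Sum>y\<in>X. v y * (\<Sum>x\<in>X. K x y * f x))"
      by (subst sum.swap) (simp add: sum_distrib_left)
    also have "\<dots> = (\<Sum>y\<in>X. v y * (\<Sum>x\<in>X. K y x * f x))"
      by (subst reproducing_kernelD(1)[OF K]) (rule refl)
    also have "\<dots> = (\<Sum>y\<in>X. v y * f y)" using reproducing_kernelD(3)[OF K that] by simp
    finally show ?thesis by (simp add: w_def left_diff_distrib sum_subtractf)
  qed
  have "(\<Sum>i\<in>X. \<Sum>j\<in>X. w i * z i j * w j) = (\<Sum>j\<in>X. w j * F w j)"
    by (subst sum.swap) (simp add: F_def sum_distrib_left mult_ac)
  with inj[of w] orth[of "F w"] have "\<forall>i\<in>X. w i = 0" by simp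
  then have v: "v x = (\<Sum>y\<in>X. K x y * v y)" if "x \<in> X" for x using that by (simp add: w_def)
  have "(\<lambda>x. \<Sum>y\<in>X. v y * K y x) \<in> range F"
    by (rule function_subspace_sum) (rule \<open>function_subspace (range F)\<close>, rule reproducing_kernelD(2)[OF K])
  then obtain y where y: "(\<lambda>x. \<Sum>y\<in>X. v y * K y x) = F y" by auto
  have "v j = F y j" if "j \<in> X" for j
    using v[OF that] fun_cong[OF y, of j] reproducing_kernelD(1)[OF K, of j] by (simp add: mult.commute)
  then show ?thesis by (intro exI[of _ y]) (simp add: F_def)
qed

section \<open>Positivity for algebras of matrices\<close>

lemma sum_swap4:
  "(\<Sum>a\<in>A. \<Sum>b\<in>B. \<Sum>c\<in>C. \<Sum>d\<in>D. f a b c d) = (\<Sum>c\<in>C. \<Sum>d\<in>D. \<Sum>a\<in>A. \<Sum>b\<in>B. f a b c d)"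
  (is "?l = ?r")
proof -
  have "?l = (\<Sum>a\<in>A. \<Sum>c\<in>C. \<Sum>b\<in>B. \<Sum>d\<in>D. f a b c d)" by (simp add: sum.swap[of _ C B])
  also have "\<dots> = (\<Sum>c\<in>C. \<Sum>a\<in>A. \<Sum>d\<in>D. \<Sum>b\<in>B. f a b c d)"
    by (subst sum.swap) (simp add: sum.swap[of _ D B])
  also have "\<dots> = ?r" by (simp add: sum.swap[of _ D A])
  finally show ?thesis .
qed

text \<open>
  For an algebra \<open>N\<close> of matrices closed under transposition, with orthonormal basis \<open>(T\<^sub>b)\<close>, the
  map \<open>\<Phi>(c) = \<Sum> T\<^sub>b c T\<^sub>b\<^sup>t\<close> takes values in the commutant \<open>N'\<close>, and \<open>z = \<Phi>(1)\<close> is central and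
  invertible. Writing \<open>c = y z\<close> gives \<open>\<langle>c, \<Phi>(c)\<rangle> = \<langle>\<Phi>(y), \<Phi>(y) z\<rangle> \<ge> 0\<close>. Here \<open>\<Phi>\<close> is expressed
  through the kernel of the projection onto \<open>N\<close>.
\<close>

theorem matrix_algebra_kernel_positive:
  fixes c :: "'x \<Rightarrow> 'x \<Rightarrow> real"
  assumes fin: "finite X"
    and mult: "\<And>S T. S \<in> N \<Longrightarrow> T \<in> N \<Longrightarrow> (\<lambda>(x, y). \<Sum>k\<in>X. S (x, k) * T (k, y)) \<in> N"
    and tr: "\<And>T. T \<in> N \<Longrightarrow> (\<lambda>(x, y). T (y, x)) \<in> N"
    and one: "(\<lambda>(x, y). if x \<in> X \<and> x = y then 1 else 0) \<in> N"
    and K: "reproducing_kernel (X \<times> X) N K"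
  shows "0 \<le> (\<Sum>i\<in>X. \<Sum>j\<in>X. \<Sum>i'\<in>X. \<Sum>j'\<in>X. c i j * c i' j' * K (i, i') (j, j'))"
proof -
  note Ksym = reproducing_kernelD(1)[OF K] and KN = reproducing_kernelD(2)[OF K]
    and Krep = reproducing_kernelD(3)[OF K]
  have rep: "(\<Sum>p\<in>X. \<Sum>q\<in>X. K (i, j) (p, q) * T (p, q)) = T (i, j)" if "T \<in> N" for T i j
    using Krep[OF that, of "(i, j)"] by (simp add: sum.cartesian_product case_prod_unfold)

  \<comment> \<open>Transposing both arguments of \<open>K\<close> gives another reproducing kernel
    of \<open>N\<close>, because \<open>N\<close> is closed under transposition.\<close>
  have Ktr: "K (i, i') (j, j') = K (i', i) (j', j)" for i i' j j'
  proof -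
    have "reproducing_kernel (X \<times> X) N (\<lambda>(i, i') (j, j'). K (i', i) (j', j))"
      unfolding reproducing_kernel_def
    proof (intro conjI allI ballI)
      fix x :: "'x \<times> 'x" show "(\<lambda>(i, i') (j, j'). K (i', i) (j', j)) x \<in> N"
        using tr[OF KN[of "(snd x, fst x)"]] by (simp add: case_prod_unfold)
    next
      fix f and x :: "'x \<times> 'x" assume f: "f \<in> N"
      obtain a b where x: "x = (a, b)" by (cases x)
      have "(\<Sum>y\<in>X \<times> X. (\<lambda>(i, i') (j, j'). K (i', i) (j', j)) x y * f y) =
          (\<Sum>p\<in>X. \<Sum>q\<in>X. K (b, a) (q, p) * f (p, q))"
        by (simp add: x sum.cartesian_product case_prod_unfold)
      also have "\<dots> = (\<Sum>q\<in>X. \<Sum>p\<in>X. K (b, a) (q, p) * (\<lambda>(x, y). f (y, x)) (q, p))"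
        by (subst sum.swap) simp
      also have "\<dots> = f x" by (subst rep[OF tr[OF f]]) (simp add: x)
      finally show "(\<Sum>y\<in>X \<times> X. (\<lambda>(i, i') (j, j'). K (i', i) (j', j)) x y * f y) = f x" .
    qed (auto simp: Ksym)
    from reproducing_kernel_unique[OF K this] show ?thesis by (simp add: fun_eq_iff)
  qed

  \<comment> \<open>In an orthonormal basis: the sum of \<open>T T\<^sub>b\<close> tensor
    \<open>T\<^sub>b\<close> equals the sum of \<open>T\<^sub>b\<close> tensor
    \<open>T\<^sup>t T\<^sub>b\<close>, because left multiplications by \<open>T\<close> and by its
    transpose are adjoint to each other.\<close>
  have comm: "(\<Sum>k\<in>X. T (i, k) * K (k, i') (j, j')) = (\<Sum>k\<in>X. T (k, j) * K (i, i') (k, j'))"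
    if T: "T \<in> N" for T i i' j j'
  proof -
    have "(\<Sum>k\<in>X. T (i, k) * K (k, i') (j, j')) =
        (\<lambda>(x, y). \<Sum>k\<in>X. T (x, k) * K (j, j') (k, y)) (i, i')"
      by (simp add: Ksym[of "(j, j')"])
    also have "\<dots> = (\<Sum>p\<in>X. \<Sum>q\<in>X. \<Sum>k\<in>X. K (i, i') (p, q) * (T (p, k) * K (j, j') (k, q)))"
      by (subst rep[OF mult[OF T KN], symmetric]) (simp add: sum_distrib_left)
    also have "\<dots> = (\<Sum>p\<in>X. \<Sum>k\<in>X. \<Sum>q\<in>X. K (i, i') (p, q) * (T (p, k) * K (j, j') (k, q)))"
      by (rule sum.cong[OF refl], rule sum.swap)
    also have "\<dots> = (\<Sum>k\<in>X. \<Sum>p\<in>X. \<Sum>q\<in>X. K (i, i') (p, q) * (T (p, k) * K (j, j') (k, q)))"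
      by (rule sum.swap)
    also have "\<dots> = (\<Sum>k\<in>X. \<Sum>q\<in>X. \<Sum>p\<in>X. K (i, i') (p, q) * (T (p, k) * K (j, j') (k, q)))"
      by (rule sum.cong[OF refl], rule sum.swap)
    also have "\<dots> = (\<Sum>k\<in>X. \<Sum>q\<in>X. K (j, j') (k, q) *
        (\<lambda>(x, y). \<Sum>p\<in>X. (\<lambda>(x, y). T (y, x)) (x, p) * K (i, i') (p, y)) (k, q))"
      by (simp add: sum_distrib_left mult_ac)
    also have "\<dots> = (\<lambda>(x, y). \<Sum>p\<in>X. (\<lambda>(x, y). T (y, x)) (x, p) * K (i, i') (p, y)) (j, j')"
      by (rule rep[OF mult[OF tr[OF T] KN]])
    finally show ?thesis by simp
  qed

  \<comment> \<open>\<open>K (i, i') (j, j')\<close> stands for the sum of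
    \<open>T\<^sub>b (i, i') * T\<^sub>b (j, j')\<close>, so \<open>F c\<close> is \<Phi>(c) and
    \<open>z\<close> is \<Phi>(1).\<close>
  define F where "F = (\<lambda>c i j. \<Sum>i'\<in>X. \<Sum>j'\<in>X. K (i, i') (j, j') * c i' j')"
  define z where "z = (\<lambda>i j. \<Sum>k\<in>X. K (i, k) (j, k))"
  have zsym: "z i j = z j i" for i j unfolding z_def by (intro sum.cong refl) (rule Ksym)

  have F_comm: "(\<Sum>k\<in>X. T (i, k) * F c k j) = (\<Sum>k\<in>X. F c i k * T (k, j))"
    if T: "T \<in> N" for T c i j
  proof -
    have "(\<Sum>k\<in>X. T (i, k) * F c k j) =
        (\<Sum>k\<in>X. \<Sum>i'\<in>X. \<Sum>j'\<in>X. T (i, k) * K (k, i') (j, j') * c i' j')"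
      by (simp add: F_def sum_distrib_left mult.assoc)
    also have "\<dots> = (\<Sum>i'\<in>X. \<Sum>k\<in>X. \<Sum>j'\<in>X. T (i, k) * K (k, i') (j, j') * c i' j')"
      by (rule sum.swap)
    also have "\<dots> = (\<Sum>i'\<in>X. \<Sum>j'\<in>X. \<Sum>k\<in>X. T (i, k) * K (k, i') (j, j') * c i' j')"
      by (rule sum.cong[OF refl], rule sum.swap)
    also have "\<dots> = (\<Sum>i'\<in>X. \<Sum>j'\<in>X. \<Sum>k\<in>X. T (k, j) * K (i, i') (k, j') * c i' j')"
      by (simp only: sum_distrib_right[symmetric] comm[OF T])
    also have "\<dots> = (\<Sum>i'\<in>X. \<Sum>k\<in>X. \<Sum>j'\<in>X. T (k, j) * K (i, i') (k, j') * c i' j')"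
      by (rule sum.cong[OF refl], rule sum.swap)
    also have "\<dots> = (\<Sum>k\<in>X. \<Sum>i'\<in>X. \<Sum>j'\<in>X. T (k, j) * K (i, i') (k, j') * c i' j')"
      by (rule sum.swap)
    also have "\<dots> = (\<Sum>k\<in>X. F c i k * T (k, j))"
      by (simp add: F_def sum_distrib_left mult_ac)
    finally show ?thesis .
  qed

  have z_comm: "(\<Sum>k\<in>X. T (i, k) * z k j) = (\<Sum>k\<in>X. z i k * T (k, j))"
    if T: "T \<in> N" for T i j
  proof -
    have "(\<Sum>k\<in>X. T (i, k) * z k j) = (\<Sum>l\<in>X. \<Sum>k\<in>X. T (i, k) * K (k, l) (j, l))"
      unfolding z_def sum_distrib_left by (rule sum.swap)
    also have "\<dots> = (\<Sum>l\<in>X. \<Sum>k\<in>X. T (k, j) * K (i, l) (k, l))" by (simp only: comm[OF T])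
    also have "\<dots> = (\<Sum>k\<in>X. z i k * T (k, j))"
      unfolding z_def sum_distrib_right by (subst sum.swap) (simp add: mult.commute)
    finally show ?thesis .
  qed

  \<comment> \<open>Since \<open>F c\<close> commutes with \<open>N\<close>, it can be pulled out of
    \<open>F (F c)\<close> to the left, which leaves \<Phi>(1). In \<open>F_z\<close> below it is
    \<open>z\<close> that is pulled out, to the right.\<close>
  have F_F: "F (F c) i j = (\<Sum>k\<in>X. F c i k * z k j)" for c i j
  proof -
    have "F d i j = (\<Sum>j'\<in>X. \<Sum>i'\<in>X. K (j, j') (i, i') * d i' j')" for d
      unfolding F_def by (subst sum.swap, (rule sum.cong[OF refl])+, subst Ksym, rule refl)
    then have "F (F c) i j = (\<Sum>j'\<in>X. \<Sum>i'\<in>X. K (j, j') (i, i') * F c i' j')" .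
    also have "\<dots> = (\<Sum>j'\<in>X. \<Sum>k\<in>X. F c i k * K (j, j') (k, j'))"
      by (intro sum.cong refl F_comm KN)
    also have "\<dots> = (\<Sum>k\<in>X. F c i k * z k j)"
      unfolding z_def sum_distrib_left
      by (subst sum.swap, (rule sum.cong[OF refl])+, subst Ksym, rule refl)
    finally show ?thesis .
  qed

  have F_z: "F (\<lambda>i j. \<Sum>k\<in>X. y i k * z k j) i j = (\<Sum>k\<in>X. F y i k * z k j)" for y i j
  proof -
    have "F (\<lambda>i j. \<Sum>k\<in>X. y i k * z k j) i j =
        (\<Sum>i'\<in>X. \<Sum>j'\<in>X. \<Sum>k\<in>X. y i' k * (K (i, i') (j, j') * z k j'))"
      unfolding F_def by (simp add: sum_distrib_left mult_ac)
    also have "\<dots> = (\<Sum>i'\<in>X. \<Sum>k\<in>X. y i' k * (\<Sum>j'\<in>X. K (i, i') (j, j') * z j' k))"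
      by (subst sum.swap) (simp add: sum_distrib_left zsym)
    also have "\<dots> = (\<Sum>i'\<in>X. \<Sum>k\<in>X. y i' k * (\<Sum>j'\<in>X. z j j' * K (i, i') (j', k)))"
      by (simp only: z_comm[OF KN])
    also have "\<dots> = (\<Sum>i'\<in>X. \<Sum>k\<in>X. \<Sum>j'\<in>X. y i' k * (z j j' * K (i, i') (j', k)))"
      by (simp add: sum_distrib_left)
    also have "\<dots> = (\<Sum>i'\<in>X. \<Sum>j'\<in>X. \<Sum>k\<in>X. y i' k * (z j j' * K (i, i') (j', k)))"
      by (rule sum.cong[OF refl], rule sum.swap)
    also have "\<dots> = (\<Sum>j'\<in>X. \<Sum>i'\<in>X. \<Sum>k\<in>X. y i' k * (z j j' * K (i, i') (j', k)))"
      by (rule sum.swap)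
    also have "\<dots> = (\<Sum>k\<in>X. F y i k * z k j)"
      by (simp add: F_def sum_distrib_left sum_distrib_right mult_ac zsym[of j])
    finally show ?thesis .
  qed

  have F_adj: "(\<Sum>i\<in>X. \<Sum>j\<in>X. a i j * F b i j) = (\<Sum>i\<in>X. \<Sum>j\<in>X. F a i j * b i j)" for a b
  proof -
    have "(\<Sum>i\<in>X. \<Sum>j\<in>X. a i j * F b i j) =
        (\<Sum>i\<in>X. \<Sum>j\<in>X. \<Sum>i'\<in>X. \<Sum>j'\<in>X. a i j * K (i, i') (j, j') * b i' j')"
      by (simp add: F_def sum_distrib_left mult.assoc)
    also have "\<dots> = (\<Sum>i'\<in>X. \<Sum>j'\<in>X. \<Sum>i\<in>X. \<Sum>j\<in>X. a i j * K (i, i') (j, j') * b i' j')"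
      by (rule sum_swap4)
    also have "\<dots> = (\<Sum>i'\<in>X. \<Sum>j'\<in>X. \<Sum>i\<in>X. \<Sum>j\<in>X. K (i', i) (j', j) * a i j * b i' j')"
      by (intro sum.cong refl, subst Ktr) simp
    also have "\<dots> = (\<Sum>i\<in>X. \<Sum>j\<in>X. F a i j * b i j)"
      by (simp add: F_def sum_distrib_right)
    finally show ?thesis .
  qed

  \<comment> \<open>\<open>K\<close> reproduces its own rows, so \<open>K (i, k) (j, k)\<close> is
    the inner product of two rows and the form of \<open>z\<close> becomes a sum of squares.\<close>
  have z_quad: "(\<Sum>i\<in>X. \<Sum>j\<in>X. w i * z i j * w j) =
      (\<Sum>k\<in>X. \<Sum>p\<in>X. \<Sum>q\<in>X. (\<Sum>i\<in>X. w i * K (i, k) (p, q))\<^sup>2)" for w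
  proof -
    have "K (i, k) (j, k) = (\<Sum>p\<in>X. \<Sum>q\<in>X. K (i, k) (p, q) * K (j, k) (p, q))" for i j k
      using rep[OF KN, of i k "(j, k)"] Ksym by simp
    then have "(\<Sum>i\<in>X. \<Sum>j\<in>X. w i * z i j * w j) =
        (\<Sum>i\<in>X. \<Sum>j\<in>X. \<Sum>k\<in>X. \<Sum>p\<in>X. \<Sum>q\<in>X. (w i * K (i, k) (p, q)) * (w j * K (j, k) (p, q)))"
      by (simp add: z_def sum_distrib_left sum_distrib_right mult_ac)
    also have "\<dots> = (\<Sum>k\<in>X. \<Sum>p\<in>X. \<Sum>i\<in>X. \<Sum>j\<in>X. \<Sum>q\<in>X.
        (w i * K (i, k) (p, q)) * (w j * K (j, k) (p, q)))"
      by (rule sum_swap4)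
    also have "\<dots> = (\<Sum>k\<in>X. \<Sum>p\<in>X. \<Sum>i\<in>X. \<Sum>q\<in>X. \<Sum>j\<in>X.
        (w i * K (i, k) (p, q)) * (w j * K (j, k) (p, q)))"
      by (rule sum.cong[OF refl], rule sum.cong[OF refl], rule sum.cong[OF refl], rule sum.swap)
    also have "\<dots> = (\<Sum>k\<in>X. \<Sum>p\<in>X. \<Sum>q\<in>X. \<Sum>i\<in>X. \<Sum>j\<in>X.
        (w i * K (i, k) (p, q)) * (w j * K (j, k) (p, q)))"
      by (rule sum.cong[OF refl], rule sum.cong[OF refl], rule sum.swap)
    also have "\<dots> = (\<Sum>k\<in>X. \<Sum>p\<in>X. \<Sum>q\<in>X. (\<Sum>i\<in>X. w i * K (i, k) (p, q))\<^sup>2)"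
      by (simp only: sum_product power2_eq_square)
    finally show ?thesis .
  qed
  have z_nonneg: "0 \<le> (\<Sum>i\<in>X. \<Sum>j\<in>X. w i * z i j * w j)" for w
    unfolding z_quad by (intro sum_nonneg) simp

  have "\<forall>i\<in>X. w i = 0" if "(\<Sum>i\<in>X. \<Sum>j\<in>X. w i * z i j * w j) = 0" for w
  proof
    fix k assume k: "k \<in> X"
    have *: "(\<Sum>i\<in>X. w i * K (i, k) (p, q)) = 0" if "p \<in> X" "q \<in> X" for p q
      using \<open>_ = 0\<close> k that fin unfolding z_quad
      by (simp add: sum_nonneg_eq_0_iff sum_nonneg)
    let ?I = "\<lambda>(x, y). if x \<in> X \<and> x = y then 1 else (0::real)"
    \<comment> \<open>The identity matrix lies in \<open>N\<close>, so \<open>K\<close> reproduces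
      it; this recovers \<open>w k\<close> from the inner sums that have just been shown to
      vanish.\<close>
    have "w k = (\<Sum>i\<in>X. w i * ?I (i, k))" using fin k by (simp add: if_distrib cong: if_cong)
    also have "\<dots> = (\<Sum>i\<in>X. \<Sum>p\<in>X. \<Sum>q\<in>X. (w i * K (i, k) (p, q)) * ?I (p, q))"
      by (rule sum.cong[OF refl], subst rep[OF one, symmetric], simp only: sum_distrib_left mult.assoc)
    also have "\<dots> = (\<Sum>p\<in>X. \<Sum>i\<in>X. \<Sum>q\<in>X. (w i * K (i, k) (p, q)) * ?I (p, q))"
      by (rule sum.swap)
    also have "\<dots> = (\<Sum>p\<in>X. \<Sum>q\<in>X. (\<Sum>i\<in>X. w i * K (i, k) (p, q)) * ?I (p, q))"
      by (rule sum.cong[OF refl], subst sum.swap) (simp only: sum_distrib_right)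
    also have "\<dots> = 0" using * by simp
    finally show "w k = 0" .
  qed
  then have "\<exists>y. \<forall>j\<in>X. c i j = (\<Sum>k\<in>X. y k * z k j)" for i
    by (rule positive_definite_solvable[OF fin])
  then obtain y where y: "\<And>i j. j \<in> X \<Longrightarrow> c i j = (\<Sum>k\<in>X. y i k * z k j)" by metis
  define yz where "yz = (\<lambda>i j. \<Sum>k\<in>X. y i k * z k j)"
  define Fyz where "Fyz = (\<lambda>i j. \<Sum>k\<in>X. F y i k * z k j)"

  have "(\<Sum>i\<in>X. \<Sum>j\<in>X. \<Sum>i'\<in>X. \<Sum>j'\<in>X. c i j * c i' j' * K (i, i') (j, j')) =
      (\<Sum>i\<in>X. \<Sum>j\<in>X. yz i j * F yz i j)"
    by (simp add: F_def sum_distrib_left y yz_def mult_ac)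
  also have "\<dots> = (\<Sum>i\<in>X. \<Sum>j\<in>X. yz i j * Fyz i j)"
    unfolding yz_def F_z Fyz_def ..
  also have "\<dots> = (\<Sum>i\<in>X. \<Sum>k\<in>X. y i k * (\<Sum>j\<in>X. Fyz i j * z j k))"
  proof (rule sum.cong[OF refl])
    fix i
    have "(\<Sum>j\<in>X. yz i j * Fyz i j) = (\<Sum>j\<in>X. \<Sum>k\<in>X. y i k * (Fyz i j * z j k))"
      unfolding yz_def sum_distrib_right
      by ((rule sum.cong[OF refl])+, subst zsym) simp
    then show "(\<Sum>j\<in>X. yz i j * Fyz i j) = (\<Sum>k\<in>X. y i k * (\<Sum>j\<in>X. Fyz i j * z j k))"
      by (subst (asm) sum.swap) (simp add: sum_distrib_left)
  qed
  \<comment> \<open>\<open>Fyz\<close> is \<open>F (F y)\<close>, so multiplying it by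
    \<open>z\<close> applies \<open>F\<close> once more. Self-adjointness then moves this outer
    \<open>F\<close> over to \<open>y\<close>, and the form of \<open>z\<close> on the rows of
    \<open>F y\<close> remains.\<close>
  also have "\<dots> = (\<Sum>i\<in>X. \<Sum>k\<in>X. y i k * F Fyz i k)"
  proof -
    have "Fyz = F (F y)" by (simp add: fun_eq_iff F_F Fyz_def)
    then show ?thesis by (simp add: F_F)
  qed
  also have "\<dots> = (\<Sum>i\<in>X. \<Sum>k\<in>X. F y i k * Fyz i k)" by (rule F_adj)
  also have "\<dots> = (\<Sum>i\<in>X. \<Sum>k\<in>X. \<Sum>j\<in>X. F y i k * z k j * F y i j)"
    unfolding Fyz_def sum_distrib_left
    by ((rule sum.cong[OF refl])+, subst zsym) simp
  also have "\<dots> \<ge> 0" by (intro sum_nonneg z_nonneg)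
  finally show ?thesis .
qed

section \<open>Temperley-Lieb vectors\<close>

text \<open>Inserts the invariant vector, the sum of all e_k tensor e_k, after the first
  \<open>a\<close> tensor factors; list positions count from 0.\<close>

definition cup :: "nat \<Rightarrow> ('n list \<Rightarrow> real) \<Rightarrow> 'n list \<Rightarrow> real" where
  "cup a f xs =
     (if a + 2 \<le> length xs \<and> xs ! a = xs ! (a + 1) then f (take a xs @ drop (a + 2) xs) else 0)"

text \<open>The contraction adjoint to \<open>cup a\<close>. Values lie in an arbitrary monoid
  because it is applied both to real vectors and to coefficients in the C*-algebra.\<close>

definition cap :: "nat \<Rightarrow> ('n::finite list \<Rightarrow> 'v::comm_monoid_add) \<Rightarrow> 'n list \<Rightarrow> 'v" where
  "cap a f xs = (\<Sum>k\<in>UNIV. f (take a xs @ [k, k] @ drop a xs))"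

text \<open>Generation by cups gives inductions that do not mention diagrams; the identification
  with the span of the diagram vectors comes later. \<open>TL_zero\<close> stands apart because no
  other rule starts a vector of odd degree.\<close>

inductive TL_vector :: "nat \<Rightarrow> ('n::finite list \<Rightarrow> real) \<Rightarrow> bool" where
  TL_unit: "TL_vector 0 (\<lambda>xs. if xs = [] then 1 else 0)"
| TL_zero: "TL_vector m (\<lambda>_. 0)"
| TL_add: "TL_vector m f \<Longrightarrow> TL_vector m g \<Longrightarrow> TL_vector m (\<lambda>xs. f xs + g xs)"
| TL_scale: "TL_vector m f \<Longrightarrow> TL_vector m (\<lambda>xs. c * f xs)"
| TL_cup: "TL_vector m f \<Longrightarrow> a \<le> m \<Longrightarrow> TL_vector (m + 2) (cup a f)"

lemma cup_append: "length x = a \<Longrightarrow> cup a f (x @ i # j # y) = (if i = j then f (x @ y) else 0)"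
  by (auto simp: cup_def nth_append)

lemma cap_append: "length x = a \<Longrightarrow> cap a f (x @ y) = (\<Sum>k\<in>UNIV. f (x @ k # k # y))"
  by (simp add: cap_def)

lemma list_split_pair:
  assumes "a + 2 \<le> length xs"
  obtains x i j y where "xs = x @ i # j # y" "length x = a"
proof
  show "xs = take a xs @ xs ! a # xs ! (a + 1) # drop (a + 2) xs"
    using assms by (simp add: Cons_nth_drop_Suc)
qed (use assms in simp)

lemma list_split:
  assumes "a \<le> length xs"
  obtains x y where "xs = x @ y" "length x = a"
  using assms by (metis append_take_drop_id length_take min.absorb2)

lemma TL_vector_support: "TL_vector m f \<Longrightarrow> length xs \<noteq> m \<Longrightarrow> f xs = 0"
  by (induction arbitrary: xs rule: TL_vector.induct) (auto simp: cup_def)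

lemma TL_vector_odd: "TL_vector m f \<Longrightarrow> odd m \<Longrightarrow> f xs = 0"
  by (induction arbitrary: xs rule: TL_vector.induct) (auto simp: cup_def)

lemma TL_vector_eq:
  assumes "TL_vector m f" "\<And>xs. length xs = m \<Longrightarrow> f xs = g xs" "\<And>xs. length xs \<noteq> m \<Longrightarrow> g xs = 0"
  shows "TL_vector m g"
proof -
  have "f = g" using assms TL_vector_support[OF assms(1)] by (metis ext)
  with assms(1) show ?thesis by simp
qed

lemma TL_sum: "(\<And>a. a \<in> A \<Longrightarrow> TL_vector m (f a)) \<Longrightarrow> TL_vector m (\<lambda>xs. \<Sum>a\<in>A. f a xs)"
  by (induction A rule: infinite_finite_induct) (auto intro: TL_vector.intros)

lemma function_subspace_TL: "function_subspace {f. TL_vector m f}"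
  by (auto simp: function_subspace_def intro: TL_vector.intros)

text \<open>The cap is pulled through the last cup. At the same place they close to a loop, worth
  the factor n; overlapping in one position they straighten out and cancel; otherwise they slide
  past each other, one index moves by 2, and the induction hypothesis applies to the smaller
  vector.\<close>

lemma TL_cap: "TL_vector m' f \<Longrightarrow> m' = m + 2 \<Longrightarrow> a \<le> m \<Longrightarrow> TL_vector m (cap a f)"
proof (induction arbitrary: m a rule: TL_vector.induct)
  case (TL_zero m')
  then show ?case using TL_vector.TL_zero by (simp add: cap_def[abs_def])
next
  case (TL_add m' f g)
  from TL_vector.TL_add[OF TL_add.IH(1)[OF TL_add.prems] TL_add.IH(2)[OF TL_add.prems]]
  show ?case by (simp add: cap_def[abs_def] sum.distrib)
next
  case (TL_scale m' f c)
  from TL_vector.TL_scale[OF TL_scale.IH[OF TL_scale.prems], of c]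
  show ?case by (simp add: cap_def[abs_def] sum_distrib_left)
next
  case (TL_cup m' g b)
  then have [simp]: "m' = m" by simp
  have g: "TL_vector m g" and b: "b \<le> m" and a: "a \<le> m" using TL_cup by auto
  have supp: "cap a (cup b g) xs = 0" if "length xs \<noteq> m" for xs
    using that a b TL_vector_support[OF g]
    by (auto simp: cap_def cup_def nth_append min_def intro!: sum.neutral)
  consider "a = b" | "a = b + 1" | "b = a + 1" | "b + 2 \<le> a" | "a + 2 \<le> b" by linarith
  then show ?case
  proof cases
    case 1
    show ?thesis
    proof (rule TL_vector_eq[OF TL_scale[OF g, of "of_nat CARD('a)"] _ supp])
      fix xs :: "'a list" assume "length xs = m"
      then obtain x y where "xs = x @ y" "length x = a" using list_split a by metis
      then show "of_nat CARD('a) * g xs = cap a (cup b g) xs"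
        using 1 by (simp add: cap_append cup_append)
    qed
  next
    case 2
    show ?thesis
    proof (rule TL_vector_eq[OF g _ supp])
      fix xs :: "'a list" assume xs: "length xs = m"
      then obtain x y where "xs = x @ y" "length x = a" using list_split a by metis
      moreover from this 2 obtain x' p where "x = x' @ [p]" "length x' = b"
        by (metis Suc_eq_plus1 length_Suc_conv_rev)
      ultimately show "g xs = cap a (cup b g) xs"
        using cap_append[of "x' @ [p]" a "cup b g" y] 2 by (simp add: cup_append)
    qed
  next
    case 3
    show ?thesis
    proof (rule TL_vector_eq[OF g _ supp])
      fix xs :: "'a list" assume xs: "length xs = m"
      then obtain x y where x: "xs = x @ y" "length x = a" using list_split a by metis
      moreover from this xs 3 b obtain y' p where y: "y = p # y'"
        by (cases y) auto
      moreover have "cup b g (x @ k # k # p # y') = (if k = p then g (x @ k # y') else 0)" for k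
        using cup_append[of "x @ [k]" b g k p y'] x 3 by simp
      ultimately show "g xs = cap a (cup b g) xs"
        by (simp add: cap_append)
    qed
  next
    case 4
    then obtain m'' where m'': "m = m'' + 2" using a by (metis add.commute le_add_diff_inverse2 le_trans le_add2)
    have "TL_vector m'' (cap (a - 2) g)"
      by (rule TL_cup.IH) (use 4 a m'' in auto)
    then have *: "TL_vector m (cup b (cap (a - 2) g))" unfolding m''
      by (rule TL_vector.TL_cup) (use 4 a m'' in auto)
    show ?thesis
    proof (rule TL_vector_eq[OF * _ supp])
      fix xs :: "'a list" assume xs: "length xs = m"
      have "b + 2 \<le> length xs" using 4 a xs by simp
      then obtain x p q y where x: "xs = x @ p # q # y" "length x = b" by (rule list_split_pair)
      have "a - b - 2 \<le> length y" using x xs 4 a by simp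
      then obtain y1 y2 where y: "y = y1 @ y2" "length y1 = a - b - 2" by (rule list_split)
      have "cup b (cap (a - 2) g) xs = (if p = q then cap (a - 2) g ((x @ y1) @ y2) else 0)"
        using x y by (simp add: cup_append)
      also have "\<dots> = (if p = q then \<Sum>k\<in>UNIV. g ((x @ y1) @ k # k # y2) else 0)"
        by (subst cap_append) (use x y 4 in auto)
      also have "\<dots> = (\<Sum>k\<in>UNIV. cup b g (x @ p # q # y1 @ k # k # y2))"
        using x by (simp add: cup_append)
      also have "\<dots> = cap a (cup b g) ((x @ p # q # y1) @ y2)"
        by (subst cap_append) (use x y 4 in auto)
      finally show "cup b (cap (a - 2) g) xs = cap a (cup b g) xs" using x y by simp
    qed
  next
    case 5
    then obtain m'' where m'': "m = m'' + 2" using b by (metis add.commute le_add_diff_inverse2 le_trans le_add2)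
    have "TL_vector m'' (cap a g)"
      by (rule TL_cup.IH) (use 5 b m'' in auto)
    then have *: "TL_vector m (cup (b - 2) (cap a g))" unfolding m''
      by (rule TL_vector.TL_cup) (use 5 b m'' in auto)
    show ?thesis
    proof (rule TL_vector_eq[OF * _ supp])
      fix xs :: "'a list" assume xs: "length xs = m"
      have "b - 2 + 2 \<le> length xs" using 5 b xs by simp
      then obtain x p q y where x: "xs = x @ p # q # y" "length x = b - 2" by (rule list_split_pair)
      have "a \<le> length x" using x xs 5 a by simp
      then obtain x1 x2 where y: "x = x1 @ x2" "length x1 = a" by (rule list_split)
      have "cup (b - 2) (cap a g) xs = (if p = q then cap a g (x1 @ x2 @ y) else 0)"
        using x y cup_append[of x "b - 2" "cap a g" p q y] by simp
      also have "\<dots> = (if p = q then \<Sum>k\<in>UNIV. g (x1 @ k # k # x2 @ y) else 0)"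
        by (subst cap_append) (use x y 5 in auto)
      also have "\<dots> = (\<Sum>k\<in>UNIV. cup b g ((x1 @ k # k # x2) @ p # q # y))"
        by (subst cup_append) (use x y 5 in auto)
      also have "\<dots> = cap a (cup b g) (x1 @ x2 @ p # q # y)"
        by (subst cap_append) (use x y 5 in auto)
      finally show "cup (b - 2) (cap a g) xs = cap a (cup b g) xs" using x y by simp
    qed
  qed
qed simp

text \<open>Mirror images of planar diagrams are planar: a cup at \<open>a\<close> becomes a cup at
  \<open>m - a\<close>.\<close>

lemma TL_rev: "TL_vector m f \<Longrightarrow> TL_vector m (\<lambda>xs. f (rev xs))"
proof (induction rule: TL_vector.induct)
  case (TL_cup m f a)
  from TL_vector.TL_cup[OF TL_cup.IH, of "m - a"] have *: "TL_vector (m + 2) (cup (m - a) (\<lambda>xs. f (rev xs)))"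
    by simp
  show ?case
  proof (rule TL_vector_eq[OF *])
    fix xs :: "'a list" assume xs: "length xs = m + 2"
    have "m - a + 2 \<le> length xs" using xs by simp
    then obtain x p q y where x: "xs = x @ p # q # y" "length x = m - a" by (rule list_split_pair)
    have "cup a f (rev y @ q # p # rev x) = (if q = p then f (rev y @ rev x) else 0)"
      by (rule cup_append) (use x xs TL_cup in simp)
    then show "cup (m - a) (\<lambda>xs. f (rev xs)) xs = cup a f (rev xs)"
      using x by (simp add: cup_append)
  qed (use TL_vector_support[OF TL_vector.TL_cup[OF TL_cup.hyps]] in simp)
next
  case TL_unit
  then show ?case using TL_vector.TL_unit by simp
qed (auto intro: TL_vector.intros)

lemma TL_tensor:
  assumes "TL_vector m f" "TL_vector l g"
  shows "TL_vector (m + l) (\<lambda>xs. f (take m xs) * g (drop m xs))"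
  using assms(1)
proof (induction rule: TL_vector.induct)
  case TL_unit
  then show ?case using assms(2) by simp
next
  case (TL_zero m)
  then show ?case using TL_vector.TL_zero by simp
next
  case (TL_add m f f')
  from TL_vector.TL_add[OF TL_add.IH] show ?case by (simp add: distrib_right)
next
  case (TL_scale m f c)
  from TL_vector.TL_scale[OF TL_scale.IH, of c] show ?case by (simp add: mult.assoc)
next
  case (TL_cup m f a)
  from TL_vector.TL_cup[OF TL_cup.IH, of a] TL_cup.hyps
  have *: "TL_vector (m + 2 + l) (cup a (\<lambda>xs. f (take m xs) * g (drop m xs)))" by (simp add: add_ac)
  show ?case
  proof (rule TL_vector_eq[OF *])
    fix xs :: "'a list" assume xs: "length xs = m + 2 + l"
    have "a + 2 \<le> length xs" using xs TL_cup.hyps by simp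
    then obtain x p q y where x: "xs = x @ p # q # y" "length x = a" by (rule list_split_pair)
    have "m - a \<le> length y" using x xs TL_cup.hyps by simp
    then obtain y1 y2 where y: "y = y1 @ y2" "length y1 = m - a" by (rule list_split)
    show "cup a (\<lambda>xs. f (take m xs) * g (drop m xs)) xs = cup a f (take (m + 2) xs) * g (drop (m + 2) xs)"
      using x y TL_cup.hyps by (simp add: cup_append numeral_2_eq_2 Suc_diff_le)
  next
    fix xs :: "'a list" assume xs: "length xs \<noteq> m + 2 + l"
    show "cup a f (take (m + 2) xs) * g (drop (m + 2) xs) = 0"
    proof (cases "length xs < m + 2")
      case True
      then show ?thesis
        using TL_vector_support[OF TL_vector.TL_cup[OF TL_cup.hyps], of "take (m + 2) xs"] by simp
    next
      case False
      then show ?thesis using TL_vector_support[OF assms(2), of "drop (m + 2) xs"] xs by simp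
    qed
  qed
qed

section \<open>Sums over words of fixed length\<close>

lemma finite_length_eq [simp]: "finite {xs :: 'n::finite list. length xs = m}"
  using finite_lists_length_eq[of "UNIV :: 'n set" m] by simp

lemma sum_lists_append:
  fixes f :: "'n::finite list \<Rightarrow> 'b::comm_monoid_add"
  shows "(\<Sum>xs | length xs = m + l. f xs) = (\<Sum>x | length x = m. \<Sum>y | length y = l. f (x @ y))"
proof -
  have "(\<Sum>xs | length xs = m + l. f xs) =
      (\<Sum>(x, y) \<in> {x. length x = m} \<times> {y. length y = l}. f (x @ y))"
    by (rule sum.reindex_bij_witness[of _ "\<lambda>(x, y). x @ y" "\<lambda>xs. (take m xs, drop m xs)"]) auto
  then show ?thesis by (simp add: sum.cartesian_product)
qed

lemma sum_lists_one: "(\<Sum>xs | length xs = Suc 0. f xs) = (\<Sum>k\<in>UNIV. f [k])"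
  by (rule sum.reindex_bij_witness[of _ "\<lambda>k. [k]" hd]) (auto simp: length_Suc_conv)

lemma sum_lists_snoc:
  fixes f :: "'n::finite list \<Rightarrow> 'b::comm_monoid_add"
  shows "(\<Sum>xs | length xs = Suc l. f xs) = (\<Sum>x | length x = l. \<Sum>k\<in>UNIV. f (x @ [k]))"
  using sum_lists_append[of f l "Suc 0"] by (simp add: sum_lists_one)

lemma sum_lists_rev:
  "(\<Sum>xs | length xs = m. f (rev xs)) = (\<Sum>xs | length xs = m. f xs)"
  by (rule sum.reindex_bij_witness[of _ rev rev]) auto

text \<open>Inserting \<open>z @ rev z\<close> and summing over \<open>z\<close> is a nest of
  \<open>l\<close> caps; the induction removes the innermost one, at position \<open>m + l\<close>.
  For bent matrices this is the summation over the middle index of a product.\<close>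

lemma TL_contract:
  "TL_vector (m + 2 * l + r) F \<Longrightarrow>
   TL_vector (m + r) (\<lambda>xs. if length xs = m + r
      then \<Sum>z | length z = l. F (take m xs @ z @ rev z @ drop m xs) else 0)"
proof (induction l arbitrary: F)
  case 0
  then have "TL_vector (m + r) F" by simp
  then show ?case by (rule TL_vector_eq) auto
next
  case (Suc l)
  have "TL_vector (m + 2 * l + r) (cap (m + l) F)"
    by (rule TL_cap[OF Suc.prems]) auto
  from Suc.IH[OF this] show ?case
  proof (rule TL_vector_eq)
    fix xs :: "'a list" assume xs: "length xs = m + r"
    have "cap (m + l) F ((take m xs @ z) @ (rev z @ drop m xs)) =
        (\<Sum>k\<in>UNIV. F ((take m xs @ z) @ k # k # rev z @ drop m xs))" if "length z = l" for z
      by (rule cap_append) (use xs that in simp)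
    then show "(if length xs = m + r then \<Sum>z | length z = l.
        cap (m + l) F (take m xs @ z @ rev z @ drop m xs) else 0) = (if length xs = m + r
        then \<Sum>z | length z = Suc l. F (take m xs @ z @ rev z @ drop m xs) else 0)"
      using xs by (simp add: sum_lists_snoc)
  qed simp
qed

text \<open>The bent identity matrix is a nest of \<open>m\<close> cups; each step of the induction
  inserts the new cup in the middle.\<close>

lemma TL_identity:
  "TL_vector (m + m) (\<lambda>w. if length w = m + m \<and> rev (take m w) = drop m w then 1 else 0)"
proof (induction m)
  case 0
  have "TL_vector 0 (\<lambda>w :: 'a list. if length w = 0 + 0 \<and> rev (take 0 w) = drop 0 w then 1 else 0)"
    by (rule TL_vector_eq[OF TL_unit]) auto
  then show ?case by (simp only: add_0_left)
next
  case (Suc m)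
  from TL_cup[OF Suc.IH, of m]
  have *: "TL_vector (Suc m + Suc m)
      (cup m (\<lambda>w :: 'a list. if length w = m + m \<and> rev (take m w) = drop m w then 1 else 0))"
    by simp
  show ?case
  proof (rule TL_vector_eq[OF *])
    fix w :: "'a list" assume w: "length w = Suc m + Suc m"
    have "m + 2 \<le> length w" using w by simp
    then obtain x p q y where x: "w = x @ p # q # y" "length x = m" by (rule list_split_pair)
    then show "cup m (\<lambda>w. if length w = m + m \<and> rev (take m w) = drop m w then 1 else 0) w =
        (if length w = Suc m + Suc m \<and> rev (take (Suc m) w) = drop (Suc m) w then 1 else 0)"
      using w by (auto simp: cup_append Suc_diff_le)
  qed auto
qed

section \<open>Projections onto the Temperley-Lieb vectors\<close>

definition TL_basis :: "nat \<Rightarrow> ('n::finite list \<Rightarrow> real) set" where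
  "TL_basis m = (SOME B. orthonormal_basis {xs. length xs = m} {f. TL_vector m f} B)"

text \<open>The entry (x, y) of Q in degree \<open>m\<close>. By
  \<open>reproducing_kernel_unique\<close> it does not depend on the chosen basis, but the explicit
  form is used again when Q is expanded in diagrams.\<close>

definition TL_kernel :: "nat \<Rightarrow> 'n::finite list \<Rightarrow> 'n list \<Rightarrow> real" where
  "TL_kernel m x y = (\<Sum>b\<in>TL_basis m. b x * b y)"

lemma TL_basis: "orthonormal_basis {xs. length xs = m} {f. TL_vector m f} (TL_basis m)"
  unfolding TL_basis_def
  by (rule someI_ex, rule orthonormal_basis_exists[OF _ function_subspace_TL])
    (auto intro: TL_vector_support)

lemma TL_kernel_reproducing:
  "reproducing_kernel {xs. length xs = m} {f. TL_vector m f} (TL_kernel m)"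
  using orthonormal_basis_imp_reproducing_kernel[OF function_subspace_TL TL_basis]
  by (simp add: TL_kernel_def[abs_def])

lemma TL_kernel_sym: "TL_kernel m x y = TL_kernel m y x"
  by (rule reproducing_kernelD(1)[OF TL_kernel_reproducing])

lemma TL_vector_TL_kernel: "TL_vector m (TL_kernel m x)"
  using reproducing_kernelD(2)[OF TL_kernel_reproducing] by simp

lemma TL_kernel_apply: "TL_vector m f \<Longrightarrow> (\<Sum>y | length y = m. TL_kernel m x y * f y) = f x"
  using reproducing_kernelD(3)[OF TL_kernel_reproducing, of f] by simp

lemma TL_kernel_odd: "odd m \<Longrightarrow> TL_kernel m x y = 0"
  by (rule TL_vector_odd[OF TL_vector_TL_kernel])

text \<open>Reversal preserves the Temperley-Lieb space and the inner product. This becomes the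
  compatibility of the functional with the star, which reverses words.\<close>

lemma TL_kernel_rev: "TL_kernel m (rev x) (rev y) = TL_kernel m x y"
proof -
  have "reproducing_kernel {xs. length xs = m} {f. TL_vector m f}
      (\<lambda>(x :: 'a list) y. TL_kernel m (rev x) (rev y))"
    unfolding reproducing_kernel_def
  proof (intro conjI allI ballI)
    show "TL_kernel m (rev x) (rev y) = TL_kernel m (rev y) (rev x)" for x y :: "'a list"
      by (rule TL_kernel_sym)
    show "(\<lambda>y. TL_kernel m (rev x) (rev y)) \<in> {f. TL_vector m f}" for x :: "'a list"
      using TL_rev[OF TL_vector_TL_kernel] by simp
  next
    fix f :: "'a list \<Rightarrow> real" and x assume "f \<in> {f. TL_vector m f}"
    then have "TL_vector m (\<lambda>y. f (rev y))" by (simp add: TL_rev)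
    from TL_kernel_apply[OF this, of "rev x"]
    show "(\<Sum>y | length y = m. TL_kernel m (rev x) (rev y) * f y) = f x"
      using sum_lists_rev[of "\<lambda>y. TL_kernel m (rev x) y * f (rev y)" m] by simp
  qed
  from reproducing_kernel_unique[OF this TL_kernel_reproducing] show ?thesis by (rule fun_cong[THEN fun_cong])
qed

lemma TL_kernel_0: "TL_kernel 0 ([] :: 'a::finite list) [] = 1"
proof -
  have *: "{y :: 'a list. length y = 0} = {[]}" by auto
  show ?thesis using TL_kernel_apply[OF TL_unit, of "[] :: 'a list"] unfolding * by simp
qed

text \<open>The cup forces the letters at \<open>a\<close> and \<open>a + 1\<close> to coincide,
  which collapses their double sum to the single sum of the cap.\<close>

lemma cup_cap_adjoint:
  fixes f :: "'n::finite list \<Rightarrow> 'v::real_vector"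
  assumes "a \<le> m"
  shows "(\<Sum>v | length v = m. g v *\<^sub>R cap a f v) = (\<Sum>u | length u = m + 2. cup a g u *\<^sub>R f u)"
proof -
  obtain l where m: "m = a + l" using assms le_Suc_ex by blast
  have "(\<Sum>u | length u = m + 2. cup a g u *\<^sub>R f u) =
      (\<Sum>x | length x = a. \<Sum>y | length y = Suc (Suc l). cup a g (x @ y) *\<^sub>R f (x @ y))"
    using sum_lists_append[of "\<lambda>u. cup a g u *\<^sub>R f u" a "Suc (Suc l)"] by (simp add: m)
  also have "\<dots> = (\<Sum>x | length x = a. \<Sum>i\<in>UNIV. \<Sum>j\<in>UNIV. \<Sum>y | length y = l.
      cup a g (x @ i # j # y) *\<^sub>R f (x @ i # j # y))"
  proof (rule sum.cong[OF refl])
    fix x :: "'n list"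
    show "(\<Sum>y | length y = Suc (Suc l). cup a g (x @ y) *\<^sub>R f (x @ y)) = (\<Sum>i\<in>UNIV. \<Sum>j\<in>UNIV.
        \<Sum>y | length y = l. cup a g (x @ i # j # y) *\<^sub>R f (x @ i # j # y))"
      using sum_lists_append[of "\<lambda>y. cup a g (x @ y) *\<^sub>R f (x @ y)" "Suc 0" "Suc l"]
        sum_lists_append[of "\<lambda>y. cup a g (x @ _ # y) *\<^sub>R f (x @ _ # y)" "Suc 0" l]
      by (simp add: sum_lists_one)
  qed
  also have "\<dots> = (\<Sum>x | length x = a. \<Sum>i\<in>UNIV. \<Sum>j\<in>UNIV. \<Sum>y | length y = l.
      if j = i then g (x @ y) *\<^sub>R f (x @ i # i # y) else 0)"
    by (intro sum.cong refl) (auto simp: cup_append)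
  also have "\<dots> = (\<Sum>x | length x = a. \<Sum>i\<in>UNIV. \<Sum>y | length y = l. \<Sum>j\<in>UNIV.
      if j = i then g (x @ y) *\<^sub>R f (x @ i # i # y) else 0)"
    by (rule sum.cong[OF refl], rule sum.cong[OF refl], rule sum.swap)
  also have "\<dots> = (\<Sum>x | length x = a. \<Sum>i\<in>UNIV. \<Sum>y | length y = l. g (x @ y) *\<^sub>R f (x @ i # i # y))"
    by simp
  also have "\<dots> = (\<Sum>x | length x = a. \<Sum>y | length y = l. \<Sum>i\<in>UNIV. g (x @ y) *\<^sub>R f (x @ i # i # y))"
    by (rule sum.cong[OF refl], rule sum.swap)
  also have "\<dots> = (\<Sum>v | length v = m. g v *\<^sub>R cap a f v)"
    by (simp add: m sum_lists_append cap_append scaleR_sum_right)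
  finally show ?thesis by simp
qed

text \<open>The orthogonality relations of u at the level of Q. The contracted row is again a
  Temperley-Lieb vector, hence fixed by the smaller kernel; adjunction turns the cap into a cup on a
  row of the smaller kernel, and that vector is fixed by the larger one.\<close>

lemma TL_kernel_orthogonality:
  assumes "length x = a" "length x' = a" "length y = l" "length y' = l"
  shows "(\<Sum>k\<in>UNIV. TL_kernel (a + 2 + l) (x @ i # j # y) (x' @ k # k # y')) =
    (if i = j then TL_kernel (a + l) (x @ y) (x' @ y') else 0)"
proof -
  let ?z = "x @ i # j # y" and ?w = "x' @ y'"
  have m: "a + 2 + l = (a + l) + 2" by simp
  have "TL_vector (a + l) (cap a (TL_kernel (a + l + 2) ?z))"
    by (rule TL_cap[OF TL_vector_TL_kernel]) auto
  from TL_kernel_apply[OF this, of ?w]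
  have "cap a (TL_kernel (a + l + 2) ?z) ?w =
      (\<Sum>v | length v = a + l. TL_kernel (a + l) ?w v * cap a (TL_kernel (a + l + 2) ?z) v)" ..
  also have "\<dots> = (\<Sum>u | length u = a + l + 2. TL_kernel (a + l + 2) ?z u * cup a (TL_kernel (a + l) ?w) u)"
    using cup_cap_adjoint[of a "a + l" "TL_kernel (a + l) ?w" "TL_kernel (a + l + 2) ?z"]
    by (simp add: mult.commute)
  also have "\<dots> = cup a (TL_kernel (a + l) ?w) ?z"
    by (rule TL_kernel_apply[OF TL_cup[OF TL_vector_TL_kernel]]) simp
  finally show ?thesis
    using assms unfolding m by (simp add: cap_append cup_append TL_kernel_sym[of _ "x @ y"])
qed

section \<open>Matrices with Temperley-Lieb blocks\<close>

definition block :: "nat \<Rightarrow> nat \<Rightarrow> ('n list \<times> 'n list \<Rightarrow> real) \<Rightarrow> 'n list \<Rightarrow> real" where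
  "block m l T w = (if length w = m + l then T (rev (take m w), drop m w) else 0)"

text \<open>\<open>block\<close> bends the row index round, so that matrices between tensor powers
  become vectors; the reversal in \<open>rev x @ y\<close> keeps the strings from crossing. Entries
  beyond \<open>M\<close> are set to 0 so that the blocks up to \<open>M\<close> determine the
  matrix.\<close>

definition TL_matrices :: "nat \<Rightarrow> ('n::finite list \<times> 'n list \<Rightarrow> real) set" where
  "TL_matrices M = {T. (\<forall>x y. length x > M \<or> length y > M \<longrightarrow> T (x, y) = 0) \<and>
     (\<forall>m\<le>M. \<forall>l\<le>M. TL_vector (m + l) (block m l T))}"

lemma block_append: "length x = m \<Longrightarrow> length y = l \<Longrightarrow> block m l T (rev x @ y) = T (x, y)"
  by (simp add: block_def)

lemma finite_length_le [simp]: "finite {xs :: 'n::finite list. length xs \<le> M}"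
  using finite_lists_length_le[of "UNIV :: 'n set" M] by simp

lemma sum_lists_le:
  fixes f :: "'n::finite list \<Rightarrow> 'b::comm_monoid_add"
  shows "(\<Sum>xs | length xs \<le> M. f xs) = (\<Sum>r\<le>M. \<Sum>xs | length xs = r. f xs)"
proof -
  have "{xs :: 'n list. length xs \<le> M} = (\<Union>r\<le>M. {xs. length xs = r})" by auto
  then show ?thesis by (simp only:) (rule sum.UNION_disjoint, auto)
qed

text \<open>Composition of planar diagrams is planar: a block of the product is the sum, over the
  middle length \<open>r\<close>, of the tensor product of two bent blocks with the facing 2r places
  contracted.\<close>

lemma TL_matrices_mult:
  assumes S: "S \<in> TL_matrices M" and T: "T \<in> TL_matrices M"
  shows "(\<lambda>(x, y). \<Sum>k | length k \<le> M. S (x, k) * T (k, y)) \<in> TL_matrices M"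
  unfolding TL_matrices_def
proof (intro CollectI conjI allI impI)
  fix x y :: "'a list" assume "length x > M \<or> length y > M"
  then show "(\<lambda>(x, y). \<Sum>k | length k \<le> M. S (x, k) * T (k, y)) (x, y) = 0"
    using S T by (auto simp: TL_matrices_def intro!: sum.neutral)
next
  fix m l assume m: "m \<le> M" and l: "l \<le> M"
  define F where "F = (\<lambda>r w. block m r S (take (m + r) w) * block r l T (drop (m + r) w))"
  define G where "G = (\<lambda>r w. if length w = m + l
      then \<Sum>z | length z = r. F r (take m w @ z @ rev z @ drop m w) else 0)"
  have "TL_vector (m + l) (G r)" if "r \<le> M" for r
  proof -
    have "TL_vector (m + r + (r + l)) (F r)"
      unfolding F_def by (rule TL_tensor) (use S T m l that in \<open>auto simp: TL_matrices_def\<close>)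
    then have "TL_vector (m + 2 * r + l) (F r)" by (simp add: mult_2 add_ac)
    then show ?thesis unfolding G_def by (rule TL_contract)
  qed
  then have "TL_vector (m + l) (\<lambda>w. \<Sum>r\<le>M. G r w)" by (intro TL_sum) auto
  then show "TL_vector (m + l) (block m l (\<lambda>(x, y). \<Sum>k | length k \<le> M. S (x, k) * T (k, y)))"
  proof (rule TL_vector_eq)
    fix w :: "'a list" assume w: "length w = m + l"
    have "F r (take m w @ z @ rev z @ drop m w) = S (rev (take m w), z) * T (z, drop m w)"
      if "length z = r" for r z
      using w that by (simp add: F_def block_def)
    then show "(\<Sum>r\<le>M. G r w) =
        block m l (\<lambda>(x, y). \<Sum>k | length k \<le> M. S (x, k) * T (k, y)) w"
      using w by (auto simp: G_def block_def sum_lists_le intro!: sum.cong)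
  qed (simp add: block_def)
qed

lemma TL_matrices_transpose:
  assumes T: "T \<in> TL_matrices M"
  shows "(\<lambda>(x, y). T (y, x)) \<in> TL_matrices M"
  unfolding TL_matrices_def
proof (intro CollectI conjI allI impI)
  fix m l assume "m \<le> M" "l \<le> M"
  then have "TL_vector (l + m) (block l m T)" using T by (simp add: TL_matrices_def)
  from TL_rev[OF this] have "TL_vector (m + l) (\<lambda>w. block l m T (rev w))" by (simp add: add.commute)
  then show "TL_vector (m + l) (block m l (\<lambda>(x, y). T (y, x)))"
    by (rule TL_vector_eq) (auto simp: block_def rev_drop[symmetric] take_rev drop_rev)
qed (use T in \<open>auto simp: TL_matrices_def\<close>)

lemma TL_matrices_identity:
  "(\<lambda>(x, y). if x \<in> {xs. length xs \<le> M} \<and> x = y then 1 else 0) \<in> TL_matrices M"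
  unfolding TL_matrices_def
proof (intro CollectI conjI allI impI)
  fix m l assume ml: "m \<le> M" "l \<le> M"
  show "TL_vector (m + l)
      (block m l (\<lambda>(x :: 'a list, y). if x \<in> {xs. length xs \<le> M} \<and> x = y then 1 else 0))"
  proof (cases "m = l")
    case True
    show ?thesis unfolding True
      by (rule TL_vector_eq[OF TL_identity]) (use ml in \<open>auto simp: block_def\<close>)
  next
    case False
    show ?thesis
    proof (rule TL_vector_eq[OF TL_zero])
      fix xs :: "'a list" assume "length xs = m + l"
      then have "rev (take m xs) \<noteq> drop m xs" using False
        by (metis add_diff_cancel_left' length_drop length_rev length_take min.absorb2 le_add1)
      then show "0 = block m l (\<lambda>(x, y). if x \<in> {xs. length xs \<le> M} \<and> x = y then 1 else 0) xs"
        by (simp add: block_def)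
    qed (simp add: block_def)
  qed
qed auto

text \<open>The projection onto \<open>TL_matrices\<close> acts block by block, on each block by
  \<open>TL_kernel\<close> of the bent words. The formula itself is independent of \<open>M\<close>;
  the cut-off appears only in the statements about it.\<close>

definition TL_matrix_kernel ::
  "'n::finite list \<times> 'n list \<Rightarrow> 'n list \<times> 'n list \<Rightarrow> real" where
  "TL_matrix_kernel p q =
     (if length (fst p) = length (fst q) \<and> length (snd p) = length (snd q)
      then TL_kernel (length (fst p) + length (snd p)) (rev (fst p) @ snd p) (rev (fst q) @ snd q)
      else 0)"

lemma TL_matrix_kernel_reproducing:
  "reproducing_kernel ({xs. length xs \<le> M} \<times> {xs. length xs \<le> M}) (TL_matrices M)
     (\<lambda>p q. if length (fst p) \<le> M \<and> length (snd p) \<le> M then TL_matrix_kernel p q else 0)"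
  (is "reproducing_kernel _ _ ?K")
  unfolding reproducing_kernel_def
proof (intro conjI allI ballI)
  show "?K p q = ?K q p" for p q :: "'a list \<times> 'a list"
    by (auto simp: TL_matrix_kernel_def TL_kernel_sym[of _ "rev (fst p) @ snd p"])
next
  fix p :: "'a list \<times> 'a list"
  obtain i i' where p: "p = (i, i')" by (cases p)
  show "?K p \<in> TL_matrices M"
    unfolding TL_matrices_def
  proof (intro CollectI conjI allI impI)
    fix m l assume ml: "m \<le> M" "l \<le> M"
    show "TL_vector (m + l) (block m l (?K p))"
    proof (cases "length i = m \<and> length i' = l")
      case True
      show ?thesis
        by (rule TL_vector_eq[OF TL_vector_TL_kernel[of _ "rev i @ i'"]])
          (use True ml in \<open>auto simp: block_def p TL_matrix_kernel_def\<close>)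
    next
      case False
      show ?thesis
        by (rule TL_vector_eq[OF TL_zero])
          (use False ml in \<open>auto simp: block_def p TL_matrix_kernel_def\<close>)
    qed
  qed (auto simp: p TL_matrix_kernel_def)
next
  fix T :: "'a list \<times> 'a list \<Rightarrow> real" and p :: "'a list \<times> 'a list" assume T: "T \<in> TL_matrices M"
  obtain i i' where p: "p = (i, i')" by (cases p)
  let ?X = "{xs :: 'a list. length xs \<le> M}"
  show "(\<Sum>q\<in>?X \<times> ?X. ?K p q * T q) = T p"
  proof (cases "length i \<le> M \<and> length i' \<le> M")
    case False
    then show ?thesis using T by (auto simp: p TL_matrices_def)
  next
    case True
    let ?m = "length i" and ?l = "length i'"
    have vec: "TL_vector (?m + ?l) (block ?m ?l T)" using T True by (simp add: TL_matrices_def)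
    have "(\<Sum>q\<in>?X \<times> ?X. ?K p q * T q) =
        (\<Sum>q\<in>{x. length x = ?m} \<times> {y. length y = ?l}. TL_matrix_kernel p q * T q)"
      by (rule sum.mono_neutral_cong_right) (use True in \<open>auto simp: p TL_matrix_kernel_def\<close>)
    also have "\<dots> = (\<Sum>x | length x = ?m. \<Sum>y | length y = ?l.
        TL_kernel (?m + ?l) (rev i @ i') (rev x @ y) * block ?m ?l T (rev x @ y))"
      unfolding sum.cartesian_product
      by (intro sum.cong refl) (auto simp: p TL_matrix_kernel_def block_append)
    also have "\<dots> = (\<Sum>x | length x = ?m. \<Sum>y | length y = ?l.
        TL_kernel (?m + ?l) (rev i @ i') (x @ y) * block ?m ?l T (x @ y))"
      by (rule sum_lists_rev)
    also have "\<dots> = (\<Sum>w | length w = ?m + ?l. TL_kernel (?m + ?l) (rev i @ i') w * block ?m ?l T w)"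
      by (rule sum_lists_append[symmetric])
    also have "\<dots> = block ?m ?l T (rev i @ i')" by (rule TL_kernel_apply[OF vec])
    also have "\<dots> = T p" by (simp add: block_append p)
    finally show ?thesis .
  qed
qed

lemma TL_matrix_kernel_positive:
  fixes c :: "'n::finite list \<Rightarrow> 'n list \<Rightarrow> real"
  shows "0 \<le> (\<Sum>i | length i \<le> M. \<Sum>j | length j \<le> M. \<Sum>i' | length i' \<le> M. \<Sum>j' | length j' \<le> M.
     c i j * c i' j' * TL_matrix_kernel (i, i') (j, j'))"
proof -
  have "0 \<le> (\<Sum>i | length i \<le> M. \<Sum>j | length j \<le> M. \<Sum>i' | length i' \<le> M. \<Sum>j' | length j' \<le> M.
      c i j * c i' j' * (if length (fst (i, i')) \<le> M \<and> length (snd (i, i')) \<le> M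
        then TL_matrix_kernel (i, i') (j, j') else 0))"
    by (rule matrix_algebra_kernel_positive[OF finite_length_le TL_matrices_mult
          TL_matrices_transpose TL_matrices_identity TL_matrix_kernel_reproducing])
  also have "(\<Sum>i | length i \<le> M. \<Sum>j | length j \<le> M. \<Sum>i' | length i' \<le> M. \<Sum>j' | length j' \<le> M.
      c i j * c i' j' * (if length (fst (i, i')) \<le> M \<and> length (snd (i, i')) \<le> M
        then TL_matrix_kernel (i, i') (j, j') else 0)) =
      (\<Sum>i | length i \<le> M. \<Sum>j | length j \<le> M. \<Sum>i' | length i' \<le> M. \<Sum>j' | length j' \<le> M.
      c i j * c i' j' * TL_matrix_kernel (i, i') (j, j'))"
    by (intro sum.cong refl) simp
  finally show ?thesis .
qed

section \<open>Functionals on the free *-algebra and the GNS seminorm\<close>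

definition word_functional :: "('g word \<Rightarrow> complex) \<Rightarrow> 'g free_star_algebra \<Rightarrow> complex" where
  "word_functional f P = (\<Sum>w\<in>Poly_Mapping.keys P. Poly_Mapping.lookup P w * f w)"

lemma word_functional_superset:
  assumes "finite S" "Poly_Mapping.keys P \<subseteq> S"
  shows "word_functional f P = (\<Sum>w\<in>S. Poly_Mapping.lookup P w * f w)"
  unfolding word_functional_def using assms
  by (intro sum.mono_neutral_left) (auto simp: in_keys_iff)

lemma word_functional_zero [simp]: "word_functional f 0 = 0"
  by (simp add: word_functional_def)

lemma word_functional_add: "word_functional f (P + Q) = word_functional f P + word_functional f Q"
proof -
  let ?S = "Poly_Mapping.keys P \<union> Poly_Mapping.keys Q"
  have "Poly_Mapping.keys (P + Q) \<subseteq> ?S" by (rule keys_add)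
  then show ?thesis
    by (simp add: word_functional_superset[of ?S] lookup_add distrib_right sum.distrib)
qed

lemma word_functional_diff: "word_functional f (P - Q) = word_functional f P - word_functional f Q"
  using word_functional_add[of f "P - Q" Q] by simp

lemma word_functional_sum: "word_functional f (sum g A) = (\<Sum>x\<in>A. word_functional f (g x))"
  by (induction A rule: infinite_finite_induct) (simp_all add: word_functional_add)

lemma word_functional_single: "word_functional f (Poly_Mapping.single w c) = c * f w"
  by (simp add: word_functional_def)

lemma free_scale_conv: "free_scale c P = Poly_Mapping.single 0 c * P"
  by (rule mult_map_scale_conv_mult)

lemma free_scale_mult_left: "free_scale c P * Q = free_scale c (P * Q)"
  by (simp add: free_scale_conv mult.assoc)

lemma free_scale_mult_right: "P * free_scale c Q = free_scale c (P * Q)"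
proof -
  have "P * Poly_Mapping.single 0 c = Poly_Mapping.single 0 c * P"
    by (subst (1 2) free_decomp[of P])
      (simp add: sum_distrib_left sum_distrib_right mult_single mult.commute)
  then show ?thesis by (simp add: free_scale_conv mult.assoc[symmetric])
qed

lemma word_functional_scale: "word_functional f (free_scale c P) = c * word_functional f P"
proof -
  have "free_scale c P =
      (\<Sum>w\<in>Poly_Mapping.keys P. Poly_Mapping.single w (c * Poly_Mapping.lookup P w))"
    unfolding free_scale_conv
    by (subst free_decomp[of P]) (simp add: sum_distrib_left mult_single)
  then show ?thesis
    by (simp add: word_functional_sum word_functional_single)
      (simp add: word_functional_def sum_distrib_left mult.assoc)
qed

lemma adj_word_adj_word [simp]: "adj_word (adj_word w) = w"
proof (cases w)
  case (Word ls)
  have "adj_letter (adj_letter l) = l" for l :: "'a letter" by (cases l) auto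
  then show ?thesis using Word by (simp add: rev_map comp_def)
qed

lemma adj_word_plus: "adj_word (v + w) = adj_word w + adj_word v"
  by (cases v; cases w) simp

lemma adj_word_eq_iff: "adj_word v = w \<longleftrightarrow> v = adj_word w"
  by auto

lemma lookup_free_star:
  "Poly_Mapping.lookup (free_star P) w = cnj (Poly_Mapping.lookup P (adj_word w))"
  by (auto simp: free_star_def lookup_sum lookup_single when_def adj_word_eq_iff in_keys_iff)

lemma free_star_free_star: "free_star (free_star P) = P"
  by (rule poly_mapping_eqI) (simp add: lookup_free_star)

lemma free_star_add: "free_star (P + Q) = free_star P + free_star Q"
  by (rule poly_mapping_eqI) (simp add: lookup_free_star lookup_add)

lemma free_star_zero: "free_star 0 = 0"
  by (rule poly_mapping_eqI) (simp add: lookup_free_star)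

lemma free_star_sum: "free_star (sum f A) = (\<Sum>x\<in>A. free_star (f x))"
  by (induction A rule: infinite_finite_induct) (simp_all add: free_star_zero free_star_add)

lemma free_star_single: "free_star (Poly_Mapping.single w c) = Poly_Mapping.single (adj_word w) (cnj c)"
  by (simp add: free_star_def)

lemma free_star_one: "free_star 1 = 1"
  by (simp add: single_one[symmetric] free_star_single zero_word_def del: single_one)

lemma free_star_mult: "free_star (P * Q) = free_star Q * free_star P"
  by (subst (1 2) free_decomp[of P], subst (1 2) free_decomp[of Q])
    (simp add: sum_product free_star_sum mult_single free_star_single adj_word_plus mult.commute
      sum.swap[of _ "Poly_Mapping.keys P"])

lemma free_star_scale: "free_star (free_scale c P) = free_scale (cnj c) (free_star P)"
  by (simp add: free_scale_conv free_star_mult free_star_single zero_word_def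
      free_scale_mult_right[of _ _ 1, unfolded free_scale_conv, simplified zero_word_def, simplified])

lemma word_functional_star_mult:
  "word_functional f (free_star P * Q) =
     (\<Sum>v\<in>Poly_Mapping.keys P. \<Sum>w\<in>Poly_Mapping.keys Q.
        cnj (Poly_Mapping.lookup P v) * Poly_Mapping.lookup Q w * f (adj_word v + w))"
proof -
  have "free_star P * Q = (\<Sum>v\<in>Poly_Mapping.keys P. \<Sum>w\<in>Poly_Mapping.keys Q.
      Poly_Mapping.single (adj_word v + w) (cnj (Poly_Mapping.lookup P v) * Poly_Mapping.lookup Q w))"
    unfolding free_star_def by (subst free_decomp[of Q]) (simp add: sum_product mult_single)
  then show ?thesis by (simp add: word_functional_sum word_functional_single)
qed

text \<open>
  The GNS construction, phrased without the quotient Hilbert space: \<open>gns_norm\<close> is a Hilbert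
  seminorm on the free *-algebra itself, on which the algebra acts by left multiplication.
\<close>

locale positive_functional =
  fixes \<phi> :: "'g free_star_algebra \<Rightarrow> complex"
  assumes add: "\<phi> (P + Q) = \<phi> P + \<phi> Q"
    and scale: "\<phi> (free_scale c P) = c * \<phi> P"
    and hermitian: "\<phi> (free_star P) = cnj (\<phi> P)"
    and positive: "0 \<le> Re (\<phi> (free_star P * P))"
begin

definition gns_norm :: "'g free_star_algebra \<Rightarrow> real" where
  "gns_norm P = sqrt (Re (\<phi> (free_star P * P)))"

lemma gns_norm_nonneg: "0 \<le> gns_norm P"
  by (simp add: gns_norm_def positive)

lemma gns_norm_square: "\<phi> (free_star P * P) = of_real ((gns_norm P)\<^sup>2)"
proof -
  have "cnj (\<phi> (free_star P * P)) = \<phi> (free_star P * P)"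
    by (simp add: hermitian[symmetric] free_star_mult free_star_free_star)
  then have "Im (\<phi> (free_star P * P)) = 0" by (simp add: complex_eq_iff)
  then show ?thesis by (simp add: gns_norm_def positive complex_eq_iff)
qed

lemma gns_norm_add_square:
  "(gns_norm (P + Q))\<^sup>2 = (gns_norm P)\<^sup>2 + (gns_norm Q)\<^sup>2 + 2 * Re (\<phi> (free_star P * Q))"
proof -
  have "\<phi> (free_star Q * P) = cnj (\<phi> (free_star P * Q))"
    by (simp add: hermitian[symmetric] free_star_mult free_star_free_star)
  then have "\<phi> (free_star (P + Q) * (P + Q)) = of_real ((gns_norm P)\<^sup>2) + of_real ((gns_norm Q)\<^sup>2)
      + (\<phi> (free_star P * Q) + cnj (\<phi> (free_star P * Q)))"
    by (simp add: free_star_add distrib_left distrib_right add gns_norm_square)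
  then have "of_real ((gns_norm (P + Q))\<^sup>2) = (of_real ((gns_norm P)\<^sup>2 + (gns_norm Q)\<^sup>2
      + 2 * Re (\<phi> (free_star P * Q))) :: complex)"
    by (simp only: gns_norm_square complex_add_cnj of_real_add)
  then show ?thesis by (simp only: of_real_eq_iff)
qed

lemma gns_norm_scale: "gns_norm (free_scale c P) = cmod c * gns_norm P"
proof -
  have "\<phi> (free_star (free_scale c P) * free_scale c P) = cnj c * (c * \<phi> (free_star P * P))"
    by (simp add: free_star_scale free_scale_mult_left free_scale_mult_right scale)
  also have "\<dots> = (c * cnj c) * of_real ((gns_norm P)\<^sup>2)"
    by (simp only: gns_norm_square mult_ac)
  also have "\<dots> = of_real ((cmod c * gns_norm P)\<^sup>2)"
    by (simp only: complex_norm_square[symmetric] of_real_mult power_mult_distrib)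
  finally have "(gns_norm (free_scale c P))\<^sup>2 = (cmod c * gns_norm P)\<^sup>2"
    by (simp only: gns_norm_square of_real_eq_iff)
  then show ?thesis by (simp add: gns_norm_nonneg power2_eq_iff_nonneg)
qed

lemma Cauchy_Schwarz: "cmod (\<phi> (free_star P * Q)) \<le> gns_norm P * gns_norm Q"
proof -
  define s where "s = \<phi> (free_star P * Q)"
  \<comment> \<open>The right-hand side is the squared norm of \<open>P\<close> minus
    \<open>r * cnj s\<close> times \<open>Q\<close>. For nonzero \<open>gns_norm Q\<close> the value
    \<open>r = 1 / (gns_norm Q)\<^sup>2\<close> is optimal; for \<open>gns_norm Q = 0\<close> a
    large \<open>r\<close> gives a contradiction unless \<open>s = 0\<close>.\<close>
  have *: "0 \<le> (gns_norm P)\<^sup>2 - 2 * r * (cmod s)\<^sup>2 + r\<^sup>2 * (cmod s)\<^sup>2 * (gns_norm Q)\<^sup>2" for r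
  proof -
    have "\<phi> (free_star P * free_scale (of_real (- r) * cnj s) Q) = of_real (- r) * (s * cnj s)"
      by (simp add: free_scale_mult_right scale s_def)
    also have "\<dots> = of_real (- r * (cmod s)\<^sup>2)"
      by (simp only: complex_norm_square[symmetric] of_real_mult)
    finally have "(gns_norm (P + free_scale (of_real (- r) * cnj s) Q))\<^sup>2 =
        (gns_norm P)\<^sup>2 + (cmod (of_real (- r) * cnj s) * gns_norm Q)\<^sup>2 + 2 * (- r * (cmod s)\<^sup>2)"
      by (simp only: gns_norm_add_square gns_norm_scale Re_complex_of_real)
    moreover have "(cmod (of_real (- r) * cnj s) * gns_norm Q)\<^sup>2 = r\<^sup>2 * (cmod s)\<^sup>2 * (gns_norm Q)\<^sup>2"
      by (simp add: norm_mult power_mult_distrib)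
    ultimately show ?thesis
      using zero_le_power2[of "gns_norm (P + free_scale (of_real (- r) * cnj s) Q)"] by simp
  qed
  have "(cmod s)\<^sup>2 \<le> (gns_norm P * gns_norm Q)\<^sup>2"
  proof (cases "gns_norm Q = 0")
    case True
    have "s = 0"
    proof (rule ccontr)
      assume "s \<noteq> 0"
      then have "(cmod s)\<^sup>2 > 0" by simp
      then have "0 \<le> (gns_norm P)\<^sup>2 - 2 * ((gns_norm P)\<^sup>2 + 1)"
        using *[of "((gns_norm P)\<^sup>2 + 1) / (cmod s)\<^sup>2"] True by simp
      then have "(gns_norm P)\<^sup>2 \<le> - 2" by (simp add: algebra_simps)
      then show False using zero_le_power2[of "gns_norm P"] by simp
    qed
    then show ?thesis by simp
  next
    case False
    then have "(gns_norm Q)\<^sup>2 > 0" by simp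
    moreover have "0 \<le> (gns_norm P)\<^sup>2 - (cmod s)\<^sup>2 / (gns_norm Q)\<^sup>2"
      using *[of "1 / (gns_norm Q)\<^sup>2"] False by (simp add: field_simps power2_eq_square)
    ultimately show ?thesis by (simp add: field_simps)
  qed
  then show ?thesis
    unfolding s_def by (rule power2_le_imp_le) (simp add: gns_norm_nonneg)
qed

lemma gns_norm_triangle: "gns_norm (P + Q) \<le> gns_norm P + gns_norm Q"
proof (rule power2_le_imp_le)
  have "Re (\<phi> (free_star P * Q)) \<le> gns_norm P * gns_norm Q"
    using Cauchy_Schwarz complex_Re_le_cmod order_trans by blast
  then show "(gns_norm (P + Q))\<^sup>2 \<le> (gns_norm P + gns_norm Q)\<^sup>2"
    by (simp add: gns_norm_add_square power2_sum)
qed (simp add: gns_norm_nonneg)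

section \<open>The operator seminorm of left multiplication\<close>

definition bound :: "'g free_star_algebra \<Rightarrow> real \<Rightarrow> bool" where
  "bound P c \<longleftrightarrow> 0 \<le> c \<and> (\<forall>Q. gns_norm (P * Q) \<le> c * gns_norm Q)"

lemma bound_add: "bound P c \<Longrightarrow> bound Q d \<Longrightarrow> bound (P + Q) (c + d)"
  unfolding bound_def distrib_right
  by (meson add_mono add_nonneg_nonneg gns_norm_triangle order_trans)

lemma bound_mult: "bound P c \<Longrightarrow> bound Q d \<Longrightarrow> bound (P * Q) (c * d)"
  unfolding bound_def mult.assoc by (meson mult_left_mono mult_nonneg_nonneg order_trans)

lemma bound_scale: "bound P c \<Longrightarrow> bound (free_scale a P) (cmod a * c)"
  unfolding bound_def by (simp add: free_scale_mult_left gns_norm_scale mult.assoc mult_left_mono)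

text \<open>The source of the C*-identity: the squared norm of \<open>P * Q\<close> is the pairing
  of \<open>Q\<close> with \<open>free_star P * P * Q\<close>, to which Cauchy-Schwarz
  applies.\<close>

lemma bound_of_star_mult:
  assumes "bound (free_star P * P) c"
  shows "bound P (sqrt c)"
  unfolding bound_def
proof (intro conjI allI)
  fix Q
  have "(gns_norm (P * Q))\<^sup>2 = cmod (\<phi> (free_star Q * (free_star P * P * Q)))"
    using gns_norm_square[of "P * Q"]
    by (simp add: free_star_mult mult.assoc norm_power)
  also have "\<dots> \<le> gns_norm Q * gns_norm (free_star P * P * Q)" by (rule Cauchy_Schwarz)
  also have "\<dots> \<le> gns_norm Q * (c * gns_norm Q)"
    using assms by (intro mult_left_mono gns_norm_nonneg) (simp add: bound_def)
  also have "\<dots> = (sqrt c * gns_norm Q)\<^sup>2"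
    using assms by (simp add: bound_def power2_eq_square)
  finally show "gns_norm (P * Q) \<le> sqrt c * gns_norm Q"
    by (rule power2_le_imp_le) (use assms gns_norm_nonneg in \<open>simp add: bound_def\<close>)
qed (use assms in \<open>simp add: bound_def\<close>)

text \<open>With \<open>?N\<close> the norm of \<open>free_star P * Q\<close>, its square is the
  pairing of \<open>Q\<close> with \<open>P * (free_star P * Q)\<close>. Cauchy-Schwarz and the
  bound for \<open>P\<close> leave one factor \<open>?N\<close> on the right, which cancels.\<close>

lemma bound_star:
  assumes "bound P c"
  shows "bound (free_star P) c"
  unfolding bound_def
proof (intro conjI allI)
  fix Q
  let ?N = "gns_norm (free_star P * Q)"
  have "?N * ?N = cmod (\<phi> (free_star Q * (P * (free_star P * Q))))"
    using gns_norm_square[of "free_star P * Q"]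
    by (simp add: free_star_mult free_star_free_star mult.assoc norm_mult power2_eq_square)
  also have "\<dots> \<le> gns_norm Q * gns_norm (P * (free_star P * Q))" by (rule Cauchy_Schwarz)
  also have "\<dots> \<le> gns_norm Q * (c * ?N)"
    using assms by (intro mult_left_mono gns_norm_nonneg) (simp add: bound_def)
  finally have "?N * ?N \<le> (c * gns_norm Q) * ?N" by (simp add: mult_ac)
  then show "?N \<le> c * gns_norm Q"
    using assms gns_norm_nonneg[of "free_star P * Q"] gns_norm_nonneg[of Q]
    by (cases "?N = 0") (auto simp: bound_def)
qed (use assms in \<open>simp add: bound_def\<close>)

definition opnorm :: "'g free_star_algebra \<Rightarrow> real" where
  "opnorm P = Inf {c. bound P c}"

lemma opnorm_le: "bound P c \<Longrightarrow> opnorm P \<le> c"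
  unfolding opnorm_def by (rule cInf_lower) (auto simp: bound_def intro!: bdd_belowI[of _ 0])

text \<open>The infimum is attained. For \<open>Q\<close> of nonzero norm every bound dominates the
  same quotient, hence so does the infimum; for \<open>Q\<close> of norm 0 any one bound forces
  \<open>P * Q\<close> to have norm 0.\<close>

lemma bound_opnorm:
  assumes "bound P c"
  shows "bound P (opnorm P)"
  unfolding bound_def
proof (intro conjI allI)
  have ne: "{c. bound P c} \<noteq> {}" using assms by auto
  show "0 \<le> opnorm P" unfolding opnorm_def by (rule cInf_greatest[OF ne]) (simp add: bound_def)
  fix Q
  show "gns_norm (P * Q) \<le> opnorm P * gns_norm Q"
  proof (cases "gns_norm Q = 0")
    case True
    then show ?thesis using assms unfolding bound_def by (metis mult_zero_right)
  next
    case False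
    then have Q: "gns_norm Q > 0" using gns_norm_nonneg[of Q] by simp
    have "gns_norm (P * Q) / gns_norm Q \<le> opnorm P"
      unfolding opnorm_def
      by (rule cInf_greatest[OF ne]) (use Q in \<open>simp add: bound_def pos_divide_le_eq\<close>)
    then show ?thesis using Q by (simp add: pos_divide_le_eq)
  qed
qed

lemma cstar_seminorm_opnorm:
  assumes bounded: "\<And>P. \<exists>c. bound P c"
  shows "cstar_seminorm opnorm"
proof -
  have b: "bound P (opnorm P)" for P using bounded bound_opnorm by blast
  have nonneg: "0 \<le> opnorm P" for P using b[of P] by (simp add: bound_def)
  have scale_le: "opnorm (free_scale c P) \<le> cmod c * opnorm P" for c P
    by (rule opnorm_le[OF bound_scale[OF b]])
  have scale_eq: "opnorm (free_scale c P) = cmod c * opnorm P" for c P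
  proof (cases "c = 0")
    case True
    then show ?thesis using scale_le[of 0 P] nonneg[of "free_scale 0 P"] by simp
  next
    case False
    have "P = free_scale (inverse c) (free_scale c P)"
      using False by (simp add: free_scale_conv mult.assoc[symmetric] mult_single)
    then have "opnorm P \<le> cmod (inverse c) * opnorm (free_scale c P)" by (metis scale_le)
    then have "cmod c * opnorm P \<le> cmod c * (cmod (inverse c) * opnorm (free_scale c P))"
      by (intro mult_left_mono) auto
    also have "\<dots> = (cmod c * cmod (inverse c)) * opnorm (free_scale c P)" by (rule mult.assoc[symmetric])
    also have "cmod c * cmod (inverse c) = 1" using False by (simp add: norm_inverse)
    finally have "cmod c * opnorm P \<le> opnorm (free_scale c P)" by simp
    with scale_le show ?thesis by (simp add: antisym)
  qed
  have star_le: "opnorm (free_star P) \<le> opnorm P" for P by (rule opnorm_le[OF bound_star[OF b]])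
  have square: "opnorm (free_star P * P) = (opnorm P)\<^sup>2" for P
  proof (rule antisym)
    have "opnorm (free_star P * P) \<le> opnorm (free_star P) * opnorm P"
      by (rule opnorm_le[OF bound_mult[OF b b]])
    also have "\<dots> \<le> opnorm P * opnorm P" by (intro mult_right_mono star_le nonneg)
    finally show "opnorm (free_star P * P) \<le> (opnorm P)\<^sup>2" by (simp add: power2_eq_square)
    have "opnorm P \<le> sqrt (opnorm (free_star P * P))"
      by (rule opnorm_le[OF bound_of_star_mult[OF b]])
    then show "(opnorm P)\<^sup>2 \<le> opnorm (free_star P * P)"
      using nonneg by (metis real_sqrt_le_iff real_sqrt_abs abs_of_nonneg)
  qed
  show ?thesis
    unfolding cstar_seminorm_def
    using opnorm_le[OF bound_add[OF b b]] opnorm_le[OF bound_mult[OF b b]] scale_eq square by blast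
qed

text \<open>The bounded elements form a unital *-subalgebra; \<open>bound_star\<close> accounts for
  the letters \<open>Adj g\<close>.\<close>

lemma bounded_of_gens:
  assumes gens: "\<And>g. \<exists>c. bound (gen g) c"
  shows "\<exists>c. bound P c"
proof -
  have letter: "\<exists>c. bound (Poly_Mapping.single (Word [l]) 1) c" for l
  proof (cases l)
    case (Adj g)
    obtain c where "bound (gen g) c" using gens by blast
    from bound_star[OF this] show ?thesis using Adj by (auto simp: free_star_single)
  qed (use gens in simp)
  have word: "\<exists>c. bound (Poly_Mapping.single (Word ls) 1) c" for ls
  proof (induction ls)
    case Nil
    have "Poly_Mapping.single (Word []) 1 = (1 :: 'g free_star_algebra)"
      by (simp add: zero_word_def[symmetric])
    then have "bound (Poly_Mapping.single (Word []) 1) 1" by (simp add: bound_def)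
    then show ?case by blast
  next
    case (Cons l ls)
    obtain c d where "bound (Poly_Mapping.single (Word [l]) 1) c" "bound (Poly_Mapping.single (Word ls) 1) d"
      using letter Cons by blast
    from bound_mult[OF this] show ?case by (auto simp: mult_single)
  qed
  have single: "\<exists>c. bound (Poly_Mapping.single w a) c" for w a
  proof -
    obtain ls where w: "w = Word ls" by (cases w)
    obtain c where "bound (Poly_Mapping.single w 1) c" using word w by blast
    from bound_scale[OF this, of a] show ?thesis by (auto simp: free_scale_conv mult_single)
  qed
  have zero: "bound 0 0" using add[of 0 0] by (simp add: bound_def gns_norm_def)
  have "\<exists>c. bound (\<Sum>w\<in>A. Poly_Mapping.single w (f w)) c" for A f
  proof (induction A rule: infinite_finite_induct)
    case (insert w A)
    then obtain c where "bound (\<Sum>w\<in>A. Poly_Mapping.single w (f w)) c" by blast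
    moreover obtain d where "bound (Poly_Mapping.single w (f w)) d" using single by blast
    ultimately have "bound (Poly_Mapping.single w (f w) + (\<Sum>w\<in>A. Poly_Mapping.single w (f w))) (d + c)"
      by (intro bound_add)
    then show ?case using insert.hyps by auto
  qed (use zero in auto)
  from this[of "Poly_Mapping.lookup P" "Poly_Mapping.keys P"] show ?thesis
    unfolding free_decomp[of P, symmetric] .
qed

text \<open>The relations act as zero on the GNS space, so \<open>opnorm\<close> is a C*-seminorm
  that kills them, and universality places it below the norm of the algebra. An element evaluating
  to 0 therefore acts as zero; applying it to the vector 1, Cauchy-Schwarz gives the claim.\<close>

theorem eval_free_zero_imp_functional_zero:
  fixes v :: "'g \<Rightarrow> 'a::unital_cstar_algebra"
  assumes univ: "universal_cstar_algebra R v"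
    and gens: "\<And>g. \<exists>c. bound (gen g) c"
    and rel: "\<And>r A B. r \<in> R \<Longrightarrow> \<phi> (A * r * B) = 0"
    and P: "eval_free v P = 0"
  shows "\<phi> P = 0"
proof -
  have bounded: "\<exists>c. bound Q c" for Q by (rule bounded_of_gens[OF gens])
  have "opnorm r = 0" if "r \<in> R" for r
  proof -
    have "gns_norm (r * Q) = 0" for Q
      using rel[OF that, of "free_star (r * Q)" Q] gns_norm_square[of "r * Q"] by (simp add: mult.assoc)
    then have "bound r 0" by (simp add: bound_def)
    then have "opnorm r \<le> 0" by (rule opnorm_le)
    moreover have "0 \<le> opnorm r" using bounded[of r] bound_opnorm by (auto simp: bound_def)
    ultimately show ?thesis by simp
  qed
  then have "opnorm P \<le> 0"
    using univ cstar_seminorm_opnorm[OF bounded] P unfolding universal_cstar_algebra_def by (metis norm_zero)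
  moreover have "bound P (opnorm P)" using bounded[of P] bound_opnorm by blast
  ultimately have "gns_norm (P * 1) \<le> 0"
    unfolding bound_def using gns_norm_nonneg[of 1] by (metis mult_zero_left order_antisym)
  then have "gns_norm P = 0" using gns_norm_nonneg[of P] by simp
  then show ?thesis using Cauchy_Schwarz[of 1 P] by (simp add: free_star_one)
qed

end

section \<open>The Haar functional\<close>

lemma sum_lists_Cons:
  fixes f :: "'n::finite list \<Rightarrow> 'b::comm_monoid_add"
  shows "(\<Sum>xs | length xs = Suc l. f xs) = (\<Sum>k\<in>UNIV. \<Sum>x | length x = l. f (k # x))"
  using sum_lists_append[of f "Suc 0" l] by (simp add: sum_lists_one)

text \<open>\<open>Gen g\<close> and \<open>Adj g\<close> get the same index because the relations
  make the generators self-adjoint.\<close>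

fun letter_index :: "'g letter \<Rightarrow> 'g" where
  "letter_index (Gen g) = g"
| "letter_index (Adj g) = g"

fun word_indices :: "'g word \<Rightarrow> 'g list" where
  "word_indices (Word ls) = map letter_index ls"

definition TL_moment :: "('n::finite \<times> 'n) word \<Rightarrow> real" where
  "TL_moment w = TL_kernel (length (word_indices w)) (map fst (word_indices w)) (map snd (word_indices w))"

lemma word_indices_plus [simp]: "word_indices (v + w) = word_indices v @ word_indices w"
  by (cases v; cases w) simp

lemma word_indices_adj [simp]: "word_indices (adj_word w) = rev (word_indices w)"
proof (cases w)
  case (Word ls)
  have "letter_index (adj_letter l) = letter_index l" for l :: "'a letter" by (cases l) auto
  then show ?thesis using Word by (simp add: rev_map comp_def)
qed

lemma TL_moment_adj: "TL_moment (adj_word w) = TL_moment w"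
  by (simp add: TL_moment_def rev_map[symmetric] TL_kernel_rev)

text \<open>The adjoint reverses the first word, which is exactly the bending in
  \<open>TL_matrix_kernel\<close>. Positivity of the functional thus becomes positivity of that
  kernel.\<close>

lemma TL_moment_adj_plus:
  "TL_moment (adj_word v + w) = TL_matrix_kernel
     (map fst (word_indices v), map fst (word_indices w))
     (map snd (word_indices v), map snd (word_indices w))"
  by (simp add: TL_moment_def TL_matrix_kernel_def rev_map)

text \<open>The first family contracts the column indices; the second contracts the row indices and
  follows by the symmetry of the kernel.\<close>

lemma TL_moment_orthogonality:
  "(\<Sum>k\<in>UNIV. TL_moment (v + Word [Gen (i, k), Gen (j, k)] + w)) = (if i = j then TL_moment (v + w) else 0)"
  "(\<Sum>k\<in>UNIV. TL_moment (v + Word [Gen (k, i), Gen (k, j)] + w)) = (if i = j then TL_moment (v + w) else 0)"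
  using TL_kernel_orthogonality[of "map fst (word_indices v)" "length (word_indices v)"
      "map snd (word_indices v)" "map fst (word_indices w)" "length (word_indices w)" "map snd (word_indices w)" i j]
    TL_kernel_orthogonality[of "map snd (word_indices v)" "length (word_indices v)"
      "map fst (word_indices v)" "map snd (word_indices w)" "length (word_indices w)" "map fst (word_indices w)" i j]
  by (simp_all add: TL_moment_def TL_kernel_sym[of _ "map snd _ @ _"])

lemma TL_moment_positive:
  fixes a :: "('n::finite \<times> 'n) word \<Rightarrow> real"
  assumes "finite S"
  shows "0 \<le> (\<Sum>v\<in>S. \<Sum>w\<in>S. a v * a w * TL_moment (adj_word v + w))"
proof -
  define I J where "I = (\<lambda>v :: ('n \<times> 'n) word. map fst (word_indices v))"
    and "J = (\<lambda>v :: ('n \<times> 'n) word. map snd (word_indices v))"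
  obtain M where M: "\<And>v. v \<in> S \<Longrightarrow> length (word_indices v) \<le> M"
    using finite_imageI[OF assms, of "\<lambda>v. length (word_indices v)"]
    by (meson bdd_above_finite bdd_above_def imageI)
  define X where "X = {xs :: 'n list. length xs \<le> M}"
  have IJ: "I v \<in> X" "J v \<in> X" if "v \<in> S" for v using M[OF that] by (auto simp: I_def J_def X_def)
  have finX: "finite X" by (simp add: X_def)
  \<comment> \<open>Words that differ only in \<open>Gen\<close> and \<open>Adj\<close> have the
    same indices; \<open>c\<close> adds up their coefficients and so turns the form over words into
    a form over pairs of multi-indices.\<close>
  define c where "c = (\<lambda>i j. \<Sum>v\<in>S. if i = I v then if j = J v then a v else 0 else 0)"
  have collect: "(\<Sum>i\<in>X. \<Sum>j\<in>X. c i j * F i j) = (\<Sum>v\<in>S. a v * F (I v) (J v))" for F :: "_ \<Rightarrow> _ \<Rightarrow> real"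
  proof -
    have "(\<Sum>i\<in>X. \<Sum>j\<in>X. c i j * F i j) =
        (\<Sum>i\<in>X. \<Sum>j\<in>X. \<Sum>v\<in>S. if i = I v then if j = J v then a v * F i j else 0 else 0)"
      unfolding c_def sum_distrib_right by (intro sum.cong refl) auto
    also have "\<dots> = (\<Sum>i\<in>X. \<Sum>v\<in>S. \<Sum>j\<in>X. if i = I v then if j = J v then a v * F i j else 0 else 0)"
      by (rule sum.cong[OF refl], rule sum.swap)
    also have "\<dots> = (\<Sum>v\<in>S. \<Sum>i\<in>X. \<Sum>j\<in>X. if i = I v then if j = J v then a v * F i j else 0 else 0)"
      by (rule sum.swap)
    also have "\<dots> = (\<Sum>v\<in>S. \<Sum>i\<in>X. if i = I v then a v * F i (J v) else 0)"
      by (intro sum.cong refl) (use IJ finX in auto)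
    also have "\<dots> = (\<Sum>v\<in>S. a v * F (I v) (J v))"
      by (rule sum.cong[OF refl]) (use IJ finX in simp)
    finally show ?thesis .
  qed
  have "0 \<le> (\<Sum>i\<in>X. \<Sum>j\<in>X. \<Sum>i'\<in>X. \<Sum>j'\<in>X. c i j * c i' j' * TL_matrix_kernel (i, i') (j, j'))"
    unfolding X_def by (rule TL_matrix_kernel_positive)
  also have "\<dots> = (\<Sum>i\<in>X. \<Sum>j\<in>X. c i j *
      (\<Sum>i'\<in>X. \<Sum>j'\<in>X. c i' j' * TL_matrix_kernel (i, i') (j, j')))"
    by (simp add: sum_distrib_left mult.assoc)
  also have "\<dots> = (\<Sum>v\<in>S. \<Sum>w\<in>S. a v * a w * TL_moment (adj_word v + w))"
    unfolding collect by (simp add: sum_distrib_left mult.assoc TL_moment_adj_plus I_def J_def)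
  finally show ?thesis .
qed

definition TL_functional :: "('n::finite \<times> 'n) free_star_algebra \<Rightarrow> complex" where
  "TL_functional = word_functional (\<lambda>w. of_real (TL_moment w))"

lemma TL_functional_linear:
  "TL_functional (P + Q) = TL_functional P + TL_functional Q"
  "TL_functional (P - Q) = TL_functional P - TL_functional Q"
  "TL_functional (sum g A) = (\<Sum>x\<in>A. TL_functional (g x))"
  "TL_functional (Poly_Mapping.single w c) = c * of_real (TL_moment w)"
  by (simp_all add: TL_functional_def word_functional_add word_functional_diff word_functional_sum
      word_functional_single)

interpretation TL: positive_functional TL_functional
proof
  fix P Q :: "('a \<times> 'a) free_star_algebra" and c
  show "TL_functional (P + Q) = TL_functional P + TL_functional Q" by (rule TL_functional_linear)
  show "TL_functional (free_scale c P) = c * TL_functional P"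
    by (simp add: TL_functional_def word_functional_scale)
  show "TL_functional (free_star P) = cnj (TL_functional P)"
    by (simp add: free_star_def TL_functional_linear TL_moment_adj)
      (simp add: TL_functional_def word_functional_def)
  let ?l = "Poly_Mapping.lookup P" and ?K = "Poly_Mapping.keys P"
  \<comment> \<open>The moments are real, so only the real part of each product
    \<open>cnj (?l v) * ?l w\<close> counts, and it splits into a product of real parts plus a
    product of imaginary parts.\<close>
  have "Re (TL_functional (free_star P * P)) =
      (\<Sum>v\<in>?K. \<Sum>w\<in>?K. Re (?l v) * Re (?l w) * TL_moment (adj_word v + w)) +
      (\<Sum>v\<in>?K. \<Sum>w\<in>?K. Im (?l v) * Im (?l w) * TL_moment (adj_word v + w))"
    by (simp add: TL_functional_def word_functional_star_mult sum.distrib[symmetric] distrib_right)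
  then show "0 \<le> Re (TL_functional (free_star P * P))"
    using TL_moment_positive[of ?K] by (simp add: add_nonneg_nonneg)
qed

lemma functional_zero_on_ideal:
  assumes "\<And>v w. TL_functional (Poly_Mapping.single v 1 * r * Poly_Mapping.single w 1) = 0"
  shows "TL_functional (A * r * B) = 0"
proof -
  have *: "TL_functional (Poly_Mapping.single v a * r * Poly_Mapping.single w b) = 0" for v w a b
  proof -
    have "Poly_Mapping.single v c = free_scale c (Poly_Mapping.single v 1)" for v :: "('a \<times> 'a) word" and c
      by (simp add: free_scale_conv mult_single)
    from this[of v a] this[of w b] show ?thesis
      by (simp only: free_scale_mult_left free_scale_mult_right TL.scale assms mult_zero_right)
  qed
  show ?thesis
    by (subst free_decomp[of A], subst free_decomp[of B])
      (simp add: sum_distrib_left sum_distrib_right TL_functional_linear(3) *)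
qed

lemma TL_functional_relation:
  assumes "r \<in> orthogonal_relations"
  shows "TL_functional (A * r * B) = 0"
proof (rule functional_zero_on_ideal)
  fix v w :: "('a \<times> 'a) word"
  have delta: "Poly_Mapping.single v 1 * (if i = j then 1 else 0) * Poly_Mapping.single w 1 =
      (if i = j then Poly_Mapping.single (v + w) 1 else (0 :: ('a \<times> 'a) free_star_algebra))" for i j :: 'a
    by (simp add: mult_single)
  have zero: "TL_functional 0 = 0" using TL_functional_linear(1)[of 0 0] by simp
  consider g where "r = gen g - free_star (gen g)"
    | i j where "r = (\<Sum>k\<in>UNIV. gen (i, k) * gen (j, k)) - (if i = j then 1 else 0)"
    | i j where "r = (\<Sum>k\<in>UNIV. gen (k, i) * gen (k, j)) - (if i = j then 1 else 0)"
    using assms by (auto simp: orthogonal_relations_def)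
  then show "TL_functional (Poly_Mapping.single v 1 * r * Poly_Mapping.single w 1) = 0"
  proof cases
    case (1 g)
    have "TL_moment (v + Word [Gen g] + w) = TL_moment (v + Word [Adj g] + w)"
      by (simp add: TL_moment_def)
    then show ?thesis
      by (simp add: 1 free_star_single left_diff_distrib right_diff_distrib mult_single TL_functional_linear)
  next
    case (2 i j)
    have "TL_functional (Poly_Mapping.single v 1 * r * Poly_Mapping.single w 1) =
        of_real ((\<Sum>k\<in>UNIV. TL_moment (v + Word [Gen (i, k), Gen (j, k)] + w)) - (if i = j then TL_moment (v + w) else 0))"
      unfolding 2 left_diff_distrib right_diff_distrib delta
      by (simp add: sum_distrib_left sum_distrib_right mult_single TL_functional_linear zero)
    then show ?thesis by (simp only: TL_moment_orthogonality) simp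
  next
    case (3 i j)
    have "TL_functional (Poly_Mapping.single v 1 * r * Poly_Mapping.single w 1) =
        of_real ((\<Sum>k\<in>UNIV. TL_moment (v + Word [Gen (k, i), Gen (k, j)] + w)) - (if i = j then TL_moment (v + w) else 0))"
      unfolding 3 left_diff_distrib right_diff_distrib delta
      by (simp add: sum_distrib_left sum_distrib_right mult_single TL_functional_linear zero)
    then show ?thesis by (simp only: TL_moment_orthogonality) simp
  qed
qed

text \<open>The squares of the entries in a column of u sum to 1, so the squared norms of
  \<open>gen (k, j) * Q\<close> over all \<open>k\<close> add up to that of \<open>Q\<close>, and no
  single one exceeds it.\<close>

lemma TL_gens_bounded: "TL.bound (gen (i, j)) 1"
  unfolding TL.bound_def
proof (intro conjI allI)
  fix Q :: "('a \<times> 'a) free_star_algebra"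
  let ?Q = "free_star Q"
  have sq: "of_real ((TL.gns_norm (gen (k, j) * Q))\<^sup>2) = TL_functional (?Q * (gen (k, j) * gen (k, j)) * Q)" for k
  proof -
    have "gen (k, j) - free_star (gen (k, j)) \<in> orthogonal_relations"
      by (auto simp: orthogonal_relations_def)
    from TL_functional_relation[OF this, of ?Q "gen (k, j) * Q"]
    have "TL_functional (?Q * (gen (k, j) * gen (k, j)) * Q) =
        TL_functional (?Q * free_star (gen (k, j)) * (gen (k, j) * Q))"
      by (simp add: left_diff_distrib right_diff_distrib TL_functional_linear mult.assoc)
    then show ?thesis
      using TL.gns_norm_square[of "gen (k, j) * Q"] by (simp add: free_star_mult mult.assoc)
  qed
  \<comment> \<open>The trivial conditional keeps the shape of the third family of relations, of
    which this is a diagonal case.\<close>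
  have "(\<Sum>k\<in>UNIV. gen (k, j) * gen (k, j)) - (if j = j then 1 else 0) \<in> orthogonal_relations"
    unfolding orthogonal_relations_def by blast
  from TL_functional_relation[OF this, of ?Q Q]
  have "TL_functional (?Q * Q) = (\<Sum>k\<in>UNIV. TL_functional (?Q * (gen (k, j) * gen (k, j)) * Q))"
    by (simp add: left_diff_distrib right_diff_distrib sum_distrib_left sum_distrib_right
        TL_functional_linear mult.assoc)
  then have "of_real ((TL.gns_norm Q)\<^sup>2) = (of_real (\<Sum>k\<in>UNIV. (TL.gns_norm (gen (k, j) * Q))\<^sup>2) :: complex)"
    by (simp only: TL.gns_norm_square sq of_real_sum)
  then have "(TL.gns_norm Q)\<^sup>2 = (\<Sum>k\<in>UNIV. (TL.gns_norm (gen (k, j) * Q))\<^sup>2)"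
    by (simp only: of_real_eq_iff)
  then have "(TL.gns_norm (gen (i, j) * Q))\<^sup>2 \<le> (TL.gns_norm Q)\<^sup>2"
    using member_le_sum[of i UNIV "\<lambda>k. (TL.gns_norm (gen (k, j) * Q))\<^sup>2"] by simp
  then show "TL.gns_norm (gen (i, j) * Q) \<le> 1 * TL.gns_norm Q"
    using power2_le_imp_le[OF _ TL.gns_norm_nonneg] by simp
qed simp

lemma eval_free_zero_imp_TL_functional_zero:
  fixes u :: "'n::finite \<Rightarrow> 'n \<Rightarrow> 'a::unital_cstar_algebra"
  assumes "is_A_o u" "eval_free (\<lambda>(i, j). u i j) P = 0"
  shows "TL_functional P = 0"
proof (rule TL.eval_free_zero_imp_functional_zero[OF assms(1)[unfolded is_A_o_def] _ _ assms(2)])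
  fix g :: "'n \<times> 'n"
  show "\<exists>c. TL.bound (gen g) c" using TL_gens_bounded by (cases g) blast
qed (rule TL_functional_relation)

section \<open>Matrix coefficients of the tensor powers of u\<close>

definition coefficient :: "('n \<Rightarrow> 'n \<Rightarrow> 'a::unital_cstar_algebra) \<Rightarrow> 'n list \<Rightarrow> 'n list \<Rightarrow> 'a" where
  "coefficient u xs ys = prod_list (map2 u xs ys)"

lemma coefficient_append:
  "length x = length x' \<Longrightarrow> coefficient u (x @ y) (x' @ y') = coefficient u x x' * coefficient u y y'"
  by (simp add: coefficient_def)

lemma coefficient_Cons: "coefficient u (x # xs) (y # ys) = u x y * coefficient u xs ys"
  by (simp add: coefficient_def)

lemma eval_word_coefficient:
  "eval_word (\<lambda>(i, j). u i j) (Word (map Gen (zip xs ys))) = coefficient u xs ys"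
proof -
  have "map (eval_letter (\<lambda>(i, j). u i j)) (map Gen zs) = map (\<lambda>(i, j). u i j) zs" for zs
    by (induction zs) auto
  then show ?thesis by (simp only: eval_word.simps coefficient_def)
qed

lemma A_o_orthogonal:
  fixes u :: "'n::finite \<Rightarrow> 'n \<Rightarrow> 'a::unital_cstar_algebra"
  assumes "is_A_o u"
  shows "(\<Sum>k\<in>UNIV. u i k * u j k) = (if i = j then 1 else 0)"
proof -
  have "(\<Sum>k\<in>UNIV. gen (i, k) * gen (j, k)) - (if i = j then 1 else 0) \<in> orthogonal_relations"
    unfolding orthogonal_relations_def by blast
  then have "eval_free (\<lambda>(i, j). u i j) ((\<Sum>k\<in>UNIV. gen (i, k) * gen (j, k)) - (if i = j then 1 else 0)) = 0"
    using assms unfolding is_A_o_def universal_cstar_algebra_def by blast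
  then show ?thesis
    by (cases "i = j") (simp_all add: eval_free_diff eval_free_sum eval_free_mult eval_free_gen
        eval_free_one)
qed

text \<open>For a cup, adjunction moves the contraction onto the coefficients, where two
  neighbouring factors combine to the entry (p, q) of uu^t, which is 1 or 0. What remains is the
  claim for the shorter word.\<close>

lemma TL_vector_fixed:
  fixes u :: "'n::finite \<Rightarrow> 'n \<Rightarrow> 'a::unital_cstar_algebra"
  assumes "is_A_o u"
  shows "TL_vector m f \<Longrightarrow> length xs = m \<Longrightarrow>
    (\<Sum>ys | length ys = m. f ys *\<^sub>R coefficient u xs ys) = f xs *\<^sub>R 1"
proof (induction arbitrary: xs rule: TL_vector.induct)
  case TL_unit
  have "{ys :: 'n list. length ys = 0} = {[]}" by auto
  then show ?case using TL_unit by (simp add: coefficient_def)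
next
  case (TL_scale m f c)
  then show ?case by (simp add: scaleR_scaleR[symmetric] scaleR_sum_right[symmetric] del: scaleR_scaleR)
next
  case (TL_cup m f a)
  have "a + 2 \<le> length xs" using TL_cup by simp
  then obtain x p q y where x: "xs = x @ p # q # y" "length x = a" by (rule list_split_pair)
  have cap: "cap a (coefficient u xs) v = (if p = q then coefficient u (x @ y) v else 0)"
    if v: "length v = m" for v
  proof -
    have "a \<le> length v" using TL_cup.hyps v by simp
    then obtain v1 v2 where v': "v = v1 @ v2" "length v1 = a" by (rule list_split)
    have "cap a (coefficient u xs) v =
        (\<Sum>k\<in>UNIV. coefficient u x v1 * (u p k * u q k) * coefficient u y v2)"
      using x v' by (simp add: cap_append coefficient_append coefficient_Cons mult.assoc)
    also have "\<dots> = coefficient u x v1 * (\<Sum>k\<in>UNIV. u p k * u q k) * coefficient u y v2"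
      by (simp only: sum_distrib_left sum_distrib_right)
    finally show ?thesis
      using x v' by (simp add: A_o_orthogonal[OF assms] coefficient_append)
  qed
  have "(\<Sum>ys | length ys = m + 2. cup a f ys *\<^sub>R coefficient u xs ys) =
      (\<Sum>v | length v = m. f v *\<^sub>R cap a (coefficient u xs) v)"
    by (rule cup_cap_adjoint[OF TL_cup.hyps(2), symmetric])
  also have "\<dots> = (\<Sum>v | length v = m. f v *\<^sub>R (if p = q then coefficient u (x @ y) v else 0))"
    by (intro sum.cong refl) (simp add: cap)
  also have "\<dots> = cup a f xs *\<^sub>R 1"
    using TL_cup.IH[of "x @ y"] TL_cup.prems x by (simp add: cup_append)
  finally show ?case .
qed (simp_all add: scaleR_add_left sum.distrib)

lemma comultiplication_coefficient:
  fixes u :: "'n::finite \<Rightarrow> 'n \<Rightarrow> 'a::unital_cstar_algebra"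
    and \<tau> :: "'a \<Rightarrow> 'a \<Rightarrow> 't::unital_cstar_algebra"
  assumes \<tau>: "is_cstar_tensor \<tau>" and \<Delta>: "is_comultiplication u \<tau> \<Delta>" and len: "length xs = length ys"
  shows "\<Delta> (coefficient u xs ys) =
    (\<Sum>ks | length ks = length xs. \<tau> (coefficient u xs ks) (coefficient u ks ys))"
  using len
proof (induction xs ys rule: list_induct2)
  case Nil
  have "{ys :: 'n list. length ys = 0} = {[]}" by auto
  then show ?case using \<tau> \<Delta>
    by (simp add: coefficient_def is_cstar_tensor_def is_comultiplication_def star_hom_def)
next
  case (Cons x xs y ys)
  have mult: "\<tau> a b * \<tau> a' b' = \<tau> (a * a') (b * b')" for a b a' b'
    using \<tau> by (simp add: is_cstar_tensor_def)
  have "\<Delta> (coefficient u (x # xs) (y # ys)) = \<Delta> (u x y) * \<Delta> (coefficient u xs ys)"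
    using \<Delta> by (simp add: coefficient_Cons is_comultiplication_def star_hom_def)
  also have "\<dots> = (\<Sum>k\<in>UNIV. \<tau> (u x k) (u k y)) *
      (\<Sum>ks | length ks = length xs. \<tau> (coefficient u xs ks) (coefficient u ks ys))"
    using \<Delta> by (simp add: Cons.IH is_comultiplication_def)
  also have "\<dots> = (\<Sum>ks | length ks = length (x # xs).
      \<tau> (coefficient u (x # xs) ks) (coefficient u ks (y # ys)))"
    by (simp add: sum_product mult sum_lists_Cons coefficient_Cons)
  finally show ?case .
qed

theorem haar_functional_eq_TL_kernel:
  fixes u :: "'n::finite \<Rightarrow> 'n \<Rightarrow> 'a::unital_cstar_algebra"
    and \<tau> :: "'a \<Rightarrow> 'a \<Rightarrow> 't::unital_cstar_algebra"
  assumes A_o: "is_A_o u" and \<tau>: "is_cstar_tensor \<tau>" and \<Delta>: "is_comultiplication u \<tau> \<Delta>"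
    and h: "is_haar_functional \<tau> \<Delta> h"
    and xs: "length xs = m" and ys: "length ys = m"
  shows "h (coefficient u xs ys) = of_real (TL_kernel m xs ys)"
proof -
  have h_add: "h (a + b) = h a + h b" and h_scale: "h (scaleC c a) = c * h a" and h_one: "h 1 = 1" for a b c
    using h by (auto simp: is_haar_functional_def clinear_form_def)
  have h_zero: "h 0 = 0" using h_add[of 0 0] by simp
  have h_sum: "h (sum f A) = (\<Sum>x\<in>A. h (f x))" for f and A :: "'n list set"
    by (induction A rule: infinite_finite_induct) (simp_all add: h_zero h_add)
  obtain T where T: "clinear_map T" "\<And>a b. T (\<tau> a b) = scaleC (h a) b"
      "\<And>a. T (\<Delta> a) = scaleC (h a) 1"
    using h unfolding is_haar_functional_def is_tensor_id_def by blast
  have T_add: "T (a + b) = T a + T b" for a b using T(1) by (simp add: clinear_map_def)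
  have T_zero: "T 0 = 0" using T_add[of 0 0] by simp
  have T_sum: "T (sum f A) = (\<Sum>x\<in>A. T (f x))" for f and A :: "'n list set"
    by (induction A rule: infinite_finite_induct) (simp_all add: T_zero T_add)

  \<comment> \<open>\<open>T\<close> is the slice map that replaces the first tensor factor by its
    moment, applied here to the comultiplied coefficient.\<close>
  have "(\<Sum>ks | length ks = m. scaleC (h (coefficient u xs ks)) (coefficient u ks ys)) = T (\<Delta> (coefficient u xs ys))"
    using comultiplication_coefficient[OF \<tau> \<Delta>, of xs ys] xs ys by (simp add: T_sum T(2))
  also have "\<dots> = scaleC (h (coefficient u xs ys)) 1" by (rule T(3))
  finally have invariant: "(\<Sum>ks | length ks = m. scaleC (h (coefficient u xs ks)) (coefficient u ks ys)) =
      scaleC (h (coefficient u xs ys)) 1" .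

  \<comment> \<open>\<open>P\<close> lifts the invariance identity to the free algebra; it is not
    the moment matrix. As it evaluates to 0, \<open>TL_functional\<close> kills it, and this says
    that the moment matrix equals its own product with Q.\<close>
  define P where "P = (\<Sum>ks | length ks = m.
      Poly_Mapping.single (Word (map Gen (zip ks ys))) (h (coefficient u xs ks)))
      - Poly_Mapping.single 0 (h (coefficient u xs ys))"
  have "eval_free (\<lambda>(i, j). u i j) P = 0"
    using invariant
    by (simp add: P_def eval_free_diff eval_free_sum eval_free_single eval_word_coefficient zero_word_def
        del: eval_word.simps(1)) (simp add: coefficient_def)
  then have "TL_functional P = 0" by (rule eval_free_zero_imp_TL_functional_zero[OF A_o])
  moreover have "TL_moment (Word (map Gen (zip ks ys))) = TL_kernel m ks ys" if "length ks = m" for ks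
    using that ys by (simp add: TL_moment_def comp_def)
  moreover have "TL_moment (0 :: ('n \<times> 'n) word) = 1"
    by (simp add: zero_word_def TL_moment_def TL_kernel_0)
  ultimately have "h (coefficient u xs ys) =
      (\<Sum>ks | length ks = m. h (coefficient u xs ks) * of_real (TL_kernel m ks ys))"
    by (simp add: P_def TL_functional_linear)
  \<comment> \<open>Read the other way, the sum is \<open>h\<close> of a row of Q paired with the
    coefficients. Rows of Q are fixed vectors, so the argument of \<open>h\<close> is a multiple of
    1 and the result is an entry of Q.\<close>
  also have "\<dots> = h (\<Sum>ks | length ks = m. TL_kernel m ys ks *\<^sub>R coefficient u xs ks)"
    by (simp add: h_sum scaleR_eq_scaleC h_scale TL_kernel_sym[of m ys] mult.commute)
  also have "\<dots> = of_real (TL_kernel m xs ys)"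
    unfolding TL_vector_fixed[OF A_o TL_vector_TL_kernel xs]
    by (simp add: scaleR_eq_scaleC h_scale h_one TL_kernel_sym[of m xs])
  finally show ?thesis .
qed

section \<open>Non-crossing pairings\<close>

text \<open>From here on a pairing is handled as a partner relation: every point has exactly one
  partner. Unordered pairs \<open>{x, y}\<close> thereby replace blocks and disjointness.\<close>

lemma TL_diagrams_iff:
  "p \<in> TL_diagrams k \<longleftrightarrow>
     (\<forall>B\<in>p. \<exists>a b. B = {a, b} \<and> 1 \<le> a \<and> a < b \<and> b \<le> 2 * k) \<and>
     (\<forall>x. 1 \<le> x \<longrightarrow> x \<le> 2 * k \<longrightarrow> (\<exists>y. {x, y} \<in> p)) \<and>
     (\<forall>x y z. {x, y} \<in> p \<longrightarrow> {x, z} \<in> p \<longrightarrow> y = z) \<and>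
     (\<forall>a b c d. a < b \<longrightarrow> b < c \<longrightarrow> c < d \<longrightarrow> {a, c} \<in> p \<longrightarrow> {b, d} \<notin> p)"
  (is "_ \<longleftrightarrow> ?blocks \<and> ?total \<and> ?unique \<and> ?nc")
proof
  assume p: "p \<in> TL_diagrams k"
  then have U: "\<Union>p = {1..2 * k}" and disj: "\<And>B C. B \<in> p \<Longrightarrow> C \<in> p \<Longrightarrow> B \<noteq> C \<Longrightarrow> B \<inter> C = {}"
    and card: "\<And>B. B \<in> p \<Longrightarrow> card B = 2" and nc: ?nc
    by (auto simp: TL_diagrams_def partition_on_def disjoint_def)
  have blocks: ?blocks
  proof
    fix B assume B: "B \<in> p"
    obtain x y where xy: "B = {x, y}" "x \<noteq> y" using card[OF B] by (auto simp: card_2_iff)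
    have "x \<in> {1..2 * k}" "y \<in> {1..2 * k}" using U B xy by blast+
    moreover have "{x, y} = {y, x}" by auto
    ultimately show "\<exists>a b. B = {a, b} \<and> 1 \<le> a \<and> a < b \<and> b \<le> 2 * k"
      using xy by (metis atLeastAtMost_iff linorder_neq_iff)
  qed
  moreover have ?total
  proof (intro allI impI)
    fix x assume "1 \<le> x" "x \<le> 2 * k"
    then have "x \<in> \<Union>p" unfolding U by simp
    then obtain B where B: "B \<in> p" "x \<in> B" by (rule UnionE)
    then obtain a b where ab: "B = {a, b}" using bspec[OF blocks B(1)] by (elim exE conjE)
    have "B = {x, if x = a then b else a}" using ab B(2) by auto
    with B(1) have "{x, if x = a then b else a} \<in> p" by simp
    then show "\<exists>y. {x, y} \<in> p" by (rule exI)
  qed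
  moreover have ?unique
  proof (intro allI impI)
    fix x y z assume xy: "{x, y} \<in> p" and xz: "{x, z} \<in> p"
    have "{x, y} = {x, z}" by (rule ccontr) (use disj[OF xy xz] in simp)
    moreover have "x \<noteq> y" using card[OF xy] by auto
    ultimately show "y = z" by (auto simp: doubleton_eq_iff)
  qed
  ultimately show "?blocks \<and> ?total \<and> ?unique \<and> ?nc" using nc by (intro conjI)
next
  assume *: "?blocks \<and> ?total \<and> ?unique \<and> ?nc"
  note blocks = *[THEN conjunct1] and total = *[THEN conjunct2, THEN conjunct1]
    and unique = *[THEN conjunct2, THEN conjunct2, THEN conjunct1]
    and nc = *[THEN conjunct2, THEN conjunct2, THEN conjunct2]
  have "\<Union>p = {1..2 * k}"
  proof (intro equalityI subsetI)
    fix x assume "x \<in> \<Union>p"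
    then obtain B where B: "B \<in> p" "x \<in> B" by (rule UnionE)
    obtain a b where "B = {a, b}" "1 \<le> a" "a < b" "b \<le> 2 * k"
      using bspec[OF blocks B(1)] by (elim exE conjE)
    with B(2) show "x \<in> {1..2 * k}" by auto
  next
    fix x assume "x \<in> {1..2 * k}"
    then obtain y where "{x, y} \<in> p" using total[rule_format, of x] by auto
    then show "x \<in> \<Union>p" by (rule UnionI) simp
  qed
  moreover have "disjoint p"
    unfolding disjoint_def
  proof (intro ballI impI)
    fix B C assume BC: "B \<in> p" "C \<in> p" "B \<noteq> C"
    show "B \<inter> C = {}"
    proof (rule ccontr)
      assume "B \<inter> C \<noteq> {}"
      then obtain x where x: "x \<in> B" "x \<in> C" by auto
      have pair: "\<exists>y. D = {x, y}" if D: "D \<in> p" "x \<in> D" for D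
      proof -
        obtain a b where "D = {a, b}" using bspec[OF blocks D(1)] by (elim exE conjE)
        then have "D = {x, if x = a then b else a}" using D(2) by auto
        then show ?thesis by blast
      qed
      obtain y z where yz: "B = {x, y}" "C = {x, z}" using pair[OF BC(1) x(1)] pair[OF BC(2) x(2)] by blast
      then have "y = z" using BC by (intro unique[rule_format, of x]) auto
      then show False using yz BC by simp
    qed
  qed
  moreover have card: "card B = 2" if B: "B \<in> p" for B
  proof -
    obtain a b where "B = {a, b}" "a < b" using bspec[OF blocks B] by (elim exE conjE)
    then show ?thesis by simp
  qed
  moreover have "{} \<notin> p" using card[of "{}"] by auto
  moreover have "\<not> (\<exists>a b c d. a < b \<and> b < c \<and> c < d \<and> {a, c} \<in> p \<and> {b, d} \<in> p)"
    using nc by blast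
  ultimately show "p \<in> TL_diagrams k"
    unfolding TL_diagrams_def partition_on_def by (intro CollectI conjI ballI)
qed

lemma TL_diagramsD:
  assumes "p \<in> TL_diagrams k"
  shows "B \<in> p \<Longrightarrow> \<exists>a b. B = {a, b} \<and> 1 \<le> a \<and> a < b \<and> b \<le> 2 * k"
    and "1 \<le> x \<Longrightarrow> x \<le> 2 * k \<Longrightarrow> \<exists>y. {x, y} \<in> p"
    and "{x, y} \<in> p \<Longrightarrow> {x, z} \<in> p \<Longrightarrow> y = z"
    and "a < b \<Longrightarrow> b < c \<Longrightarrow> c < d \<Longrightarrow> {a, c} \<in> p \<Longrightarrow> {b, d} \<notin> p"
    and "{x, y} \<in> p \<Longrightarrow> 1 \<le> x \<and> x \<le> 2 * k \<and> 1 \<le> y \<and> y \<le> 2 * k \<and> x \<noteq> y"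
proof -
  note * = assms[unfolded TL_diagrams_iff]
  note blocks = *[THEN conjunct1] and total = *[THEN conjunct2, THEN conjunct1]
    and unique = *[THEN conjunct2, THEN conjunct2, THEN conjunct1]
    and nc = *[THEN conjunct2, THEN conjunct2, THEN conjunct2]
  show "B \<in> p \<Longrightarrow> \<exists>a b. B = {a, b} \<and> 1 \<le> a \<and> a < b \<and> b \<le> 2 * k"
    by (rule blocks[THEN bspec])
  show "1 \<le> x \<Longrightarrow> x \<le> 2 * k \<Longrightarrow> \<exists>y. {x, y} \<in> p" by (rule total[rule_format])
  show "{x, y} \<in> p \<Longrightarrow> {x, z} \<in> p \<Longrightarrow> y = z" by (rule unique[rule_format])
  show "a < b \<Longrightarrow> b < c \<Longrightarrow> c < d \<Longrightarrow> {a, c} \<in> p \<Longrightarrow> {b, d} \<notin> p" by (rule nc[rule_format])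
  show "1 \<le> x \<and> x \<le> 2 * k \<and> 1 \<le> y \<and> y \<le> 2 * k \<and> x \<noteq> y" if xy: "{x, y} \<in> p"
  proof -
    obtain a b where "{x, y} = {a, b}" "1 \<le> a" "a < b" "b \<le> 2 * k" using bspec[OF blocks xy] by blast
    then show ?thesis by (auto simp: doubleton_eq_iff)
  qed
qed

lemma finite_TL_diagrams [simp]: "finite (TL_diagrams k)"
proof (rule finite_subset)
  show "TL_diagrams k \<subseteq> Pow (Pow {1..2 * k})"
  proof
    fix p assume "p \<in> TL_diagrams k"
    then have "\<Union>p = {1..2 * k}" by (simp add: TL_diagrams_def partition_on_def)
    then show "p \<in> Pow (Pow {1..2 * k})" by blast
  qed
qed simp

lemma TL_diagrams_0: "TL_diagrams 0 = {{}}"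
proof -
  have "p = {}" if "p \<in> TL_diagrams 0" for p
  proof (rule ccontr)
    assume "p \<noteq> {}"
    then obtain B where "B \<in> p" by blast
    from TL_diagramsD(1)[OF that this] show False by auto
  qed
  moreover have "{} \<in> TL_diagrams 0" by (simp add: TL_diagrams_iff)
  ultimately show ?thesis by blast
qed

section \<open>Insertion and removal of adjacent pairs\<close>

definition shift :: "nat \<Rightarrow> nat \<Rightarrow> nat" where
  "shift a r = (if r \<le> a then r else r + 2)"

text \<open>Points count from 1, so the new pair \<open>{a + 1, a + 2}\<close> sits at the list
  positions \<open>a\<close> and \<open>a + 1\<close> that \<open>cup a\<close> fills.\<close>

definition insert_pair :: "nat \<Rightarrow> nat set set \<Rightarrow> nat set set" where
  "insert_pair a p = insert {a + 1, a + 2} ((`) (shift a) ` p)"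

lemma shift_eq_iff [simp]: "shift a r = shift a s \<longleftrightarrow> r = s"
  and shift_less_iff [simp]: "shift a r < shift a s \<longleftrightarrow> r < s"
  by (auto simp: shift_def)

lemma shift_neq [simp]: "shift a r \<noteq> Suc a" "shift a r \<noteq> Suc (Suc a)" "Suc a \<noteq> shift a r" "Suc (Suc a) \<noteq> shift a r"
  by (auto simp: shift_def)

lemma shift_surj: "x \<noteq> a + 1 \<Longrightarrow> x \<noteq> a + 2 \<Longrightarrow> \<exists>r. x = shift a r"
  by (rule exI[of _ "if x \<le> a then x else x - 2"]) (auto simp: shift_def)

lemma mem_insert_pair_iff:
  "{x, y} \<in> insert_pair a p \<longleftrightarrow>
     {x, y} = {a + 1, a + 2} \<or> (\<exists>r s. x = shift a r \<and> y = shift a s \<and> {r, s} \<in> p)"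
proof -
  have "\<exists>r s. x = shift a r \<and> y = shift a s \<and> {r, s} \<in> p" if B: "B \<in> p" "{x, y} = shift a ` B" for B
  proof -
    have "x \<in> shift a ` B" "y \<in> shift a ` B" unfolding B(2)[symmetric] by auto
    then obtain r s where rs: "r \<in> B" "s \<in> B" "x = shift a r" "y = shift a s" by blast
    have "shift a ` B = shift a ` {r, s}" using B(2) rs by simp
    moreover have "inj (shift a)" by (auto simp: inj_def)
    ultimately have "B = {r, s}" by (simp only: inj_image_eq_iff)
    with rs B(1) show ?thesis by blast
  qed
  moreover have "{shift a r, shift a s} \<in> (`) (shift a) ` p" if "{r, s} \<in> p" for r s
    using that by (intro image_eqI[of _ _ "{r, s}"]) auto
  ultimately show ?thesis by (auto simp: insert_pair_def)
qed

lemma shift_mem_insert_pair: "{shift a r, shift a s} \<in> insert_pair a p \<longleftrightarrow> {r, s} \<in> p"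
  unfolding mem_insert_pair_iff by (auto simp: doubleton_eq_iff)

lemma insert_pair_TL_diagrams:
  assumes p: "p \<in> TL_diagrams k" and a: "a \<le> 2 * k"
  shows "insert_pair a p \<in> TL_diagrams (k + 1)"
  unfolding TL_diagrams_iff
proof (intro conjI ballI allI impI)
  fix B assume "B \<in> insert_pair a p"
  then consider "B = {a + 1, a + 2}" | C where "C \<in> p" "B = shift a ` C"
    by (auto simp: insert_pair_def)
  then show "\<exists>c d. B = {c, d} \<and> 1 \<le> c \<and> c < d \<and> d \<le> 2 * (k + 1)"
  proof cases
    case 1
    then show ?thesis using a by (intro exI[of _ "a + 1"] exI[of _ "a + 2"]) auto
  next
    case 2
    then obtain c d where "C = {c, d}" "1 \<le> c" "c < d" "d \<le> 2 * k" using TL_diagramsD(1)[OF p] by blast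
    then show ?thesis using 2
      by (intro exI[of _ "shift a c"] exI[of _ "shift a d"]) (auto simp: shift_def)
  qed
next
  fix x assume x: "1 \<le> x" "x \<le> 2 * (k + 1)"
  show "\<exists>y. {x, y} \<in> insert_pair a p"
  proof (cases "x = a + 1 \<or> x = a + 2")
    case True
    then show ?thesis by (auto simp: insert_pair_def insert_commute)
  next
    case False
    then obtain r where r: "x = shift a r" using shift_surj by blast
    then have "1 \<le> r" "r \<le> 2 * k" using x a by (auto simp: shift_def split: if_splits)
    then obtain s where "{r, s} \<in> p" using TL_diagramsD(2)[OF p] by blast
    then show ?thesis using r shift_mem_insert_pair by blast
  qed
next
  fix x y z assume "{x, y} \<in> insert_pair a p" "{x, z} \<in> insert_pair a p"
  then show "y = z" unfolding mem_insert_pair_iff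
    by (auto simp: doubleton_eq_iff dest: TL_diagramsD(3)[OF p])
next
  fix b c d e assume lt: "b < c" "c < d" "d < e" and bd: "{b, d} \<in> insert_pair a p"
  show "{c, e} \<notin> insert_pair a p"
  proof
    assume ce: "{c, e} \<in> insert_pair a p"
    have "{b, d} \<noteq> {a + 1, a + 2}" "{c, e} \<noteq> {a + 1, a + 2}"
      using lt by (auto simp: doubleton_eq_iff)
    then show False using bd ce lt TL_diagramsD(4)[OF p] unfolding mem_insert_pair_iff
      by (metis shift_less_iff)
  qed
qed

text \<open>Take a pair of minimal length \<open>d\<close>. If \<open>d > 1\<close>, the partner of
  the point next to its left end is enclosed, because pairs do not cross, and so gives a shorter
  pair.\<close>

lemma adjacent_pair_exists:
  assumes q: "q \<in> TL_diagrams (k + 1)"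
  shows "\<exists>a. {a + 1, a + 2} \<in> q"
proof -
  define P where "P = (\<lambda>d. \<exists>a. {a, a + d} \<in> q \<and> d > 0)"
  obtain y where y: "{1, y} \<in> q" using TL_diagramsD(2)[OF q, of 1] by auto
  then have "y > 1" using TL_diagramsD(5)[OF q y] by auto
  then have "P (y - 1)" using y by (auto simp: P_def intro!: exI[of _ 1])
  then have PL: "P (LEAST d. P d)" by (rule LeastI)
  define d where "d = (LEAST d. P d)"
  obtain a where a: "{a, a + d} \<in> q" "d > 0" using PL by (auto simp: P_def d_def)
  have min: "d \<le> e" if "P e" for e unfolding d_def by (rule Least_le) (rule that)
  have a1: "1 \<le> a" "a + d \<le> 2 * (k + 1)" using TL_diagramsD(5)[OF q a(1)] by auto
  show ?thesis
  proof (cases "d = 1")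
    case True
    \<comment> \<open>The pair found is \<open>{a, a + 1}\<close> with \<open>a\<close> at least 1,
      whence the witness \<open>a - 1\<close>.\<close>
    then show ?thesis using a a1 by (intro exI[of _ "a - 1"]) simp
  next
    case False
    then have d: "d > 1" using a by simp
    obtain c where c: "{a + 1, c} \<in> q" using TL_diagramsD(2)[OF q, of "a + 1"] a1 d by auto
    have "c \<noteq> a" using c a d TL_diagramsD(3)[OF q, of a "a + 1" "a + d"] by (auto simp: insert_commute)
    moreover have "c \<noteq> a + 1" using TL_diagramsD(5)[OF q c] by auto
    moreover have "c \<noteq> a + d"
      using c a d TL_diagramsD(3)[OF q, of "a + d" "a + 1" a] by (auto simp: insert_commute)
    moreover have "\<not> c < a"
      using TL_diagramsD(4)[OF q, of c a "a + 1" "a + d"] c a d by (auto simp: insert_commute)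
    moreover have "\<not> a + d < c"
      using TL_diagramsD(4)[OF q, of a "a + 1" "a + d" c] c a d by auto
    ultimately have "a + 1 < c" "c < a + d" by auto
    then have "P (c - (a + 1))" using c by (auto simp: P_def intro!: exI[of _ "a + 1"])
    then have "d \<le> c - (a + 1)" by (rule min)
    with \<open>a + 1 < c\<close> \<open>c < a + d\<close> have False by linarith
    then show ?thesis ..
  qed
qed

text \<open>The induction principle for diagrams. After deletion of an adjacent pair the remaining
  points keep their partners, since \<open>a + 1\<close> and \<open>a + 2\<close> are partners of
  each other only.\<close>

lemma TL_diagrams_Suc:
  assumes q: "q \<in> TL_diagrams (k + 1)"
  obtains a p where "a \<le> 2 * k" "p \<in> TL_diagrams k" "q = insert_pair a p"
proof -
  obtain a where a: "{a + 1, a + 2} \<in> q" using adjacent_pair_exists[OF q] by blast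
  have ak: "a \<le> 2 * k" using TL_diagramsD(5)[OF q a] by simp
  define p where "p = {B. shift a ` B \<in> q}"
  have pair: "{r, s} \<in> p \<longleftrightarrow> {shift a r, shift a s} \<in> q" for r s by (simp add: p_def)
  have bound: "shift a r \<le> 2 * (k + 1) \<longleftrightarrow> r \<le> 2 * k" "1 \<le> shift a r \<longleftrightarrow> 1 \<le> r" for r
    using ak by (auto simp: shift_def)
  have comm: "{x, y} \<in> q \<Longrightarrow> {y, x} \<in> q" for x y by (subst insert_commute)
  have q1: "y = a + 2" if "{a + 1, y} \<in> q" for y by (rule TL_diagramsD(3)[OF q that a])
  have q2: "y = a + 1" if "{a + 2, y} \<in> q" for y by (rule TL_diagramsD(3)[OF q that comm[OF a]])
  have other: "\<exists>s. y = shift a s" if "{shift a r, y} \<in> q" for r y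
  proof (rule shift_surj)
    show "y \<noteq> a + 1" using q1[of "shift a r"] comm[OF that] by auto
    show "y \<noteq> a + 2" using q2[of "shift a r"] comm[OF that] by auto
  qed
  have p_blocks: "\<exists>c d. B = {c, d} \<and> 1 \<le> c \<and> c < d \<and> d \<le> 2 * k" if "B \<in> p" for B
  proof -
    have "shift a ` B \<in> q" using that by (simp add: p_def)
    from TL_diagramsD(1)[OF q this]
    obtain x y where xy: "shift a ` B = {x, y}" "1 \<le> x" "x < y" "y \<le> 2 * (k + 1)"
      by (elim exE conjE)
    have "x \<in> shift a ` B" "y \<in> shift a ` B" unfolding xy(1) by auto
    then obtain c d where cd: "x = shift a c" "y = shift a d" by blast
    have "shift a ` B = shift a ` {c, d}" using xy cd by simp
    moreover have "inj (shift a)" by (auto simp: inj_def)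
    ultimately have "B = {c, d}" by (simp only: inj_image_eq_iff)
    then show ?thesis using xy cd bound by auto
  qed
  have "p \<in> TL_diagrams k"
    unfolding TL_diagrams_iff
  proof (intro conjI ballI allI impI)
    fix x assume "1 \<le> x" "x \<le> 2 * k"
    then obtain y where "{shift a x, y} \<in> q" using TL_diagramsD(2)[OF q, of "shift a x"] bound by blast
    then show "\<exists>y. {x, y} \<in> p" using other pair by blast
  next
    fix x y z assume "{x, y} \<in> p" "{x, z} \<in> p"
    then have "shift a y = shift a z" unfolding pair by (rule TL_diagramsD(3)[OF q])
    then show "y = z" by simp
  next
    fix b c d e assume "b < c" "c < d" "d < e" "{b, d} \<in> p"
    then show "{c, e} \<notin> p"
      using TL_diagramsD(4)[OF q, of "shift a b" "shift a c" "shift a d" "shift a e"] unfolding pair by simp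
  qed (rule p_blocks)
  moreover have "q = insert_pair a p"
  proof (rule set_eqI)
    fix B
    have "{x, y} \<in> q \<longleftrightarrow> {x, y} \<in> insert_pair a p" for x y
    proof (cases "\<exists>r. x = shift a r")
      case True
      then obtain r where r: "x = shift a r" by blast
      show ?thesis
      proof (cases "\<exists>s. y = shift a s")
        case True
        then obtain s where "y = shift a s" by blast
        with r show ?thesis by (simp only: shift_mem_insert_pair pair)
      next
        case False
        moreover have "{x, y} \<noteq> {a + 1, a + 2}" by (simp add: doubleton_eq_iff r)
        ultimately show ?thesis using other[of r y] unfolding mem_insert_pair_iff r by blast
      qed
    next
      case False
      then have x: "x = a + 1 \<or> x = a + 2" using shift_surj by blast
      have "{x, y} \<in> q \<longleftrightarrow> {x, y} = {a + 1, a + 2}"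
      proof
        assume xy: "{x, y} \<in> q"
        from x show "{x, y} = {a + 1, a + 2}"
        proof
          assume "x = a + 1"
          with q1[of y] xy show ?thesis by simp
        next
          assume "x = a + 2"
          with q2[of y] xy show ?thesis by auto
        qed
      qed (use a in simp)
      with False show ?thesis unfolding mem_insert_pair_iff by blast
    qed
    moreover have "\<exists>x y. B = {x, y}" if "B \<in> q"
      using TL_diagramsD(1)[OF q that] by (elim exE conjE) (intro exI)
    moreover have "\<exists>x y. B = {x, y}" if B: "B \<in> insert_pair a p"
    proof (cases "B = {a + 1, a + 2}")
      case False
      then obtain C where C: "C \<in> p" "B = shift a ` C" using B by (auto simp: insert_pair_def)
      from p_blocks[OF C(1)] obtain c d where "C = {c, d}" by (elim exE conjE)
      then have "B = {shift a c, shift a d}" using C(2) by simp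
      then show ?thesis by (intro exI)
    qed (intro exI)
    ultimately show "B \<in> q \<longleftrightarrow> B \<in> insert_pair a p" by metis
  qed
  ultimately show ?thesis using that ak by blast
qed

section \<open>Vectors of diagrams\<close>

definition diagram_vector :: "nat \<Rightarrow> nat set set \<Rightarrow> 'n list \<Rightarrow> real" where
  "diagram_vector k p xs =
     (if length xs = 2 * k \<and> (\<forall>a b. {a, b} \<in> p \<longrightarrow> xs ! (a - 1) = xs ! (b - 1)) then 1 else 0)"

text \<open>This matches the recursive structure of diagrams with that of \<open>TL_vector\<close>
  and yields both inclusions between the Temperley-Lieb vectors and the span of the diagram
  vectors.\<close>

lemma diagram_vector_insert_pair:
  assumes p: "p \<in> TL_diagrams k" and a: "a \<le> 2 * k"
  shows "diagram_vector (k + 1) (insert_pair a p) = cup a (diagram_vector k p)"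
proof
  fix xs :: "'b list"
  show "diagram_vector (k + 1) (insert_pair a p) xs = cup a (diagram_vector k p) xs"
  proof (cases "length xs = 2 * k + 2")
    case False
    then show ?thesis using a by (auto simp: diagram_vector_def cup_def)
  next
    case True
    then have "a + 2 \<le> length xs" using a by simp
    then obtain x i j y where x: "xs = x @ i # j # y" "length x = a" by (rule list_split_pair)
    have nth: "xs ! (shift a r - 1) = (x @ y) ! (r - 1)" if "1 \<le> r" for r
      using that x by (auto simp: shift_def nth_append nth_Cons' Suc_diff_le)
    have "(\<forall>b c. {b, c} \<in> insert_pair a p \<longrightarrow> xs ! (b - 1) = xs ! (c - 1)) \<longleftrightarrow>
        i = j \<and> (\<forall>b c. {b, c} \<in> p \<longrightarrow> (x @ y) ! (b - 1) = (x @ y) ! (c - 1))" (is "?l \<longleftrightarrow> ?r")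
    proof
      assume l: ?l
      have "i = j" using l[rule_format, of "a + 1" "a + 2"] x by (simp add: insert_pair_def nth_append)
      moreover have "(x @ y) ! (b - 1) = (x @ y) ! (c - 1)" if bc: "{b, c} \<in> p" for b c
        using l[rule_format, of "shift a b" "shift a c"] bc TL_diagramsD(5)[OF p bc]
          nth[of b] nth[of c]
        by (simp add: shift_mem_insert_pair)
      ultimately show ?r by blast
    next
      assume r: ?r
      show ?l
      proof (intro allI impI)
        fix b c assume "{b, c} \<in> insert_pair a p"
        then consider "{b, c} = {a + 1, a + 2}"
          | r s where "b = shift a r" "c = shift a s" "{r, s} \<in> p"
          unfolding mem_insert_pair_iff by blast
        then show "xs ! (b - 1) = xs ! (c - 1)"
        proof cases
          case 1
          then show ?thesis using r x by (auto simp: doubleton_eq_iff nth_append)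
        next
          case 2
          then show ?thesis using r TL_diagramsD(5)[OF p 2(3)] nth[of r] nth[of s] by simp
        qed
      qed
    qed
    then show ?thesis
      unfolding diagram_vector_def using True x by (auto simp: cup_append)
  qed
qed

lemma TL_vector_diagram_vector: "p \<in> TL_diagrams k \<Longrightarrow> TL_vector (2 * k) (diagram_vector k p)"
proof (induction k arbitrary: p)
  case 0
  have "TL_vector 0 (diagram_vector 0 {})"
    by (rule TL_vector_eq[OF TL_unit]) (auto simp: diagram_vector_def)
  with 0 show ?case by (simp add: TL_diagrams_0)
next
  case (Suc k)
  then have "p \<in> TL_diagrams (k + 1)" by simp
  then obtain a p' where p': "a \<le> 2 * k" "p' \<in> TL_diagrams k" "p = insert_pair a p'"
    by (rule TL_diagrams_Suc)
  from TL_cup[OF Suc.IH[OF p'(2)] p'(1)] show ?case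
    by (simp add: diagram_vector_insert_pair[OF p'(2,1), symmetric] p'(3))
qed

lemma function_subspace_span: "function_subspace {f. \<exists>c. f = (\<lambda>x. \<Sum>a\<in>A. c a * v a x)}"
  unfolding function_subspace_def
proof (intro conjI ballI allI)
  show "(\<lambda>_. 0) \<in> {f. \<exists>c. f = (\<lambda>x. \<Sum>a\<in>A. c a * v a x)}" by (auto intro!: exI[of _ "\<lambda>_. 0"])
next
  fix f g assume "f \<in> {f. \<exists>c. f = (\<lambda>x. \<Sum>a\<in>A. c a * v a x)}" "g \<in> {f. \<exists>c. f = (\<lambda>x. \<Sum>a\<in>A. c a * v a x)}"
  then obtain c d where "f = (\<lambda>x. \<Sum>a\<in>A. c a * v a x)" "g = (\<lambda>x. \<Sum>a\<in>A. d a * v a x)" by blast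
  then show "(\<lambda>x. f x + g x) \<in> {f. \<exists>c. f = (\<lambda>x. \<Sum>a\<in>A. c a * v a x)}"
    by (auto intro!: exI[of _ "\<lambda>a. c a + d a"] simp: distrib_right sum.distrib)
next
  fix e f assume "f \<in> {f. \<exists>c. f = (\<lambda>x. \<Sum>a\<in>A. c a * v a x)}"
  then obtain c where "f = (\<lambda>x. \<Sum>a\<in>A. c a * v a x)" by blast
  then show "(\<lambda>x. e * f x) \<in> {f. \<exists>c. f = (\<lambda>x. \<Sum>a\<in>A. c a * v a x)}"
    by (auto intro!: exI[of _ "\<lambda>a. e * c a"] simp: sum_distrib_left mult.assoc)
qed

definition diagram_span :: "nat \<Rightarrow> ('n list \<Rightarrow> real) set" where
  "diagram_span k = {f. \<exists>c. f = (\<lambda>x. \<Sum>p\<in>TL_diagrams k. c p * diagram_vector k p x)}"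

lemma function_subspace_diagram_span: "function_subspace (diagram_span k)"
  unfolding diagram_span_def by (rule function_subspace_span)

lemma diagram_vector_in_span: "p \<in> TL_diagrams k \<Longrightarrow> diagram_vector k p \<in> diagram_span k"
  unfolding diagram_span_def
  by (intro CollectI exI[of _ "\<lambda>q. if q = p then 1 else 0"]) (auto simp: fun_eq_iff if_distrib[of "\<lambda>c. c * _"] cong: if_cong)

lemma TL_vector_in_diagram_span: "TL_vector m f \<Longrightarrow> m = 2 * k \<Longrightarrow> f \<in> diagram_span k"
proof (induction arbitrary: k rule: TL_vector.induct)
  case TL_unit
  then have "(\<lambda>xs :: 'a list. if xs = [] then 1 else 0) = diagram_vector k {}"
    by (auto simp: fun_eq_iff diagram_vector_def)
  moreover have "diagram_vector k {} \<in> diagram_span k"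
    by (rule diagram_vector_in_span) (use TL_unit in \<open>simp add: TL_diagrams_0\<close>)
  ultimately show ?case by simp
next
  case (TL_zero m)
  show ?case using function_subspace_diagram_span unfolding function_subspace_def by blast
next
  case (TL_add m f g)
  then show ?case using function_subspace_diagram_span[of k] unfolding function_subspace_def by blast
next
  case (TL_scale m f c)
  then show ?case using function_subspace_diagram_span[of k] unfolding function_subspace_def by blast
next
  case (TL_cup m f a)
  then obtain k' where k: "k = k' + 1" "m = 2 * k'" by (cases k) auto
  then obtain c where c: "f = (\<lambda>x. \<Sum>p\<in>TL_diagrams k'. c p * diagram_vector k' p x)"
    using TL_cup.IH by (auto simp: diagram_span_def)
  have a: "a \<le> 2 * k'" using TL_cup.hyps k by simp
  have "cup a f = (\<lambda>x. \<Sum>p\<in>TL_diagrams k'. c p * cup a (diagram_vector k' p) x)"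
    by (auto simp: c cup_def fun_eq_iff)
  also have "\<dots> = (\<lambda>x. \<Sum>p\<in>TL_diagrams k'. c p * diagram_vector k (insert_pair a p) x)"
    unfolding k by (intro ext sum.cong refl) (simp add: diagram_vector_insert_pair[OF _ a, symmetric])
  also have "\<dots> \<in> diagram_span k"
    unfolding k by (intro function_subspace_sum[OF function_subspace_diagram_span]
        diagram_vector_in_span insert_pair_TL_diagrams a)
  finally show ?case .
qed

section \<open>Linear independence\<close>

text \<open>The points enclosed by a pair are matched among themselves, so their number is even. In
  the induction, inserting a pair moves old points by 0 or 2 and adds two consecutive ones.\<close>

lemma TL_diagram_parity:
  "p \<in> TL_diagrams k \<Longrightarrow> {a, b} \<in> p \<Longrightarrow> even a \<longleftrightarrow> odd b"
proof (induction k arbitrary: p a b)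
  case 0
  then show ?case by (simp add: TL_diagrams_0)
next
  case (Suc k)
  then have "p \<in> TL_diagrams (k + 1)" by simp
  then obtain c p' where p': "p' \<in> TL_diagrams k" "p = insert_pair c p'" by (rule TL_diagrams_Suc)
  have "{a, b} \<in> insert_pair c p'" using Suc.prems(2) p'(2) by simp
  from this[unfolded mem_insert_pair_iff] consider "{a, b} = {c + 1, c + 2}"
    | r s where "a = shift c r" "b = shift c s" "{r, s} \<in> p'"
    by blast
  then show ?case
  proof cases
    case 1
    then show ?thesis by (auto simp: doubleton_eq_iff)
  next
    case 2
    then show ?thesis using Suc.IH[OF p'(1) 2(3)] by (simp add: shift_def)
  qed
qed

text \<open>The left ends of the pairs, that is, the up-steps of the Dyck path of a diagram.\<close>

definition openers :: "nat set set \<Rightarrow> nat set" where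
  "openers p = {a. \<exists>b>a. {a, b} \<in> p}"

lemma openers_subset: "p \<in> TL_diagrams k \<Longrightarrow> openers p \<subseteq> {1..2 * k}"
  using TL_diagramsD(5) unfolding openers_def by fastforce

lemma opener_iff:
  assumes p: "p \<in> TL_diagrams k" and ab: "{a, b} \<in> p"
  shows "a \<in> openers p \<longleftrightarrow> a < b"
proof
  assume "a \<in> openers p"
  then obtain c where c: "{a, c} \<in> p" "a < c" by (auto simp: openers_def)
  then show "a < b" using TL_diagramsD(3)[OF p ab c(1)] by simp
qed (use ab in \<open>auto simp: openers_def\<close>)

lemma TL_diagram_flip: "{a, b} \<in> p \<Longrightarrow> {b, a} \<in> p"
  by (subst insert_commute)

text \<open>As with parentheses, a closing point is matched with the latest opener that is still
  open. The induction runs over the right end of a pair.\<close>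

lemma TL_diagrams_eqI:
  assumes p: "p \<in> TL_diagrams k" and q: "q \<in> TL_diagrams k" and eq: "openers p = openers q"
  shows "p = q"
proof -
  \<comment> \<open>Here \<open>p\<close> and \<open>q\<close> are generalized, so that the step
    serves both inclusions.\<close>
  have step: "{a, b} \<in> q"
    if p: "p \<in> TL_diagrams k" and q: "q \<in> TL_diagrams k" and eq: "openers p = openers q"
      and IH: "\<And>a c. c < b \<Longrightarrow> a < c \<Longrightarrow> {a, c} \<in> p \<longleftrightarrow> {a, c} \<in> q"
      and ab: "{a, b} \<in> p" "a < b" for p q a b
  proof -
    have range: "1 \<le> a" "a \<le> 2 * k" "1 \<le> b" "b \<le> 2 * k" using TL_diagramsD(5)[OF p ab(1)] by auto
    obtain a' where "{b, a'} \<in> q" using TL_diagramsD(2)[OF q] range by blast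
    then have a': "{a', b} \<in> q" by (rule TL_diagram_flip)
    have "b \<notin> openers q"
      using opener_iff[OF p TL_diagram_flip[OF ab(1)]] ab(2) eq by simp
    then have "a' < b"
      using opener_iff[OF q TL_diagram_flip[OF a']] TL_diagramsD(5)[OF q a'] by auto
    \<comment> \<open>If \<open>a\<close> and \<open>a'\<close> differ, the one further right also
      opens a pair in the other diagram. That pair cannot end at \<open>b\<close>, nor earlier by
      the induction hypothesis, nor later without a crossing.\<close>
    consider "a' = a" | "a < a'" | "a' < a" by linarith
    then show ?thesis
    proof cases
      case 1
      with a' show ?thesis by simp
    next
      case 2
      have "a' \<in> openers p" using opener_iff[OF q a'] \<open>a' < b\<close> eq by simp
      then obtain c where c: "{a', c} \<in> p" "a' < c" by (auto simp: openers_def)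
      have "c \<noteq> b"
      proof
        assume "c = b"
        then have "{b, a'} \<in> p" using TL_diagram_flip[OF c(1)] by simp
        then have "a' = a" by (rule TL_diagramsD(3)[OF p _ TL_diagram_flip[OF ab(1)]])
        with 2 show False by simp
      qed
      moreover have "\<not> c < b"
      proof
        assume "c < b"
        then have "{a', c} \<in> q" using IH c by blast
        then have "c = b" by (rule TL_diagramsD(3)[OF q _ a'])
        with \<open>c < b\<close> show False by simp
      qed
      moreover have "\<not> b < c"
        using TL_diagramsD(4)[OF p 2 \<open>a' < b\<close>] ab(1) c(1) by blast
      ultimately show ?thesis by simp
    next
      case 3
      have "a \<in> openers q" using opener_iff[OF p ab(1)] ab(2) eq by simp
      then obtain c where c: "{a, c} \<in> q" "a < c" by (auto simp: openers_def)
      have "c \<noteq> b"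
      proof
        assume "c = b"
        then have "{b, a} \<in> q" using TL_diagram_flip[OF c(1)] by simp
        then have "a = a'" by (rule TL_diagramsD(3)[OF q _ TL_diagram_flip[OF a']])
        with 3 show False by simp
      qed
      moreover have "\<not> c < b"
      proof
        assume "c < b"
        then have "{a, c} \<in> p" using IH c by blast
        then have "c = b" by (rule TL_diagramsD(3)[OF p _ ab(1)])
        with \<open>c < b\<close> show False by simp
      qed
      moreover have "\<not> b < c"
        using TL_diagramsD(4)[OF q 3 ab(2)] a' c(1) by blast
      ultimately show ?thesis by simp
    qed
  qed
  have iff: "{a, b} \<in> p \<longleftrightarrow> {a, b} \<in> q" if "a < b" for a b
    using that
  proof (induction b arbitrary: a rule: less_induct)
    case (less b)
    show ?case
    proof
      assume "{a, b} \<in> p"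
      then show "{a, b} \<in> q" using less by (intro step[OF p q eq]) auto
    next
      assume "{a, b} \<in> q"
      then show "{a, b} \<in> p" using less by (intro step[OF q p eq[symmetric]]) auto
    qed
  qed
  show ?thesis
  proof (rule set_eqI)
    fix B
    have "\<exists>a b. B = {a, b} \<and> a < b" if "B \<in> p" using TL_diagramsD(1)[OF p that] by (elim exE conjE) (intro exI conjI)
    moreover have "\<exists>a b. B = {a, b} \<and> a < b" if "B \<in> q" using TL_diagramsD(1)[OF q that] by (elim exE conjE) (intro exI conjI)
    ultimately show "B \<in> p \<longleftrightarrow> B \<in> q" using iff by metis
  qed
qed

lemma sum_over_blocks:
  fixes f :: "nat \<Rightarrow> nat"
  assumes q: "q \<in> TL_diagrams k" and A: "A \<subseteq> {1..2 * k}"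
  shows "sum f A = (\<Sum>B\<in>q. sum f (B \<inter> A))"
proof -
  have U: "\<Union>q = {1..2 * k}" and disj: "disjoint q"
    using q by (auto simp: TL_diagrams_def partition_on_def)
  have fin: "finite q" by (rule finite_UnionD) (simp add: U)
  have "A = (\<Union>B\<in>q. B \<inter> A)" using A U by blast
  also have "sum f \<dots> = (\<Sum>B\<in>q. sum f (B \<inter> A))"
  proof (rule sum.UNION_disjoint[OF fin])
    show "\<forall>B\<in>q. finite (B \<inter> A)" using finite_subset[OF A] by simp
    show "\<forall>B\<in>q. \<forall>C\<in>q. B \<noteq> C \<longrightarrow> (B \<inter> A) \<inter> (C \<inter> A) = {}" using disjointD[OF disj] by blast
  qed
  finally show ?thesis .
qed

text \<open>
  If every pair of \<open>q\<close> contains exactly one opener of \<open>p\<close>, then the openers of \<open>p\<close> arise from those of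
  \<open>q\<close> by moving some of them to the right.
\<close>

lemma openers_eqI:
  assumes p: "p \<in> TL_diagrams k" and q: "q \<in> TL_diagrams k"
    and compat: "\<And>a b. {a, b} \<in> q \<Longrightarrow> a \<in> openers p \<longleftrightarrow> b \<notin> openers p"
    and le: "\<Sum>(openers p) \<le> \<Sum>(openers q)"
  shows "openers p = openers q"
proof -
  have block: "\<exists>a b. a < b \<and> B \<inter> openers q = {a} \<and> (B \<inter> openers p = {a} \<or> B \<inter> openers p = {b})"
    if B: "B \<in> q" for B
  proof -
    obtain a b where ab: "B = {a, b}" "a < b" using TL_diagramsD(1)[OF q B] by (elim exE conjE)
    have abq: "{a, b} \<in> q" using B ab by simp
    have "a \<in> openers q" "b \<notin> openers q"
      using opener_iff[OF q abq] opener_iff[OF q TL_diagram_flip[OF abq]] ab(2) by simp_all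
    moreover note compat[OF abq]
    ultimately have *: "B \<inter> openers q = {a}" "B \<inter> openers p = {a} \<or> B \<inter> openers p = {b}" using ab by auto
    show ?thesis by (rule exI[of _ a], rule exI[of _ b]) (intro conjI ab(2) *)
  qed
  have fin: "finite q"
  proof (rule finite_UnionD)
    have "\<Union>q = {1..2 * k}" using q by (simp add: TL_diagrams_def partition_on_def)
    then show "finite (\<Union>q)" by simp
  qed
  have "B \<inter> openers p = B \<inter> openers q" if B: "B \<in> q" for B
  proof (rule ccontr)
    assume ne: "B \<inter> openers p \<noteq> B \<inter> openers q"
    \<comment> \<open>In a block where the two sets differ, \<open>p\<close> selects the right end
      and \<open>q\<close> the left end. This makes the weight of \<open>p\<close> strictly larger,
      against \<open>le\<close>.\<close>
    have "(\<Sum>B\<in>q. \<Sum>(B \<inter> openers q)) < (\<Sum>B\<in>q. \<Sum>(B \<inter> openers p))"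
    proof (rule sum_strict_mono_ex1[OF fin])
      show "\<forall>B\<in>q. \<Sum>(B \<inter> openers q) \<le> \<Sum>(B \<inter> openers p)"
      proof
        fix B assume "B \<in> q"
        from block[OF this] show "\<Sum>(B \<inter> openers q) \<le> \<Sum>(B \<inter> openers p)" by (elim exE conjE disjE) simp_all
      qed
      from block[OF B] ne have "\<Sum>(B \<inter> openers q) < \<Sum>(B \<inter> openers p)"
        by (elim exE conjE disjE) simp_all
      with B show "\<exists>B\<in>q. \<Sum>(B \<inter> openers q) < \<Sum>(B \<inter> openers p)" by (intro bexI)
    qed
    then show False
      using le sum_over_blocks[OF q openers_subset[OF p], of "\<lambda>x. x"] sum_over_blocks[OF q openers_subset[OF q], of "\<lambda>x. x"]
      by simp
  qed
  then have "(\<Union>B\<in>q. B \<inter> openers p) = (\<Union>B\<in>q. B \<inter> openers q)" by (rule SUP_cong[OF refl])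
  moreover have "(\<Union>B\<in>q. B \<inter> A) = A" if "A \<subseteq> {1..2 * k}" for A
  proof -
    have "\<Union>q = {1..2 * k}" using q by (simp add: TL_diagrams_def partition_on_def)
    with that show ?thesis by blast
  qed
  ultimately show ?thesis using openers_subset[OF p] openers_subset[OF q] by simp
qed

text \<open>
  A non-crossing pair joins an odd to an even position, so negating the opener labels of \<open>p\<close> at odd
  positions turns "both ends of a pair carry opposite labels" into "both ends agree". The vectors
  are then triangular for the weight \<open>\<Sum>(openers p)\<close>.
\<close>

theorem diagram_vectors_independent:
  fixes c :: "nat set set \<Rightarrow> real"
  assumes n: "CARD('n::finite) \<ge> 2"
    and zero: "\<And>xs :: 'n list. (\<Sum>p\<in>TL_diagrams k. c p * diagram_vector k p xs) = 0"
    and p: "p \<in> TL_diagrams k"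
  shows "c p = 0"
proof (rule ccontr)
  assume "c p \<noteq> 0"
  with p have "\<exists>p. p \<in> TL_diagrams k \<and> c p \<noteq> 0" by blast
  from ex_has_least_nat[of "\<lambda>p. p \<in> TL_diagrams k \<and> c p \<noteq> 0", where m = "\<lambda>p. \<Sum>(openers p)"] this
  obtain p where p: "p \<in> TL_diagrams k" "c p \<noteq> 0"
    and min: "\<And>q. q \<in> TL_diagrams k \<Longrightarrow> c q \<noteq> 0 \<Longrightarrow> \<Sum>(openers p) \<le> \<Sum>(openers q)" by blast
  have "\<not> card (UNIV :: 'n set) \<le> Suc 0" using n by simp
  \<comment> \<open>The test word needs two distinct letters; this is where n \<ge> 2
    enters.\<close>
  then obtain s t :: 'n where st: "s \<noteq> t" by (auto simp: card_le_Suc0_iff_eq)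
  define f where "f = (\<lambda>r :: nat. if (r \<in> openers p) = even r then s else t)"
  define xs where "xs = map f [1..<2 * k + 1]"
  have nth: "xs ! (r - 1) = f r" if "1 \<le> r" "r \<le> 2 * k" for r
    using that unfolding xs_def by (subst nth_map) (auto simp del: upt_Suc)
  have pair: "xs ! (a - 1) = xs ! (b - 1) \<longleftrightarrow> (a \<in> openers p \<longleftrightarrow> b \<notin> openers p)"
    if q: "q \<in> TL_diagrams k" and ab: "{a, b} \<in> q" for q a b
  proof -
    have "xs ! (a - 1) = f a" "xs ! (b - 1) = f b" using TL_diagramsD(5)[OF q ab] nth[of a] nth[of b] by simp_all
    moreover have "f a = f b \<longleftrightarrow> ((a \<in> openers p) = even a) = ((b \<in> openers p) = even b)"
      using st by (auto simp: f_def)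
    ultimately show ?thesis using TL_diagram_parity[OF q ab] by auto
  qed
  \<comment> \<open>A diagram \<open>q\<close> with a nonzero term has exactly one opener of
    \<open>p\<close> in each of its pairs, and by the choice of \<open>p\<close> its weight is at
    least that of \<open>p\<close>. Then \<open>openers_eqI\<close> identifies them, so only the
    term of \<open>p\<close> survives at this word.\<close>
  have "c q * diagram_vector k q xs = (if q = p then c p else 0)" if q: "q \<in> TL_diagrams k" for q
  proof (cases "q = p")
    case True
    have "xs ! (a - 1) = xs ! (b - 1)" if ab: "{a, b} \<in> p" for a b
      using opener_iff[OF p(1) ab] opener_iff[OF p(1) TL_diagram_flip[OF ab]] TL_diagramsD(5)[OF p(1) ab]
      unfolding pair[OF p(1) ab] by auto
    then show ?thesis using True by (simp add: diagram_vector_def xs_def)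
  next
    case False
    have "diagram_vector k q xs = 0 \<or> c q = 0"
    proof (rule ccontr)
      assume *: "\<not> (diagram_vector k q xs = 0 \<or> c q = 0)"
      then have "xs ! (a - 1) = xs ! (b - 1)" if "{a, b} \<in> q" for a b
        using that by (auto simp: diagram_vector_def split: if_splits)
      then have "a \<in> openers p \<longleftrightarrow> b \<notin> openers p" if "{a, b} \<in> q" for a b
        using that pair[OF q that] by blast
      then have "openers p = openers q"
        by (rule openers_eqI[OF p(1) q]) (use * min[OF q] in auto)
      then show False using TL_diagrams_eqI[OF p(1) q] False by simp
    qed
    with False show ?thesis by auto
  qed
  then have "(\<Sum>q\<in>TL_diagrams k. c q * diagram_vector k q xs) = (\<Sum>q\<in>TL_diagrams k. if q = p then c p else 0)"
    by (rule sum.cong[OF refl])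
  with zero[of xs] p show False by simp
qed

section \<open>The Weingarten formula\<close>

text \<open>The product of the two vectors is the indicator of the words that are constant along the
  edges of both diagrams, and such a word is a free choice of one letter per connected
  component.\<close>

lemma sum_diagram_vectors:
  fixes p q :: "nat set set"
  assumes p: "p \<in> TL_diagrams k" and q: "q \<in> TL_diagrams k"
  shows "(\<Sum>xs | length xs = 2 * k. diagram_vector k p xs * diagram_vector k q (xs :: 'n::finite list)) =
    real CARD('n) ^ loops k p q"
proof -
  define E where "E = {(a, b). {a, b} \<in> p \<union> q}"
  define A where "A = {1..2 * k}"
  define Q where "Q = A // E\<^sup>*"
  define L where "L = {xs :: 'n list. length xs = 2 * k \<and> (\<forall>a b. (a, b) \<in> E \<longrightarrow> xs ! (a - 1) = xs ! (b - 1))}"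
  define m where "m = (\<lambda>g :: nat set \<Rightarrow> 'n. map (\<lambda>r. g (E\<^sup>* `` {r})) [1..<2 * k + 1])"
  have E_A: "a \<in> A \<and> b \<in> A" if "(a, b) \<in> E" for a b
    using that TL_diagramsD(5)[OF p, of a b] TL_diagramsD(5)[OF q, of a b] by (auto simp: E_def A_def)
  have symE: "sym E" by (auto simp: sym_def E_def insert_commute)
  have nth: "m g ! (r - 1) = g (E\<^sup>* `` {r})" if "r \<in> A" for g r
    using that unfolding m_def A_def by (subst nth_map) (auto simp del: upt_Suc)
  have mem_Q: "E\<^sup>* `` {r} \<in> Q" if "r \<in> A" for r using that by (simp add: Q_def quotientI)
  have Q_cases: "\<exists>r\<in>A. C = E\<^sup>* `` {r}" if "C \<in> Q" for C using that by (auto simp: Q_def elim: quotientE)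
  have finQ: "finite Q" using finite_imageI[of A "\<lambda>r. E\<^sup>* `` {r}"] Q_cases
    by (rule_tac finite_subset[of _ "(\<lambda>r. E\<^sup>* `` {r}) ` A"]) (auto simp: A_def)
  have "inj_on m (PiE Q (\<lambda>_. UNIV))"
  proof (rule inj_onI)
    fix g g' assume g: "g \<in> PiE Q (\<lambda>_. UNIV)" "g' \<in> PiE Q (\<lambda>_. UNIV)" and eq: "m g = m g'"
    show "g = g'"
    proof (rule PiE_ext[OF g])
      fix C assume "C \<in> Q"
      then obtain r where "r \<in> A" "C = E\<^sup>* `` {r}" using Q_cases by blast
      then show "g C = g' C" using nth[of r g] nth[of r g'] eq by simp
    qed
  qed
  moreover have "m ` PiE Q (\<lambda>_. UNIV) = L"
  proof (rule set_eqI, rule iffI)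
    fix xs assume "xs \<in> m ` PiE Q (\<lambda>_. UNIV)"
    then obtain g where g: "xs = m g" by blast
    have "xs ! (a - 1) = xs ! (b - 1)" if ab: "(a, b) \<in> E" for a b
    proof -
      have "(b, a) \<in> E" using symE ab by (rule symD)
      then have "E\<^sup>* `` {a} = E\<^sup>* `` {b}"
        using ab by (auto intro: converse_rtrancl_into_rtrancl)
      then show ?thesis using E_A[OF ab] nth[of a g] nth[of b g] by (simp add: g)
    qed
    then show "xs \<in> L" by (simp add: L_def g m_def)
  next
    fix xs assume xs: "xs \<in> L"
    have const: "xs ! (r - 1) = xs ! (s - 1)" if "(r, s) \<in> E\<^sup>*" for r s
      using that
    proof (induction rule: rtrancl_induct)
      case (step y z)
      then show ?case using xs unfolding L_def by simp
    qed simp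
    \<comment> \<open>The letter of a component is read off at an arbitrary one of its points; by
      \<open>const\<close> all of them carry the same letter.\<close>
    define g where "g = restrict (\<lambda>C. xs ! ((SOME r. r \<in> C) - 1)) Q"
    have "g (E\<^sup>* `` {r}) = xs ! (r - 1)" if r: "r \<in> A" for r
    proof -
      have "(SOME s. s \<in> E\<^sup>* `` {r}) \<in> E\<^sup>* `` {r}" by (rule someI[of _ r]) simp
      then have "(r, SOME s. s \<in> E\<^sup>* `` {r}) \<in> E\<^sup>*" by simp
      from const[OF this] show ?thesis by (simp add: g_def mem_Q[OF r])
    qed
    then have "xs = m g"
      using xs nth[of _ g] by (intro nth_equalityI) (auto simp: L_def m_def A_def simp del: upt_Suc)
    moreover have "g \<in> PiE Q (\<lambda>_. UNIV)" by (simp add: g_def)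
    ultimately show "xs \<in> m ` PiE Q (\<lambda>_. UNIV)" by (rule image_eqI)
  qed
  ultimately have card: "card L = CARD('n) ^ loops k p q"
    using card_image[of m "PiE Q (\<lambda>_. UNIV)"] card_PiE[OF finQ, of "\<lambda>_. UNIV :: 'n set"]
    by (simp add: loops_def Q_def A_def E_def)
  have "(\<Sum>xs | length xs = 2 * k. diagram_vector k p xs * diagram_vector k q (xs :: 'n list)) =
      (\<Sum>xs | length xs = 2 * k. if xs \<in> L then 1 else 0)"
    by (rule sum.cong[OF refl]) (auto simp: diagram_vector_def L_def E_def)
  also have "\<dots> = (\<Sum>xs\<in>L. 1)"
    by (rule sum.mono_neutral_cong_right) (auto simp: L_def)
  finally show ?thesis using card by simp
qed

lemma matrix_inverse_on_eqI:
  assumes fin: "finite I"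
    and zero: "\<And>p q. p \<notin> I \<or> q \<notin> I \<Longrightarrow> W p q = 0"
    and right: "\<And>p q. p \<in> I \<Longrightarrow> q \<in> I \<Longrightarrow> (\<Sum>r\<in>I. G p r * W r q) = (if p = q then 1 else 0)"
    and left: "\<And>p q. p \<in> I \<Longrightarrow> q \<in> I \<Longrightarrow> (\<Sum>r\<in>I. W p r * G r q) = (if p = q then 1 else 0)"
  shows "matrix_inverse_on I G = W"
  unfolding matrix_inverse_on_def
proof (rule the_equality)
  fix V assume V: "(\<forall>p q. p \<notin> I \<or> q \<notin> I \<longrightarrow> V p q = 0) \<and>
    (\<forall>p\<in>I. \<forall>q\<in>I. (\<Sum>r\<in>I. G p r * V r q) = (if p = q then 1 else 0)) \<and>
    (\<forall>p\<in>I. \<forall>q\<in>I. (\<Sum>r\<in>I. V p r * G r q) = (if p = q then 1 else 0))"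
  show "V = W"
  proof (intro ext)
    fix p q
    show "V p q = W p q"
    proof (cases "p \<in> I \<and> q \<in> I")
      case False
      then show ?thesis using V zero by metis
    next
      case True
      have "V p q = (\<Sum>r\<in>I. V p r * (if r = q then 1 else 0))"
        using True fin by (simp add: if_distrib cong: if_cong)
      also have "\<dots> = (\<Sum>r\<in>I. V p r * (\<Sum>s\<in>I. G r s * W s q))"
        by (rule sum.cong[OF refl]) (use True right in simp)
      also have "\<dots> = (\<Sum>s\<in>I. (\<Sum>r\<in>I. V p r * G r s) * W s q)"
        unfolding sum_distrib_left sum_distrib_right by (subst sum.swap) (simp add: mult.assoc)
      also have "\<dots> = (\<Sum>s\<in>I. (if p = s then 1 else 0) * W s q)"
        by (rule sum.cong[OF refl]) (use True V in simp)
      also have "\<dots> = W p q"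
        using True fin by (simp add: if_distrib[of "\<lambda>c. c * _"] cong: if_cong)
      finally show ?thesis .
    qed
  qed
qed (use zero right left in blast)

text \<open>Expanding an orthonormal basis in diagram vectors gives Q a coefficient matrix W. That Q
  fixes every diagram vector then means, by linear independence, that W is a left inverse of the
  Gram matrix.\<close>

theorem TL_kernel_weingarten:
  fixes xs ys :: "'n::finite list"
  assumes n: "CARD('n) \<ge> 2"
  shows "of_real (TL_kernel (2 * k) xs ys) =
    (\<Sum>p\<in>TL_diagrams k. \<Sum>q\<in>TL_diagrams k.
       of_real (diagram_vector k p xs) * of_real (diagram_vector k q ys) * weingarten k CARD('n) p q)"
proof -
  let ?D = "TL_diagrams k"
  define B where "B = (TL_basis (2 * k) :: ('n list \<Rightarrow> real) set)"
  have "\<forall>b\<in>B. \<exists>c. b = (\<lambda>x. \<Sum>p\<in>?D. c p * diagram_vector k p x)"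
  proof
    fix b assume "b \<in> B"
    then have "TL_vector (2 * k) b" using orthonormal_basisD(2)[OF TL_basis] by (auto simp: B_def)
    then have "b \<in> diagram_span k" by (rule TL_vector_in_diagram_span) simp
    then show "\<exists>c. b = (\<lambda>x. \<Sum>p\<in>?D. c p * diagram_vector k p x)" unfolding diagram_span_def by simp
  qed
  then obtain c where "\<forall>b\<in>B. b = (\<lambda>x. \<Sum>p\<in>?D. c b p * diagram_vector k p x)" by (rule bchoice[THEN exE])
  then have c: "b x = (\<Sum>p\<in>?D. c b p * diagram_vector k p x)" if "b \<in> B" for b x
    using that by (metis (no_types, lifting))
  define W where "W = (\<lambda>p q. \<Sum>b\<in>B. c b p * c b q)"
  define G where "G = (\<lambda>p q. real CARD('n) ^ loops k p q)"
  have W_sym: "W p q = W q p" for p q by (simp add: W_def mult.commute)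
  have G: "G p q = (\<Sum>xs | length xs = 2 * k. diagram_vector k p xs * diagram_vector k q (xs :: 'n list))"
    if "p \<in> ?D" "q \<in> ?D" for p q
    unfolding G_def by (rule sum_diagram_vectors[OF that, symmetric])
  have G_sym: "G p q = G q p" if "p \<in> ?D" "q \<in> ?D" for p q
    using that by (simp add: G mult.commute)
  have kernel: "TL_kernel (2 * k) x y = (\<Sum>p\<in>?D. \<Sum>q\<in>?D. W p q * diagram_vector k p x * diagram_vector k q y)"
    for x y :: "'n list"
  proof -
    have "TL_kernel (2 * k) x y = (\<Sum>b\<in>B. (\<Sum>p\<in>?D. c b p * diagram_vector k p x) * (\<Sum>q\<in>?D. c b q * diagram_vector k q y))"
      unfolding TL_kernel_def B_def[symmetric] by (rule sum.cong[OF refl]) (simp only: c)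
    also have "\<dots> = (\<Sum>b\<in>B. \<Sum>p\<in>?D. \<Sum>q\<in>?D. c b p * c b q * diagram_vector k p x * diagram_vector k q y)"
      by (simp add: sum_product mult_ac)
    also have "\<dots> = (\<Sum>p\<in>?D. \<Sum>b\<in>B. \<Sum>q\<in>?D. c b p * c b q * diagram_vector k p x * diagram_vector k q y)"
      by (rule sum.swap)
    also have "\<dots> = (\<Sum>p\<in>?D. \<Sum>q\<in>?D. \<Sum>b\<in>B. c b p * c b q * diagram_vector k p x * diagram_vector k q y)"
      by (rule sum.cong[OF refl], rule sum.swap)
    finally show ?thesis by (simp only: W_def sum_distrib_right)
  qed
  have left: "(\<Sum>r\<in>?D. W p r * G r q) = (if p = q then 1 else 0)" if p: "p \<in> ?D" and q: "q \<in> ?D" for p q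
  proof -
    have "(\<Sum>p\<in>?D. ((\<Sum>r\<in>?D. W p r * G r q) - (if p = q then 1 else 0)) * diagram_vector k p x) = 0"
      for x :: "'n list"
    proof -
      have "diagram_vector k q x = (\<Sum>y | length y = 2 * k. TL_kernel (2 * k) x y * diagram_vector k q y)"
        by (rule TL_kernel_apply[OF TL_vector_diagram_vector[OF q], symmetric])
      also have "\<dots> = (\<Sum>y | length (y :: 'n list) = 2 * k. \<Sum>p\<in>?D. \<Sum>r\<in>?D.
          W p r * diagram_vector k p x * (diagram_vector k r y * diagram_vector k q y))"
        by (simp only: kernel sum_distrib_right mult.assoc)
      also have "\<dots> = (\<Sum>p\<in>?D. \<Sum>y | length (y :: 'n list) = 2 * k. \<Sum>r\<in>?D.
          W p r * diagram_vector k p x * (diagram_vector k r y * diagram_vector k q y))"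
        by (rule sum.swap)
      also have "\<dots> = (\<Sum>p\<in>?D. \<Sum>r\<in>?D. \<Sum>y | length (y :: 'n list) = 2 * k.
          W p r * diagram_vector k p x * (diagram_vector k r y * diagram_vector k q y))"
        by (rule sum.cong[OF refl], rule sum.swap)
      also have "\<dots> = (\<Sum>p\<in>?D. \<Sum>r\<in>?D. W p r * diagram_vector k p x * G r q)"
        by (intro sum.cong refl) (simp add: sum_distrib_left[symmetric] G q)
      also have "\<dots> = (\<Sum>p\<in>?D. (\<Sum>r\<in>?D. W p r * G r q) * diagram_vector k p x)"
        unfolding sum_distrib_right by (simp only: mult_ac)
      finally have "(\<Sum>p\<in>?D. (\<Sum>r\<in>?D. W p r * G r q) * diagram_vector k p x) = diagram_vector k q x" ..
      moreover have "(\<Sum>p\<in>?D. (if p = q then 1 else 0) * diagram_vector k p x) = diagram_vector k q x"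
        using q by (simp add: if_distrib[of "\<lambda>c. c * _"] cong: if_cong)
      ultimately show ?thesis by (simp add: left_diff_distrib sum_subtractf)
    qed
    from diagram_vectors_independent[OF n this p] show ?thesis by simp
  qed
  \<comment> \<open>Both matrices are symmetric, so this is the transpose of
    \<open>left\<close>.\<close>
  have right: "(\<Sum>r\<in>?D. G p r * W r q) = (if p = q then 1 else 0)" if p: "p \<in> ?D" and q: "q \<in> ?D" for p q
  proof -
    have "(\<Sum>r\<in>?D. G p r * W r q) = (\<Sum>r\<in>?D. W q r * G r p)"
      by (rule sum.cong[OF refl]) (simp add: G_sym[OF p] W_sym[of q])
    then show ?thesis using left[OF q p] by auto
  qed
  \<comment> \<open>The coefficients \<open>c b p\<close> are arbitrary for \<open>p\<close> outside
    the diagrams, whereas the inverse is 0 there by convention; hence the case distinction.\<close>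
  have "weingarten k CARD('n) = (\<lambda>p q. if p \<in> ?D \<and> q \<in> ?D then of_real (W p q) else 0)"
    unfolding weingarten_def
  proof (rule matrix_inverse_on_eqI)
    fix p q assume pq: "p \<in> ?D" "q \<in> ?D"
    have gram: "gram k CARD('n) r s = of_real (G r s)" for r s by (simp add: gram_def G_def)
    have "(\<Sum>r\<in>?D. gram k CARD('n) p r * (if r \<in> ?D \<and> q \<in> ?D then of_real (W r q) else 0)) =
        of_real (\<Sum>r\<in>?D. G p r * W r q)"
      unfolding of_real_sum by (rule sum.cong[OF refl]) (simp add: gram pq)
    then show "(\<Sum>r\<in>?D. gram k CARD('n) p r * (if r \<in> ?D \<and> q \<in> ?D then of_real (W r q) else 0)) =
        (if p = q then 1 else 0)" using right[OF pq] by simp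
    have "(\<Sum>r\<in>?D. (if p \<in> ?D \<and> r \<in> ?D then of_real (W p r) else 0) * gram k CARD('n) r q) =
        of_real (\<Sum>r\<in>?D. W p r * G r q)"
      unfolding of_real_sum by (rule sum.cong[OF refl]) (simp add: gram pq)
    then show "(\<Sum>r\<in>?D. (if p \<in> ?D \<and> r \<in> ?D then of_real (W p r) else 0) * gram k CARD('n) r q) =
        (if p = q then 1 else 0)" using left[OF pq] by simp
  qed auto
  then show ?thesis
    unfolding kernel of_real_sum by (intro sum.cong refl) simp
qed

theorem theorem4p1:
  fixes u :: "'n::finite \<Rightarrow> 'n \<Rightarrow> 'a::unital_cstar_algebra"
    and \<tau> :: "'a \<Rightarrow> 'a \<Rightarrow> 't::unital_cstar_algebra"
    and \<Delta> :: "'a \<Rightarrow> 't"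
    and h :: "'a \<Rightarrow> complex"
  assumes "CARD('n) \<ge> 2"
    and "is_A_o u"
    and "is_cstar_tensor \<tau>"
    and "is_comultiplication u \<tau> \<Delta>"
    and "is_haar_functional \<tau> \<Delta> h"
  shows "(\<forall>k\<ge>1. \<forall>i j :: nat \<Rightarrow> 'n.
            h (prod_list (map (\<lambda>r. u (i r) (j r)) [1..<2 * k + 1])) =
            (\<Sum>p\<in>TL_diagrams k. \<Sum>q\<in>TL_diagrams k.
               diagram_delta p i * diagram_delta q j * weingarten k CARD('n) p q)) \<and>
         (\<forall>k. \<forall>i j :: nat \<Rightarrow> 'n.
            h (prod_list (map (\<lambda>r. u (i r) (j r)) [1..<2 * k + 2])) = 0)"
proof -
  \<comment> \<open>Stated for any number \<open>m\<close> of factors; the values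
    \<open>2 * k\<close> and \<open>2 * k + 1\<close> give the two claims.\<close>
  have moment: "h (prod_list (map (\<lambda>r. u (i r) (j r)) [1..<m + 1])) =
      of_real (TL_kernel m (map i [1..<m + 1]) (map j [1..<m + 1]))" for m and i j :: "nat \<Rightarrow> 'n"
    using haar_functional_eq_TL_kernel[OF assms(2-5), of "map i [1..<m + 1]" m "map j [1..<m + 1]"]
    by (simp add: coefficient_def map2_map_map del: upt_Suc)
  have delta: "of_real (diagram_vector k p (map i [1..<2 * k + 1])) = diagram_delta p i"
    if p: "p \<in> TL_diagrams k" for k p and i :: "nat \<Rightarrow> 'n"
  proof -
    have "map i [1..<2 * k + 1] ! (a - 1) = i a" if "1 \<le> a" "a \<le> 2 * k" for a
      using that by (subst nth_map) (auto simp del: upt_Suc)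
    then have "map i [1..<2 * k + 1] ! (a - 1) = i a \<and> map i [1..<2 * k + 1] ! (b - 1) = i b"
      if "{a, b} \<in> p" for a b
      using TL_diagramsD(5)[OF p that] by blast
    then have "(\<forall>a b. {a, b} \<in> p \<longrightarrow> map i [1..<2 * k + 1] ! (a - 1) = map i [1..<2 * k + 1] ! (b - 1)) \<longleftrightarrow>
        (\<forall>a b. {a, b} \<in> p \<longrightarrow> i a = i b)"
      by metis
    then show ?thesis unfolding diagram_vector_def diagram_delta_def by (simp del: upt_Suc)
  qed
  have "h (prod_list (map (\<lambda>r. u (i r) (j r)) [1..<2 * k + 1])) =
      (\<Sum>p\<in>TL_diagrams k. \<Sum>q\<in>TL_diagrams k.
         diagram_delta p i * diagram_delta q j * weingarten k CARD('n) p q)" for k i j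
    unfolding moment TL_kernel_weingarten[OF assms(1)] by (intro sum.cong refl) (simp only: delta)
  moreover have "h (prod_list (map (\<lambda>r. u (i r) (j r)) [1..<2 * k + 2])) = 0" for k i j
    using moment[of i j "2 * k + 1"] by (simp add: TL_kernel_odd del: upt_Suc)
  ultimately show ?thesis by blast
qed

end
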